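(* Let $n,k\in\mathbb{N}$, $n<p<\infty$ and $s=1-\frac np$. Let $V,\widetilde V,W$ be finite dimensional real inner product spaces, let $\mathscr{A}\colon V\to\widetilde V$ be a linear map and let $\mathbb{B}=\sum_{|\alpha|=k}\mathbb{B}_\alpha\partial^\alpha$ be a $k$-th order, linear, homogeneous, constant coefficient differential operator on $\mathbb{R}^n$ from $V$ to $W$ such that $$\bigcup_{\xi\in\mathbb{R}^n\setminus\{0\}}\ker\mathscr{A}\cap\ker(\mathbb{B}[\xi])=\{0\}.$$ Then there exists a constant $c>0$ such that $$\|\mathrm D^{k-1}P\|_{\dot{\mathrm C}^{0,s}(\mathbb{R}^n)}\le c\,\Big(\|\mathrm D^{k-1}\mathscr{A}[P]\|_{\dot{\mathrm C}^{0,s}(\mathbb{R}^n)}+\|\mathbb{B}P\|_{\mathrm L^p(\mathbb{R}^n)}\Big)$$ holds for all $P\in\mathrm C_c^\infty(\mathbb{R}^n;V)$.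
   Context: Differential operator: $\mathbb{B}P=\sum_{|\alpha|=k}\mathbb{B}_\alpha\partial^\alpha P$ with fixed linear maps $\mathbb{B}_\alpha\colon V\to W$; its symbol is $\mathbb{B}[\xi]=\sum_{|\alpha|=k}\xi^\alpha\mathbb{B}_\alpha\colon V\to W$. $\mathscr{A}[P]$ denotes pointwise application of $\mathscr{A}$. $\|u\|_{\dot{\mathrm C}^{0,s}(\mathbb{R}^n)}=\sup_{x\ne y}|u(x)-u(y)|/|x-y|^s$ is the homogeneous Hölder seminorm, and $\mathrm D^{k-1}$ is the collection of all partial derivatives of order $k-1$. *)

theory Defs
  imports "HOL-Analysis.Analysis"
begin

text \<open>Unlike the class \<open>euclidean_space\<close>, this also admits the zero space.\<close>

definition finite_dimensional :: "'v::real_vector itself \<Rightarrow> bool" where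
  "finite_dimensional _ \<longleftrightarrow> (\<exists>B :: 'v set. finite B \<and> span B = UNIV)"

definition partial_deriv ::
  "'n::finite \<Rightarrow> (real ^ 'n \<Rightarrow> 'v::real_normed_vector) \<Rightarrow> real ^ 'n \<Rightarrow> 'v" where
  "partial_deriv i f x = vector_derivative (\<lambda>t. f (x + t *\<^sub>R axis i 1)) (at 0)"

definition iter_partial ::
  "'n::finite list \<Rightarrow> (real ^ 'n \<Rightarrow> 'v::real_normed_vector) \<Rightarrow> real ^ 'n \<Rightarrow> 'v" where
  "iter_partial is f = foldr partial_deriv is f"

definition multi_indices :: "nat \<Rightarrow> ('n::finite \<Rightarrow> nat) set" where
  "multi_indices m = {\<alpha>. (\<Sum>i\<in>UNIV. \<alpha> i) = m}"

text \<open>The coordinates carry no canonical order, so the order of differentiation in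
  \<open>\<partial>\<^sup>\<alpha>\<close> is chosen arbitrarily; on smooth functions it is irrelevant by Schwarz's theorem.\<close>

definition multi_partial ::
  "('n::finite \<Rightarrow> nat) \<Rightarrow> (real ^ 'n \<Rightarrow> 'v::real_normed_vector) \<Rightarrow> real ^ 'n \<Rightarrow> 'v" where
  "multi_partial \<alpha> = iter_partial (SOME is. \<forall>i. count_list is i = \<alpha> i)"

definition smooth :: "(real ^ 'n::finite \<Rightarrow> 'v::real_normed_vector) \<Rightarrow> bool" where
  "smooth f \<longleftrightarrow> (\<forall>is x. iter_partial is f differentiable (at x))"

definition test_functions :: "(real ^ 'n::finite \<Rightarrow> 'v::real_normed_vector) set" where
  "test_functions = {f. smooth f \<and> compact (closure {x. f x \<noteq> 0})}"

definition diff_op ::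
  "nat \<Rightarrow> (('n::finite \<Rightarrow> nat) \<Rightarrow> 'v \<Rightarrow> 'w) \<Rightarrow>
   (real ^ 'n \<Rightarrow> 'v::real_normed_vector) \<Rightarrow> real ^ 'n \<Rightarrow> 'w::real_normed_vector" where
  "diff_op k BB P x = (\<Sum>\<alpha>\<in>multi_indices k. BB \<alpha> (multi_partial \<alpha> P x))"

definition symbol ::
  "nat \<Rightarrow> (('n::finite \<Rightarrow> nat) \<Rightarrow> 'v \<Rightarrow> 'w) \<Rightarrow> real ^ 'n \<Rightarrow> 'v \<Rightarrow> 'w::real_vector" where
  "symbol k BB \<xi> v = (\<Sum>\<alpha>\<in>multi_indices k. (\<Prod>i\<in>UNIV. (\<xi> $ i) ^ \<alpha> i) *\<^sub>R BB \<alpha> v)"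

text \<open>The finite family \<open>(F i)\<close>, \<open>i \<in> I\<close>, is read as one function with values in the
  direct sum of the target spaces, with its Euclidean norm.\<close>

definition holder_seminorm ::
  "real \<Rightarrow> 'i set \<Rightarrow> ('i \<Rightarrow> 'a::metric_space \<Rightarrow> 'v::real_normed_vector) \<Rightarrow> ennreal" where
  "holder_seminorm s I F =
    (SUP (x, y)\<in>{(x, y). x \<noteq> y}.
      ennreal (L2_set (\<lambda>i. norm (F i x - F i y)) I / dist x y powr s))"

definition holder_deriv_seminorm ::
  "real \<Rightarrow> nat \<Rightarrow> (real ^ 'n::finite \<Rightarrow> 'v::real_normed_vector) \<Rightarrow> ennreal" where
  "holder_deriv_seminorm s m u =
    holder_seminorm s (multi_indices m) (\<lambda>\<alpha>. multi_partial \<alpha> u)"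

definition Lp_norm ::
  "real \<Rightarrow> (real ^ 'n::finite \<Rightarrow> 'w::real_normed_vector) \<Rightarrow> ennreal" where
  "Lp_norm p u =
    (let J = (\<integral>\<^sup>+ x. ennreal (norm (u x) powr p) \<partial>lborel)
     in if J = \<infinity> then \<infinity> else ennreal (enn2real J powr (1 / p)))"

end

theory Submission
  imports Defs "HOL-Probability.Sinc_Integral" "Jordan_Normal_Form.Determinant"
begin

text \<open>
  Write \<open>M(\<xi>)\<close> for the Gram matrix of \<open>B[\<xi>]\<close> plus \<open>\<Sum>\<^sub>b \<xi>\<^sub>b\<^sup>2\<^sup>k\<close> times the Gram matrix of \<open>A\<close>, in an
  orthonormal basis of \<open>V\<close>. The kernel condition makes \<open>M(\<xi>)\<close> invertible for \<open>\<xi> \<noteq> 0\<close>, so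
  \<open>q = (det M)\<^sup>2\<close> is a homogeneous polynomial, positive away from the origin, and the adjugate of \<open>M\<close>
  yields polynomials \<open>N\<close> with \<open>N M = q\<close>. Replacing \<open>\<xi>\<close> by derivatives, the scalar operator \<open>q(D)\<close>
  applied to a component of \<open>P\<close> becomes a combination of derivatives of \<open>B P\<close> and of \<open>A P\<close>.

  Let \<open>u(t)\<close> be the convolution of a component \<open>g\<close> of \<open>D\<^sup>k\<^sup>-\<^sup>1 P\<close> with the Fourier transform of
  \<open>exp (- t q)\<close>. Then \<open>u(0)\<close> is a positive multiple of \<open>g\<close>, \<open>u(\<infinity>) = 0\<close>, and \<open>\<partial>\<^sub>t u = - q(D) u\<close> can be
  expressed through \<open>B P\<close> and \<open>D\<^sup>k\<^sup>-\<^sup>1 A P\<close> convolved with rapidly decreasing kernels. Scaling, Hoelder's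
  inequality for the first kind of terms and the vanishing integral of the kernel for the second kind
  give, with \<open>t = r\<^sup>e\<close> and \<open>e\<close> the degree of \<open>q\<close>, bounds for \<open>\<partial>\<^sub>t u\<close> by \<open>r\<^sup>s\<^sup>-\<^sup>e\<close> and for its spatial
  gradient by \<open>r\<^sup>s\<^sup>-\<^sup>1\<^sup>-\<^sup>e\<close>. Integrating \<open>\<partial>\<^sub>t (u(t, x) - u(t, y))\<close> over \<open>t > 0\<close>, with the first bound for
  \<open>r < |x - y|\<close> and the second one for \<open>r > |x - y|\<close>, gives the Hoelder estimate.
\<close>

no_notation Matrix.vec_index (infixl "$" 100)
no_notation Matrix.scalar_prod (infix "\<bullet>" 70)
hide_const (open) Matrix.orthogonal

section \<open>Integration\<close>

text \<open>The obstacle is the inverse of q(D): 1/q is singular at the origin, and its kernel may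
  contain logarithms, depending on degree and dimension. With the factor \<open>exp (- t q)\<close>
  every kernel is smooth and rapidly decreasing, and the singularity is confined to the integral
  over t. There the two bounds complement each other because 0 < s < 1: the first is integrable at t
  = 0 but not at infinity, the second at infinity but not at 0. The degrees fit together.
  \<open>N\<close> has degree e - 2k. A term with B P carries k + (k - 1) further factors, in total
  e - 1, and Hoelder's inequality costs n/p. A term with A P carries 2k further factors, in total e,
  and Hoelder continuity gains s. Both scale like r^(s - e). Weighting the Gram matrix of
  \<open>A\<close> by the sum of the 2k-th powers of the \<xi>_b makes M homogeneous and leaves in
  every such term a factor \<xi>_b, which is why its kernel has integral zero. The constant in front
  of g at t = 0 is (2 pi)^n by Fourier inversion; its positivity is shown by an energy argument with
  a bump function.\<close>

lemma integrable_mult_bounded: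
  fixes f g :: "'a \<Rightarrow> real"
  assumes "integrable M f" "g \<in> borel_measurable M" "\<And>x. \<bar>g x\<bar> \<le> B"
  shows "integrable M (\<lambda>x. f x * g x)"
proof (rule Bochner_Integration.integrable_bound)
  show "integrable M (\<lambda>x. B * f x)" using assms(1) by simp
  show "AE x in M. norm (f x * g x) \<le> norm (B * f x)"
  proof (intro AE_I2)
    fix x
    have "\<bar>f x\<bar> * \<bar>g x\<bar> \<le> \<bar>f x\<bar> * \<bar>B\<bar>"
      using assms(3)[of x] by (intro mult_left_mono) auto
    then show "norm (f x * g x) \<le> norm (B * f x)" by (simp add: abs_mult mult.commute)
  qed
qed (use assms in measurable)

lemma abs_integral_le:
  fixes f g :: "'a \<Rightarrow> real"
  assumes "integrable M g" "\<And>x. \<bar>f x\<bar> \<le> g x"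
  shows "\<bar>\<integral>x. f x \<partial>M\<bar> \<le> (\<integral>x. g x \<partial>M)"
proof (cases "integrable M f")
  case True
  have "\<bar>\<integral>x. f x \<partial>M\<bar> \<le> (\<integral>x. \<bar>f x\<bar> \<partial>M)" by (rule integral_abs_bound)
  also have "\<dots> \<le> (\<integral>x. g x \<partial>M)" using True assms by (intro integral_mono) auto
  finally show ?thesis .
next
  \<comment> \<open>A non-integrable function has Bochner integral 0 by convention, so only
    nonnegativity of the right-hand side remains.\<close>
  case False
  moreover have "0 \<le> (\<integral>x. g x \<partial>M)"
    using assms(2) by (intro integral_nonneg_AE AE_I2) (meson abs_ge_zero order_trans)
  ultimately show ?thesis by (simp add: not_integrable_integral_eq)
qed

text \<open>The product \<open>B * \<bar>f x\<bar> * \<bar>g y\<bar>\<close> is an integrable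
  majorant on the product space. In the uses one variable is a frequency, the other a position, and
  \<open>\<psi>\<close> is an oscillation.\<close>

lemma Fubini_bounded_kernel:
  fixes f :: "'a::euclidean_space \<Rightarrow> real" and g :: "'b::euclidean_space \<Rightarrow> real"
  assumes f: "integrable lborel f" and g: "integrable lborel g"
    and \<psi>: "(\<lambda>(x, y). \<psi> x y) \<in> borel_measurable borel" and B: "\<And>x y. \<bar>\<psi> x y\<bar> \<le> B"
  shows "integrable lborel (\<lambda>x. f x * (\<integral>y. g y * \<psi> x y \<partial>lborel))" (is ?A)
    and "(\<integral>x. f x * (\<integral>y. g y * \<psi> x y \<partial>lborel) \<partial>lborel) =
      (\<integral>y. g y * (\<integral>x. f x * \<psi> x y \<partial>lborel) \<partial>lborel)" (is ?B)
proof -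
  have [measurable]: "f \<in> borel_measurable borel" "g \<in> borel_measurable borel"
    using borel_measurable_integrable[OF f] borel_measurable_integrable[OF g] by auto
  have \<psi>' [measurable]: "(\<lambda>z. \<psi> (fst z) (snd z)) \<in> borel_measurable (lborel \<Otimes>\<^sub>M lborel)"
    using \<psi> by (simp add: case_prod_unfold lborel_prod)
  have [measurable]: "(\<lambda>y. \<psi> x y) \<in> borel_measurable borel" for x
    using measurable_compose[OF measurable_Pair1'[of x borel borel], of "\<lambda>z. \<psi> (fst z) (snd z)" borel] \<psi>
    by (simp add: borel_prod case_prod_unfold)
  have int1: "integrable lborel (\<lambda>y. g y * \<psi> x y)" for x
    by (rule integrable_mult_bounded[OF g _ B]) auto
  have "integrable (lborel \<Otimes>\<^sub>M lborel) (\<lambda>(x, y). f x * g y * \<psi> x y)"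
  proof (rule lborel_pair.Fubini_integrable)
    show "(\<lambda>(x, y). f x * g y * \<psi> x y) \<in> borel_measurable (lborel \<Otimes>\<^sub>M lborel)"
      unfolding case_prod_unfold by measurable
    show "AE x in lborel. integrable lborel (\<lambda>y. case (x, y) of (x, y) \<Rightarrow> f x * g y * \<psi> x y)"
      using int1 by (simp add: mult.assoc)
    show "integrable lborel (\<lambda>x. \<integral>y. norm (case (x, y) of (x, y) \<Rightarrow> f x * g y * \<psi> x y) \<partial>lborel)"
    proof (rule Bochner_Integration.integrable_bound)
      show "integrable lborel (\<lambda>x. f x * (B * (\<integral>y. \<bar>g y\<bar> \<partial>lborel)))" using f by simp
      have [measurable]: "(\<lambda>x. \<integral>y. \<bar>f x * g y * \<psi> x y\<bar> \<partial>lborel) \<in> borel_measurable lborel"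
        by (rule lborel.borel_measurable_lebesgue_integral) (unfold case_prod_unfold, measurable)
      show "(\<lambda>x. \<integral>y. norm (case (x, y) of (x, y) \<Rightarrow> f x * g y * \<psi> x y) \<partial>lborel) \<in> borel_measurable lborel"
        by simp
      have "(\<integral>y. \<bar>g y * \<psi> x y\<bar> \<partial>lborel) \<le> (\<integral>y. \<bar>g y\<bar> * B \<partial>lborel)" for x
        using integrable_abs[OF int1[of x]] g B by (intro integral_mono) (auto simp: abs_mult intro!: mult_left_mono)
      then have le: "(\<integral>y. \<bar>g y * \<psi> x y\<bar> \<partial>lborel) \<le> \<bar>B * (\<integral>y. \<bar>g y\<bar> \<partial>lborel)\<bar>" for x
        by (simp add: mult.commute abs_le_iff order_trans[OF _ abs_ge_self])
      have "(\<integral>y. norm (f x * g y * \<psi> x y) \<partial>lborel) = \<bar>f x\<bar> * (\<integral>y. \<bar>g y * \<psi> x y\<bar> \<partial>lborel)" for x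
        by (simp add: abs_mult mult.assoc)
      then have "norm (\<integral>y. norm (f x * g y * \<psi> x y) \<partial>lborel) \<le> \<bar>f x\<bar> * \<bar>B * (\<integral>y. \<bar>g y\<bar> \<partial>lborel)\<bar>" for x
        using mult_left_mono[OF le[of x], of "\<bar>f x\<bar>"] by (simp add: abs_mult)
      then show "AE x in lborel. norm (\<integral>y. norm (case (x, y) of (x, y) \<Rightarrow> f x * g y * \<psi> x y) \<partial>lborel)
          \<le> norm (f x * (B * (\<integral>y. \<bar>g y\<bar> \<partial>lborel)))"
        by (simp add: abs_mult)
    qed
  qed
  note lborel_pair.integrable_fst'[OF this] lborel_pair.Fubini_integral[OF this]
  moreover have "(\<integral>y. f x * g y * \<psi> x y \<partial>lborel) = f x * (\<integral>y. g y * \<psi> x y \<partial>lborel)" for x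
    by (simp add: mult.assoc)
  moreover have "(\<integral>x. f x * g y * \<psi> x y \<partial>lborel) = g y * (\<integral>x. f x * \<psi> x y \<partial>lborel)" for y
    by (subst integral_mult_right_zero[symmetric]) (simp add: ac_simps)
  ultimately show ?A ?B by simp_all
qed

text \<open>The mean value inequality bounds the difference quotients by \<open>g\<close>, so
  dominated convergence applies along every sequence tending to \<open>\<tau>0\<close>.\<close>

lemma has_real_derivative_integral:
  fixes f f' :: "real \<Rightarrow> 'a \<Rightarrow> real"
  assumes "\<delta> > 0"
    and int: "\<And>\<tau>. \<bar>\<tau> - \<tau>0\<bar> < \<delta> \<Longrightarrow> integrable M (f \<tau>)"
    and der: "\<And>\<tau> x. \<bar>\<tau> - \<tau>0\<bar> < \<delta> \<Longrightarrow> ((\<lambda>\<tau>. f \<tau> x) has_real_derivative f' \<tau> x) (at \<tau>)"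
    and bnd: "\<And>\<tau> x. \<bar>\<tau> - \<tau>0\<bar> < \<delta> \<Longrightarrow> \<bar>f' \<tau> x\<bar> \<le> g x"
    and g: "integrable M g"
    and meas: "f' \<tau>0 \<in> borel_measurable M"
  shows "((\<lambda>\<tau>. \<integral>x. f \<tau> x \<partial>M) has_real_derivative (\<integral>x. f' \<tau>0 x \<partial>M)) (at \<tau>0)"
  unfolding has_field_derivative_iff tendsto_at_iff_sequentially
proof (intro allI impI)
  fix X :: "nat \<Rightarrow> real"
  assume X: "\<forall>i. X i \<in> UNIV - {\<tau>0}" "X \<longlonglongrightarrow> \<tau>0"
  define Q where "Q \<tau> x = (f \<tau> x - f \<tau>0 x) / (\<tau> - \<tau>0)" for \<tau> x
  have Qb: "\<bar>Q \<tau> x\<bar> \<le> g x" if \<tau>: "\<bar>\<tau> - \<tau>0\<bar> < \<delta>" "\<tau> \<noteq> \<tau>0" for \<tau> x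
  proof -
    have ball: "z \<in> ball \<tau>0 \<delta> \<longleftrightarrow> \<bar>z - \<tau>0\<bar> < \<delta>" for z
      by (simp add: dist_real_def abs_minus_commute)
    have "norm (f \<tau> x - f \<tau>0 x) \<le> g x * norm (\<tau> - \<tau>0)"
    proof (rule field_differentiable_bound[of "ball \<tau>0 \<delta>" "\<lambda>\<tau>. f \<tau> x" "\<lambda>\<tau>. f' \<tau> x"])
      fix z assume "z \<in> ball \<tau>0 \<delta>"
      then have z: "\<bar>z - \<tau>0\<bar> < \<delta>" unfolding ball .
      show "((\<lambda>\<tau>. f \<tau> x) has_field_derivative f' z x) (at z within ball \<tau>0 \<delta>)"
        by (rule has_field_derivative_at_within[OF der[OF z]])
      show "norm (f' z x) \<le> g x" using bnd[OF z] by simp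
    next
      show "\<tau> \<in> ball \<tau>0 \<delta>" using \<tau> unfolding ball by simp
      show "\<tau>0 \<in> ball \<tau>0 \<delta>" using \<open>\<delta> > 0\<close> by simp
    qed simp
    then show ?thesis using \<tau> by (simp add: Q_def divide_le_eq)
  qed
  \<comment> \<open>The domination holds only inside the \<open>\<delta>\<close>-interval, hence the
    first \<open>N\<close> terms are cut off; \<open>LIMSEQ_offset\<close> puts them back at the
    end.\<close>
  obtain N where N: "\<bar>X n - \<tau>0\<bar> < \<delta>" if "n \<ge> N" for n
    using LIMSEQ_D[OF X(2) \<open>\<delta> > 0\<close>] by (auto simp: real_norm_def)
  define Y where "Y = (\<lambda>n. X (n + N))"
  have Y: "Y \<longlonglongrightarrow> \<tau>0" "\<And>n. Y n \<noteq> \<tau>0" "\<And>n. \<bar>Y n - \<tau>0\<bar> < \<delta>"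
    using X N LIMSEQ_ignore_initial_segment[OF X(2), of N] by (auto simp: Y_def)
  have "(\<lambda>n. \<integral>x. Q (Y n) x \<partial>M) \<longlonglongrightarrow> (\<integral>x. f' \<tau>0 x \<partial>M)"
  proof (rule integral_dominated_convergence[where w=g])
    show "AE x in M. (\<lambda>n. Q (Y n) x) \<longlonglongrightarrow> f' \<tau>0 x"
    proof (intro AE_I2)
      fix x
      have "((\<lambda>\<tau>. Q \<tau> x) \<longlongrightarrow> f' \<tau>0 x) (at \<tau>0)"
        using der[of \<tau>0 x] \<open>\<delta> > 0\<close> by (simp add: has_field_derivative_iff Q_def)
      then show "(\<lambda>n. Q (Y n) x) \<longlonglongrightarrow> f' \<tau>0 x"
        using Y unfolding tendsto_at_iff_sequentially comp_def by auto
    qed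
    show "Q (Y n) \<in> borel_measurable M" for n
      unfolding Q_def using int[OF Y(3)] int[of \<tau>0] \<open>\<delta> > 0\<close> by (auto intro!: borel_measurable_divide borel_measurable_diff)
    show "AE x in M. norm (Q (Y n) x) \<le> g x" for n using Qb[OF Y(3,2)] by simp
  qed (use g meas in auto)
  then have "(\<lambda>n. \<integral>x. Q (X n) x \<partial>M) \<longlonglongrightarrow> (\<integral>x. f' \<tau>0 x \<partial>M)"
    unfolding Y_def by (rule LIMSEQ_offset)
  moreover have "\<forall>\<^sub>F n in sequentially.
      (\<integral>x. Q (X n) x \<partial>M) = ((\<integral>x. f (X n) x \<partial>M) - (\<integral>x. f \<tau>0 x \<partial>M)) / (X n - \<tau>0)"
    using eventually_ge_at_top[of N] by eventually_elim (use N int \<open>\<delta> > 0\<close> in \<open>simp add: Q_def\<close>)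
  ultimately show "((\<lambda>\<tau>. ((\<integral>x. f \<tau> x \<partial>M) - (\<integral>x. f \<tau>0 x \<partial>M)) / (\<tau> - \<tau>0)) \<circ> X) \<longlonglongrightarrow> (\<integral>x. f' \<tau>0 x \<partial>M)"
    unfolding comp_def by (rule Lim_transform_eventually)
qed

text \<open>An affine bijection preserves measurability in both directions, and for a function that
  is not integrable both integrals are 0 by convention; so the substitution rule applies to an
  arbitrary \<open>f\<close>.\<close>

lemma lborel_integral_affine:
  fixes f :: "'a::euclidean_space \<Rightarrow> real"
  assumes "c \<noteq> 0"
  shows "(\<integral>x. f x \<partial>lborel) = \<bar>c\<bar> ^ DIM('a) * (\<integral>x. f (t + c *\<^sub>R x) \<partial>lborel)"
    and "integrable lborel f \<longleftrightarrow> integrable lborel (\<lambda>x. f (t + c *\<^sub>R x))"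
proof -
  have c: "\<bar>c\<bar> ^ DIM('a) \<noteq> 0" using assms by simp
  have inv: "f y = (\<lambda>x. f (t + c *\<^sub>R x)) (- (1/c) *\<^sub>R t + (1/c) *\<^sub>R y)" for y
    using assms by (simp add: algebra_simps)
  have meas: "(\<lambda>x. f (t + c *\<^sub>R x)) \<in> borel_measurable borel \<longleftrightarrow> f \<in> borel_measurable borel"
  proof
    assume [measurable]: "(\<lambda>x. f (t + c *\<^sub>R x)) \<in> borel_measurable borel"
    have "(\<lambda>y. (\<lambda>x. f (t + c *\<^sub>R x)) (- (1/c) *\<^sub>R t + (1/c) *\<^sub>R y)) \<in> borel_measurable borel"
      by measurable
    then show "f \<in> borel_measurable borel" using inv[symmetric] by (simp del: scaleR_minus_left)
  next
    assume [measurable]: "f \<in> borel_measurable borel"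
    show "(\<lambda>x. f (t + c *\<^sub>R x)) \<in> borel_measurable borel" by measurable
  qed
  show int: "integrable lborel f \<longleftrightarrow> integrable lborel (\<lambda>x. f (t + c *\<^sub>R x))"
  proof (cases "f \<in> borel_measurable borel")
    case True
    note [measurable] = True
    show ?thesis
      by (subst lborel_affine[OF assms, of t])
         (use c in \<open>simp add: integrable_density integrable_distr_eq\<close>)
  next
    case False
    then show ?thesis using meas by (auto dest!: borel_measurable_integrable)
  qed
  show "(\<integral>x. f x \<partial>lborel) = \<bar>c\<bar> ^ DIM('a) * (\<integral>x. f (t + c *\<^sub>R x) \<partial>lborel)"
  proof (cases "f \<in> borel_measurable borel")
    case True
    note [measurable] = True
    show ?thesis
      by (subst lborel_affine[OF assms, of t])
         (simp add: integral_density integral_distr)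
  next
    case False
    then have "\<not> integrable lborel f" by (auto dest!: borel_measurable_integrable)
    with int show ?thesis by (simp add: not_integrable_integral_eq)
  qed
qed

text \<open>By the fundamental theorem, \<open>h (x + v) - h x\<close> is the integral of
  \<open>h'\<close> along the segment from x to x + v. On integrating over x, translation invariance
  turns one side into 0 and, after Fubini, the other into the integral of \<open>h'\<close>. Applied
  to products, this is the integration by parts used throughout.\<close>

lemma integral_directional_derivative_eq_0:
  fixes h h' :: "'a::euclidean_space \<Rightarrow> real"
  assumes h: "integrable lborel h" and h': "integrable lborel h'"
    and cont: "continuous_on UNIV h'"
    and der: "\<And>x. ((\<lambda>\<sigma>. h (x + \<sigma> *\<^sub>R v)) has_real_derivative h' x) (at 0)"
  shows "(\<integral>x. h' x \<partial>lborel) = 0"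
proof -
  define I :: "real \<Rightarrow> real" where "I = indicator {0..1}"
  have [measurable]: "h \<in> borel_measurable borel" "h' \<in> borel_measurable borel"
    using borel_measurable_integrable[OF h] borel_measurable_integrable[OF h'] by auto
  have I: "integrable lborel I" "(\<integral>\<sigma>. I \<sigma> \<partial>lborel) = 1" unfolding I_def by simp_all
  have shift: "(\<integral>x. f (x + u) \<partial>lborel) = (\<integral>x. f x \<partial>lborel)"
     "integrable lborel (\<lambda>x. f (x + u)) \<longleftrightarrow> integrable lborel f" for u and f :: "'a \<Rightarrow> real"
    using lborel_integral_affine[of 1 f u] by (simp_all add: add.commute)
  have der': "((\<lambda>\<sigma>. h (x + \<sigma> *\<^sub>R v)) has_real_derivative h' (x + \<sigma> *\<^sub>R v)) (at \<sigma>)" for x \<sigma>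
    using der[of "x + \<sigma> *\<^sub>R v"] DERIV_shift[of "\<lambda>\<sigma>. h (x + \<sigma> *\<^sub>R v)" "h' (x + \<sigma> *\<^sub>R v)" 0 \<sigma>]
    by (simp add: algebra_simps)
  have FTC: "(\<integral>\<sigma>. h' (x + \<sigma> *\<^sub>R v) * I \<sigma> \<partial>lborel) = h (x + v) - h x" for x
  proof -
    have "continuous_on UNIV (\<lambda>\<sigma>. h' (x + \<sigma> *\<^sub>R v))"
      by (intro continuous_on_compose2[OF cont] continuous_intros) auto
    then have "isCont (\<lambda>\<sigma>. h' (x + \<sigma> *\<^sub>R v)) \<sigma>" for \<sigma>
      by (simp add: continuous_on_eq_continuous_at)
    then show ?thesis
      unfolding I_def
      using integral_FTC_Icc_real[of 0 1 "\<lambda>\<sigma>. h (x + \<sigma> *\<^sub>R v)" "\<lambda>\<sigma>. h' (x + \<sigma> *\<^sub>R v)"] der'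
      by simp
  qed
  have "integrable (lborel \<Otimes>\<^sub>M lborel) (\<lambda>(\<sigma>, x). I \<sigma> * h' (x + \<sigma> *\<^sub>R v))"
  proof (rule lborel_pair.Fubini_integrable)
    show "(\<lambda>(\<sigma>, x). I \<sigma> * h' (x + \<sigma> *\<^sub>R v)) \<in> borel_measurable (lborel \<Otimes>\<^sub>M lborel)"
      unfolding I_def case_prod_unfold by measurable
    show "AE \<sigma> in lborel. integrable lborel (\<lambda>x. case (\<sigma>, x) of (\<sigma>, x) \<Rightarrow> I \<sigma> * h' (x + \<sigma> *\<^sub>R v))"
      using shift(2)[of h'] h' by simp
    show "integrable lborel (\<lambda>\<sigma>. \<integral>x. norm (case (\<sigma>, x) of (\<sigma>, x) \<Rightarrow> I \<sigma> * h' (x + \<sigma> *\<^sub>R v)) \<partial>lborel)"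
      using I shift(1)[of "\<lambda>x. \<bar>h' x\<bar>"] by (simp add: abs_mult I_def)
  qed
  from lborel_pair.Fubini_integral[OF this]
  have "(\<integral>x. h (x + v) - h x \<partial>lborel) = (\<integral>\<sigma>. I \<sigma> * (\<integral>x. h' (x + \<sigma> *\<^sub>R v) \<partial>lborel) \<partial>lborel)"
    using FTC by (simp add: mult.commute)
  also have "\<dots> = (\<integral>x. h' x \<partial>lborel)" using I by (simp add: shift)
  finally have "(\<integral>x. h' x \<partial>lborel) = (\<integral>x. h (x + v) - h x \<partial>lborel)" by simp
  also have "\<dots> = 0" using shift[of h v] h by simp
  finally show ?thesis .
qed

text \<open>This product is the majorant behind the decay estimates below: its integral factors into
  one-dimensional ones, and its reciprocal is a polynomial.\<close>

lemma integrable_prod_inverse_1_plus_square: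
  "integrable lborel (\<lambda>x::'a::euclidean_space. \<Prod>b\<in>Basis. inverse (1 + (x \<bullet> b)\<^sup>2))"
proof (rule integrableI_bounded)
  have "integrable lborel (\<lambda>x::real. inverse (1 + x\<^sup>2))"
    using integrable_inverse_1_plus_square by (simp add: set_integrable_def einterval_iff)
  then have fin: "(\<integral>\<^sup>+x. ennreal (inverse (1 + x\<^sup>2)) \<partial>(lborel::real measure)) < \<infinity>"
    by (simp add: integrable_iff_bounded)
  have "(\<integral>\<^sup>+x. ennreal (norm (\<Prod>b\<in>Basis. inverse (1 + (x \<bullet> b)\<^sup>2))) \<partial>(lborel::'a measure))
      = (\<integral>\<^sup>+x. (\<Prod>b\<in>Basis. ennreal (inverse (1 + (x \<bullet> b)\<^sup>2))) \<partial>(lborel::'a measure))"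
    by (intro nn_integral_cong) (simp add: prod_ennreal abs_prod add_nonneg_nonneg)
  also have "\<dots> = (\<Prod>b\<in>(Basis::'a set). (\<integral>\<^sup>+x. ennreal (inverse (1 + x\<^sup>2)) \<partial>lborel))"
    by (rule nn_integral_lborel_prod) auto
  also have "\<dots> < \<infinity>"
    using fin by (simp add: power_less_top_ennreal less_top)
  finally show "(\<integral>\<^sup>+x. ennreal (norm (\<Prod>b\<in>Basis. inverse (1 + (x \<bullet> b)\<^sup>2))) \<partial>(lborel::'a measure)) < \<infinity>" .
qed simp

text \<open>A version of Hoelder's inequality with a non-optimal constant, which spares the case of a
  vanishing norm.\<close>

lemma abs_integral_mult_le_powr:
  fixes f g :: "'a \<Rightarrow> real"
  assumes p: "p > 1" and \<nu>: "\<nu> > 0"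
    and f: "integrable M (\<lambda>x. \<bar>f x\<bar> powr (p / (p - 1)))"
    and g: "integrable M (\<lambda>x. \<bar>g x\<bar> powr p)"
    and le: "(\<integral>x. \<bar>g x\<bar> powr p \<partial>M) \<le> \<nu> powr p"
  shows "\<bar>\<integral>x. f x * g x \<partial>M\<bar> \<le> ((\<integral>x. \<bar>f x\<bar> powr (p / (p - 1)) \<partial>M) + 1) * \<nu>"
proof -
  let ?q = "p / (p - 1)"
  define h where "h x = \<nu> * (\<bar>f x\<bar> powr ?q + \<bar>g x\<bar> powr p / \<nu> powr p)" for x
  have "\<bar>f x * g x\<bar> \<le> h x" for x
  proof -
    \<comment> \<open>Young's inequality for \<open>g\<close> normalised by \<open>\<nu>\<close>.
      The weights 1/q and 1/p are bounded by 1, and so is the integral of the normalised p-th power,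
      which is the \<open>+ 1\<close> of the constant.\<close>
    have "\<bar>f x\<bar> * (\<bar>g x\<bar> / \<nu>) \<le> \<bar>f x\<bar> powr ?q / ?q + (\<bar>g x\<bar> / \<nu>) powr p / p"
      using p \<nu> by (intro Youngs_inequality) (auto simp: field_simps)
    also have "\<dots> \<le> \<bar>f x\<bar> powr ?q / 1 + (\<bar>g x\<bar> / \<nu>) powr p / 1"
      using p by (intro add_mono divide_left_mono) (auto simp: field_simps)
    finally show ?thesis using \<nu> by (simp add: h_def abs_mult powr_divide field_simps)
  qed
  moreover have "integrable M h" unfolding h_def using f g by auto
  ultimately have "\<bar>\<integral>x. f x * g x \<partial>M\<bar> \<le> (\<integral>x. h x \<partial>M)" by (intro abs_integral_le)
  also have "\<dots> = \<nu> * ((\<integral>x. \<bar>f x\<bar> powr ?q \<partial>M) + (\<integral>x. \<bar>g x\<bar> powr p \<partial>M) / \<nu> powr p)"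
    unfolding h_def using f g by simp
  also have "\<dots> \<le> \<nu> * ((\<integral>x. \<bar>f x\<bar> powr ?q \<partial>M) + 1)"
    using \<nu> le by (intro mult_left_mono add_left_mono) auto
  finally show ?thesis by (simp add: mult.commute)
qed

text \<open>\<open>L\<close> is minus the integral of \<open>\<phi>'\<close> over all positive
  times, cut at \<open>T\<close>: the first bound is integrable at 0, the second at infinity.
  Instead of integrating, \<open>\<phi>\<close> is compared with a primitive of the bounding
  power.\<close>

lemma abs_limit_le_of_derivative_bounds:
  fixes \<phi> \<phi>' :: "real \<Rightarrow> real"
  assumes der: "\<And>t. t > 0 \<Longrightarrow> (\<phi> has_real_derivative \<phi>' t) (at t)"
    and near: "\<And>t. t > 0 \<Longrightarrow> \<bar>\<phi>' t\<bar> \<le> K1 * t powr (\<alpha> - 1)"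
    and far: "\<And>t. t > 0 \<Longrightarrow> \<bar>\<phi>' t\<bar> \<le> K2 * t powr (- \<beta> - 1)"
    and \<alpha>: "\<alpha> > 0" and \<beta>: "\<beta> > 0" and T: "T > 0"
    and top: "(\<phi> \<longlongrightarrow> 0) at_top" and bot: "(\<phi> \<longlongrightarrow> L) (at_right 0)"
  shows "\<bar>L\<bar> \<le> K1 * T powr \<alpha> / \<alpha> + K2 * T powr (- \<beta>) / \<beta>"
proof -
  have diff: "\<bar>\<phi> v - \<phi> u\<bar> \<le> K * v powr \<gamma> / \<gamma> - K * u powr \<gamma> / \<gamma>"
    if uv: "0 < u" "u \<le> v" and \<gamma>: "\<gamma> \<noteq> 0" and b: "\<And>t. t > 0 \<Longrightarrow> \<bar>\<phi>' t\<bar> \<le> K * t powr (\<gamma> - 1)" for u v K \<gamma>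
  proof -
    have d: "((\<lambda>t. K * t powr \<gamma> / \<gamma> + c * \<phi> t) has_real_derivative K * t powr (\<gamma> - 1) + c * \<phi>' t) (at t)"
      if "t > 0" for t c
      using that \<gamma> der[OF that] by (auto intro!: derivative_eq_intros)
    \<comment> \<open>Adding \<open>\<phi>\<close> or \<open>- \<phi>\<close> to the primitive gives
      two nondecreasing functions, which together bound the absolute increment.\<close>
    have "K * u powr \<gamma> / \<gamma> + c * \<phi> u \<le> K * v powr \<gamma> / \<gamma> + c * \<phi> v" if c: "c = 1 \<or> c = -1" for c
    proof (rule DERIV_nonneg_imp_nondecreasing[OF uv(2)])
      fix t assume "u \<le> t" "t \<le> v"
      then have "t > 0" using uv by simp
      from d[OF this, of c] b[OF this] c
      show "\<exists>y. ((\<lambda>t. K * t powr \<gamma> / \<gamma> + c * \<phi> t) has_real_derivative y) (at t) \<and> 0 \<le> y"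
        by (intro exI[of _ "K * t powr (\<gamma> - 1) + c * \<phi>' t"]) (auto simp: abs_le_iff)
    qed
    from this[of 1] this[of "-1"] show ?thesis by (simp add: abs_le_iff)
  qed
  have "\<bar>L - \<phi> T\<bar> \<le> K1 * T powr \<alpha> / \<alpha>"
  proof (rule tendsto_upperbound)
    show "((\<lambda>u. \<bar>\<phi> u - \<phi> T\<bar>) \<longlongrightarrow> \<bar>L - \<phi> T\<bar>) (at_right 0)"
      by (intro tendsto_intros bot)
    have K1: "0 \<le> K1"
      using near[of 1] by simp
    show "\<forall>\<^sub>F u in at_right 0. \<bar>\<phi> u - \<phi> T\<bar> \<le> K1 * T powr \<alpha> / \<alpha>"
      unfolding eventually_at_right_field
    proof (intro exI[of _ T] conjI allI impI T)
      fix u :: real assume u: "0 < u" "u < T"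
      have "\<bar>\<phi> T - \<phi> u\<bar> \<le> K1 * T powr \<alpha> / \<alpha> - K1 * u powr \<alpha> / \<alpha>"
        using u \<alpha> near by (intro diff) auto
      moreover have "0 \<le> K1 * u powr \<alpha> / \<alpha>" using K1 \<alpha> by simp
      ultimately show "\<bar>\<phi> u - \<phi> T\<bar> \<le> K1 * T powr \<alpha> / \<alpha>" by (simp add: abs_minus_commute)
    qed
  qed simp
  moreover have "\<bar>0 - \<phi> T\<bar> \<le> K2 * T powr (- \<beta>) / \<beta>"
  proof (rule tendsto_upperbound)
    show "((\<lambda>v. \<bar>\<phi> v - \<phi> T\<bar>) \<longlongrightarrow> \<bar>0 - \<phi> T\<bar>) at_top"
      by (intro tendsto_intros top)
    have K2: "0 \<le> K2"
      using far[of 1] by simp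
    show "\<forall>\<^sub>F v in at_top. \<bar>\<phi> v - \<phi> T\<bar> \<le> K2 * T powr (- \<beta>) / \<beta>"
      using eventually_ge_at_top[of T]
    proof eventually_elim
      fix v assume v: "T \<le> v"
      have "\<bar>\<phi> v - \<phi> T\<bar> \<le> K2 * v powr (- \<beta>) / (- \<beta>) - K2 * T powr (- \<beta>) / (- \<beta>)"
        using v \<beta> far T by (intro diff) auto
      moreover have "0 \<le> K2 * v powr (- \<beta>) / \<beta>" using K2 \<beta> by simp
      ultimately show "\<bar>\<phi> v - \<phi> T\<bar> \<le> K2 * T powr (- \<beta>) / \<beta>" by simp
    qed
  qed simp
  ultimately show ?thesis by linarith
qed

section \<open>Polynomials and Fourier integrals\<close>

lemma real_polynomial_function_continuous_on:
  fixes a :: "'a::real_normed_vector \<Rightarrow> real"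
  assumes "real_polynomial_function a"
  shows "continuous_on A a"
  using assms continuous_on_polymonial_function by (auto simp: real_polynomial_function_eq)

lemma real_polynomial_function_growth:
  assumes "real_polynomial_function a"
  shows "\<exists>C N. C \<ge> 0 \<and> (\<forall>x. \<bar>a x\<bar> \<le> C * (1 + norm x) ^ N)"
  using assms
proof induction
  case (linear f)
  then obtain C where C: "C > 0" "\<And>x. norm (f x) \<le> norm x * C" using bounded_linear.pos_bounded by blast
  have "\<bar>f x\<bar> \<le> C * (1 + norm x) ^ 1" for x
    using C(2)[of x] C(1) by (simp add: algebra_simps)
  then show ?case using C(1) by (intro exI[of _ C] exI[of _ 1]) auto
next
  case (const c)
  then show ?case by (intro exI[of _ "\<bar>c\<bar>"] exI[of _ 0]) auto
next
  case (add f g)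
  then obtain C N D M where *: "C \<ge> 0" "\<And>x. \<bar>f x\<bar> \<le> C * (1 + norm x) ^ N"
      "D \<ge> 0" "\<And>x. \<bar>g x\<bar> \<le> D * (1 + norm x) ^ M" by blast
  have "\<bar>f x + g x\<bar> \<le> (C + D) * (1 + norm x) ^ (N + M)" for x
  proof -
    have "C * (1 + norm x) ^ N \<le> C * (1 + norm x) ^ (N + M)"
      "D * (1 + norm x) ^ M \<le> D * (1 + norm x) ^ (N + M)"
      using * by (intro mult_left_mono power_increasing; simp)+
    then show ?thesis using *(2)[of x] *(4)[of x] by (simp add: algebra_simps abs_le_iff)
  qed
  then show ?case using * by (intro exI[of _ "C + D"] exI[of _ "N + M"]) auto
next
  case (mult f g)
  then obtain C N D M where *: "C \<ge> 0" "\<And>x. \<bar>f x\<bar> \<le> C * (1 + norm x) ^ N"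
      "D \<ge> 0" "\<And>x. \<bar>g x\<bar> \<le> D * (1 + norm x) ^ M" by blast
  have "\<bar>f x * g x\<bar> \<le> (C * D) * (1 + norm x) ^ (N + M)" for x
    using mult_mono[OF *(2)[of x] *(4)[of x]] * by (simp add: abs_mult power_add mult_ac)
  then show ?case using * by (intro exI[of _ "C * D"] exI[of _ "N + M"]) auto
qed

lemma real_polynomial_function_directional_derivative:
  assumes "real_polynomial_function a"
  shows "\<exists>a'. real_polynomial_function a' \<and>
    (\<forall>x. ((\<lambda>\<sigma>. a (x + \<sigma> *\<^sub>R v)) has_real_derivative a' x) (at 0))"
  using assms
proof induction
  case (linear f)
  interpret bounded_linear f by fact
  show ?case
    by (intro exI[of _ "\<lambda>_. f v"] conjI allI)
       (auto simp: add scaleR intro!: derivative_eq_intros)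
next
  case (const c)
  show ?case by (intro exI[of _ "\<lambda>_. 0"]) auto
next
  case (add f g)
  then obtain f' g' where *: "real_polynomial_function f'" "real_polynomial_function g'"
    "\<And>x. ((\<lambda>\<sigma>. f (x + \<sigma> *\<^sub>R v)) has_real_derivative f' x) (at 0)"
    "\<And>x. ((\<lambda>\<sigma>. g (x + \<sigma> *\<^sub>R v)) has_real_derivative g' x) (at 0)" by blast
  then show ?case by (intro exI[of _ "\<lambda>x. f' x + g' x"]) (auto intro: DERIV_add)
next
  case (mult f g)
  then obtain f' g' where *: "real_polynomial_function f'" "real_polynomial_function g'"
    "\<And>x. ((\<lambda>\<sigma>. f (x + \<sigma> *\<^sub>R v)) has_real_derivative f' x) (at 0)"
    "\<And>x. ((\<lambda>\<sigma>. g (x + \<sigma> *\<^sub>R v)) has_real_derivative g' x) (at 0)" by blast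
  have "((\<lambda>\<sigma>. f (x + \<sigma> *\<^sub>R v) * g (x + \<sigma> *\<^sub>R v)) has_real_derivative (f' x * g x + g' x * f x)) (at 0)" for x
    using DERIV_mult[OF *(3,4)] by simp
  then show ?case using * mult.hyps by (intro exI[of _ "\<lambda>x. f' x * g x + g' x * f x"]) auto
qed

lemma real_polynomial_function_inner: "real_polynomial_function (\<lambda>x. x \<bullet> v)"
  by (intro real_polynomial_function.intros(1) bounded_linear_inner_left)

lemma power_le_fact_exp:
  fixes x :: real
  assumes "0 \<le> x"
  shows "x ^ N \<le> fact N * exp x"
proof -
  have "(\<Sum>n\<in>{N}. x ^ n /\<^sub>R fact n) \<le> exp x"
    unfolding exp_def using assms by (intro sum_le_suminf summable_exp_generic) auto
  then show ?thesis by (simp add: field_simps)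
qed

text \<open>Since \<open>y - 1 \<le> y ^ e\<close>, the exponent is at most
  \<open>2 * \<kappa> - \<kappa> * (1 + y)\<close>; the power of \<open>1 + y\<close> is then
  absorbed by one term of the exponential series.\<close>

lemma power_exp_minus_bounded:
  fixes \<kappa> y :: real
  assumes "\<kappa> > 0" "y \<ge> 0" "e \<ge> 1"
  shows "(1 + y) ^ N * exp (- \<kappa> * y ^ e) \<le> exp (2 * \<kappa>) * fact N / \<kappa> ^ N"
proof -
  have "y - 1 \<le> y ^ e"
    using assms self_le_power[of y e] by (cases "y \<ge> 1") (auto intro: order_trans[of _ 0])
  then have "exp (- \<kappa> * y ^ e) \<le> exp (2 * \<kappa> - \<kappa> * (1 + y))"
    using mult_left_mono[of "y - 1" "y ^ e" \<kappa>] assms by (simp add: algebra_simps)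
  then have "(1 + y) ^ N * exp (- \<kappa> * y ^ e) \<le> (1 + y) ^ N * (exp (2 * \<kappa>) * exp (- (\<kappa> * (1 + y))))"
    using assms by (intro mult_left_mono) (auto simp: mult_exp_exp)
  also have "\<dots> = exp (2 * \<kappa>) / \<kappa> ^ N * ((\<kappa> * (1 + y)) ^ N * exp (- (\<kappa> * (1 + y))))"
    using assms by (simp add: power_mult_distrib)
  also have "\<dots> \<le> exp (2 * \<kappa>) / \<kappa> ^ N * (fact N * exp (\<kappa> * (1 + y)) * exp (- (\<kappa> * (1 + y))))"
    using assms by (intro mult_left_mono mult_right_mono power_le_fact_exp) auto
  also have "\<dots> = exp (2 * \<kappa>) * fact N / \<kappa> ^ N"
    by (simp add: mult.assoc mult_exp_exp)
  finally show ?thesis .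
qed

text \<open>The \<open>m\<close>-th derivative of the cosine: it keeps all Fourier integrals real, and differentiating the
  integrand raises \<open>m\<close>.\<close>

definition osc :: "nat \<Rightarrow> real \<Rightarrow> real" where
  "osc m \<theta> = cos (\<theta> + real m * (pi / 2))"

lemma abs_osc_le_1: "\<bar>osc m \<theta>\<bar> \<le> 1"
  by (simp add: osc_def)

lemma osc_mod_4: "osc (m + 4 * j) = osc m"
proof -
  have "\<theta> + real (m + 4 * j) * (pi / 2) = (\<theta> + real m * (pi / 2)) + 2 * real j * pi" for \<theta>
    by (simp add: field_simps)
  moreover have "cos (y + 2 * real j * pi) = cos y" for y
    unfolding cos_add by simp
  ultimately show ?thesis
    unfolding osc_def fun_eq_iff by metis
qed

text \<open>With natural indices, \<open>m + 3\<close> takes the place of m - 1: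
  \<open>osc (m + 3)\<close> is an antiderivative of \<open>osc m\<close>, as integration by parts
  in the frequency requires.\<close>

lemma osc_add_4: "osc (Suc (m + 3)) = osc m"
  using osc_mod_4[of m 1] by (simp add: numeral_eq_Suc)

lemma osc_Suc: "osc (Suc m) \<theta> = - sin (\<theta> + real m * (pi / 2))"
proof -
  have "\<theta> + real (Suc m) * (pi / 2) = \<theta> + real m * (pi / 2) + pi / 2" by (simp add: field_simps)
  then show ?thesis unfolding osc_def by (simp only: cos_add cos_pi_half sin_pi_half)
qed

lemma osc_has_derivative: "(osc m has_real_derivative osc (Suc m) \<theta>) (at \<theta>)"
  unfolding osc_Suc unfolding osc_def[abs_def] by (auto intro!: derivative_eq_intros)

lemma continuous_on_osc [continuous_intros]:
  fixes f :: "'a::real_normed_vector \<Rightarrow> real"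
  assumes "continuous_on A f"
  shows "continuous_on A (\<lambda>x. osc m (f x))"
  unfolding osc_def by (intro continuous_intros assms)

lemma borel_measurable_osc [measurable]: "osc m \<in> borel_measurable borel"
  by (intro borel_measurable_continuous_onI continuous_intros)

section \<open>The heat flow of an elliptic polynomial\<close>

locale elliptic_polynomial =
  fixes q :: "'a::euclidean_space \<Rightarrow> real" and e :: nat and c0 :: real
  assumes poly_q: "real_polynomial_function q"
    and homogeneous: "\<And>r \<xi>. q (r *\<^sub>R \<xi>) = r ^ e * q \<xi>"
    and c0_pos: "c0 > 0"
    and elliptic: "\<And>\<xi>. c0 * norm \<xi> ^ e \<le> q \<xi>"
    and e_ge_1: "e \<ge> 1"
begin

lemma q_nonneg: "0 \<le> q \<xi>"
  using elliptic[of \<xi>] c0_pos by (smt (verit) mult_nonneg_nonneg norm_ge_zero zero_le_power)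

lemma q_pos: "\<xi> \<noteq> 0 \<Longrightarrow> 0 < q \<xi>"
  using elliptic[of \<xi>] c0_pos by (smt (verit) mult_pos_pos zero_less_norm_iff zero_less_power)

lemma continuous_on_q: "continuous_on A q"
  by (rule real_polynomial_function_continuous_on[OF poly_q])

text \<open>Ellipticity bounds \<open>exp (- t * q \<xi>)\<close> by exp (-t c0 |\<xi>|^e), which
  beats the polynomial growth of \<open>a\<close> times the reciprocal \<open>w\<close> of the
  integrable majorant.\<close>

lemma heat_symbol_decay:
  assumes a: "real_polynomial_function a" and t: "t > 0"
  shows "\<exists>C. \<forall>\<xi>. \<bar>a \<xi>\<bar> * exp (- t * q \<xi>) \<le> C * (\<Prod>b\<in>Basis. inverse (1 + (\<xi> \<bullet> b)\<^sup>2))"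
proof -
  define w where "w \<xi> = (\<Prod>b\<in>Basis. 1 + (\<xi> \<bullet> b)\<^sup>2)" for \<xi> :: 'a
  have w: "w \<xi> > 0" for \<xi> unfolding w_def by (intro prod_pos) (auto intro: add_pos_nonneg)
  have "real_polynomial_function (\<lambda>\<xi>. a \<xi> * w \<xi>)"
    unfolding w_def using a
    by (intro real_polynomial_function.intros(2-4) real_polynomial_function_prod
        real_polynomial_function_power real_polynomial_function_inner) auto
  then obtain C N where C: "C \<ge> 0" "\<And>x. \<bar>a x * w x\<bar> \<le> C * (1 + norm x) ^ N"
    using real_polynomial_function_growth by blast
  define D where "D = C * (exp (2 * (t * c0)) * fact N / (t * c0) ^ N)"
  have "\<bar>a \<xi>\<bar> * exp (- t * q \<xi>) \<le> D * (\<Prod>b\<in>Basis. inverse (1 + (\<xi> \<bullet> b)\<^sup>2))" for \<xi>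
  proof -
    have "exp (- t * q \<xi>) \<le> exp (- (t * c0) * norm \<xi> ^ e)"
      using mult_left_mono[OF elliptic[of \<xi>], of t] t by (simp add: mult.assoc)
    then have "\<bar>a \<xi> * w \<xi>\<bar> * exp (- t * q \<xi>) \<le> (C * (1 + norm \<xi>) ^ N) * exp (- (t * c0) * norm \<xi> ^ e)"
      using C by (intro mult_mono) auto
    also have "\<dots> \<le> D"
      unfolding D_def mult.assoc[of C] using C t c0_pos e_ge_1
      by (intro mult_left_mono power_exp_minus_bounded) auto
    finally have "\<bar>a \<xi>\<bar> * exp (- t * q \<xi>) * w \<xi> \<le> D"
      using w[of \<xi>] by (simp add: abs_mult mult_ac)
    then have "\<bar>a \<xi>\<bar> * exp (- t * q \<xi>) \<le> D * inverse (w \<xi>)"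
      using w[of \<xi>] by (simp add: field_simps)
    moreover have "inverse (w \<xi>) = (\<Prod>b\<in>Basis. inverse (1 + (\<xi> \<bullet> b)\<^sup>2))"
      unfolding w_def by (simp add: prod_inversef[symmetric] comp_def)
    ultimately show ?thesis by simp
  qed
  then show ?thesis by blast
qed

lemma continuous_on_heat_symbol:
  assumes "real_polynomial_function a"
  shows "continuous_on A (\<lambda>\<xi>. a \<xi> * exp (- t * q \<xi>))"
  by (intro continuous_intros continuous_on_q real_polynomial_function_continuous_on assms)

lemma integrable_heat_symbol:
  assumes a: "real_polynomial_function a" and t: "t > 0"
  shows "integrable lborel (\<lambda>\<xi>. a \<xi> * exp (- t * q \<xi>))"
proof -
  obtain C where "\<And>\<xi>. \<bar>a \<xi>\<bar> * exp (- t * q \<xi>) \<le> C * (\<Prod>b\<in>Basis. inverse (1 + (\<xi> \<bullet> b)\<^sup>2))"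
    using heat_symbol_decay[OF assms] by blast
  then have bnd: "norm (a \<xi> * exp (- t * q \<xi>)) \<le> norm (C * (\<Prod>b\<in>Basis. inverse (1 + (\<xi> \<bullet> b)\<^sup>2)))" for \<xi>
    using order_trans[OF _ abs_ge_self] by (force simp: abs_mult)
  have meas: "(\<lambda>\<xi>. a \<xi> * exp (- t * q \<xi>)) \<in> borel_measurable lborel"
    using borel_measurable_continuous_onI[OF continuous_on_heat_symbol[OF a, of UNIV t]] by simp
  show ?thesis
    by (rule Bochner_Integration.integrable_bound[OF _ meas AE_I2[OF bnd]])
       (intro integrable_mult_right integrable_prod_inverse_1_plus_square)
qed

text \<open>\<open>f\<close> convolved with the Fourier transform of \<open>a exp (- t q)\<close>, where \<open>m\<close> records the number of
  derivatives that the factor \<open>a\<close> stands for. In this order of integration the derivatives in \<open>t\<close> and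
  \<open>x\<close> only need the decay of the symbol.\<close>

definition conv_heat :: "real \<Rightarrow> ('a \<Rightarrow> real) \<Rightarrow> nat \<Rightarrow> ('a \<Rightarrow> real) \<Rightarrow> 'a \<Rightarrow> real" where
  "conv_heat t a m f x =
    (\<integral>\<xi>. a \<xi> * exp (- t * q \<xi>) * (\<integral>y. f y * osc m ((x - y) \<bullet> \<xi>) \<partial>lborel) \<partial>lborel)"

text \<open>This is the real part of i^m times the Fourier integral of \<open>a exp (- q)\<close>,
  that is, the convolution kernel of the flow at time 1. Other times are reduced to it by
  scaling.\<close>

definition kernel :: "('a \<Rightarrow> real) \<Rightarrow> nat \<Rightarrow> 'a \<Rightarrow> real" where
  "kernel a m z = (\<integral>\<xi>. a \<xi> * exp (- q \<xi>) * osc m (z \<bullet> \<xi>) \<partial>lborel)"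

section \<open>Linearity, derivatives and large-time limit of the heat flow\<close>

lemma osc_measurable_pair:
  "(\<lambda>(\<xi>, y). osc m ((x - y) \<bullet> \<xi>)) \<in> borel_measurable borel"
  "(\<lambda>(\<xi>, y). osc m (y \<bullet> \<xi>)) \<in> borel_measurable borel"
  unfolding case_prod_unfold by (intro borel_measurable_continuous_onI continuous_intros)+

lemma integrable_conv_heat:
  assumes a: "real_polynomial_function a" and t: "t > 0" and f: "integrable lborel f"
  shows "integrable lborel
    (\<lambda>\<xi>. a \<xi> * exp (- t * q \<xi>) * (\<integral>y. f y * osc m ((x - y) \<bullet> \<xi>) \<partial>lborel))"
  by (rule Fubini_bounded_kernel(1)[OF integrable_heat_symbol[OF a t] f osc_measurable_pair(1) abs_osc_le_1])

lemma abs_fourier_le: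
  assumes "integrable lborel f"
  shows "\<bar>\<integral>y. f y * osc m (h y) \<partial>lborel\<bar> \<le> (\<integral>y. \<bar>f y\<bar> \<partial>lborel)"
  using assms by (intro abs_integral_le) (auto simp: abs_mult intro: mult_left_le abs_osc_le_1)

lemma integrable_osc:
  assumes "integrable lborel (f :: 'a \<Rightarrow> real)" "h \<in> borel_measurable borel"
  shows "integrable lborel (\<lambda>y. f y * osc m (h y))"
  by (rule integrable_mult_bounded[OF assms(1) _ abs_osc_le_1]) (use assms(2) in measurable)

lemma conv_heat_mod_4: "conv_heat t a (m + 4 * j) f x = conv_heat t a m f x"
  unfolding conv_heat_def osc_mod_4 ..

lemma conv_heat_sum_symbol:
  assumes "\<And>i. i \<in> I \<Longrightarrow> real_polynomial_function (a i)" "t > 0" "integrable lborel f"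
  shows "conv_heat t (\<lambda>\<xi>. \<Sum>i\<in>I. c i * a i \<xi>) m f x = (\<Sum>i\<in>I. c i * conv_heat t (a i) m f x)"
proof -
  have "(\<Sum>i\<in>I. c i * conv_heat t (a i) m f x) = (\<integral>\<xi>. (\<Sum>i\<in>I. c i *
      (a i \<xi> * exp (- t * q \<xi>) * (\<integral>y. f y * osc m ((x - y) \<bullet> \<xi>) \<partial>lborel))) \<partial>lborel)"
    unfolding conv_heat_def using integrable_conv_heat[OF assms]
    by (subst Bochner_Integration.integral_sum) auto
  also have "\<dots> = conv_heat t (\<lambda>\<xi>. \<Sum>i\<in>I. c i * a i \<xi>) m f x"
    unfolding conv_heat_def by (simp add: sum_distrib_right mult.assoc)
  finally show ?thesis ..
qed

lemma conv_heat_sum: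
  assumes a: "real_polynomial_function a" and t: "t > 0" and f: "\<And>i. i \<in> I \<Longrightarrow> integrable lborel (f i)"
  shows "conv_heat t a m (\<lambda>y. \<Sum>i\<in>I. c i * f i y) x = (\<Sum>i\<in>I. c i * conv_heat t a m (f i) x)"
proof -
  have "(\<integral>y. (\<Sum>i\<in>I. c i * f i y) * osc m ((x - y) \<bullet> \<xi>) \<partial>lborel)
      = (\<Sum>i\<in>I. c i * (\<integral>y. f i y * osc m ((x - y) \<bullet> \<xi>) \<partial>lborel))" for \<xi>
    using integrable_osc[OF f, of _ "\<lambda>y. (x - y) \<bullet> \<xi>" m]
    by (simp add: sum_distrib_right mult.assoc Bochner_Integration.integral_sum)
  then have "conv_heat t a m (\<lambda>y. \<Sum>i\<in>I. c i * f i y) x = (\<integral>\<xi>. (\<Sum>i\<in>I. c i *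
      (a \<xi> * exp (- t * q \<xi>) * (\<integral>y. f i y * osc m ((x - y) \<bullet> \<xi>) \<partial>lborel))) \<partial>lborel)"
    unfolding conv_heat_def by (simp add: sum_distrib_left mult_ac)
  also have "\<dots> = (\<Sum>i\<in>I. c i * conv_heat t a m (f i) x)"
    unfolding conv_heat_def using integrable_conv_heat[OF a t f]
    by (subst Bochner_Integration.integral_sum) auto
  finally show ?thesis .
qed

text \<open>Integration by parts in y. The oscillation depends on x - y, so its derivative along
  \<open>v\<close> carries a minus sign, which cancels the sign of the integration by parts. Hence
  each derivative of \<open>f\<close> becomes a factor \<open>\<xi> \<bullet> v\<close> and raises
  the index by one.\<close>

lemma conv_heat_derivative:
  assumes f: "integrable lborel f" "continuous_on UNIV f"
    and f': "integrable lborel f'" "continuous_on UNIV f'"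
    and der: "\<And>y. ((\<lambda>\<sigma>. f (y + \<sigma> *\<^sub>R v)) has_real_derivative f' y) (at 0)"
  shows "conv_heat t (\<lambda>\<xi>. a \<xi> * (\<xi> \<bullet> v)) (Suc m) f x = conv_heat t a m f' x"
proof -
  have "(\<xi> \<bullet> v) * (\<integral>y. f y * osc (Suc m) ((x - y) \<bullet> \<xi>) \<partial>lborel)
      = (\<integral>y. f' y * osc m ((x - y) \<bullet> \<xi>) \<partial>lborel)" for \<xi>
  proof -
    define h where "h y = f y * osc m ((x - y) \<bullet> \<xi>)" for y
    define h' where "h' y = f' y * osc m ((x - y) \<bullet> \<xi>) - (\<xi> \<bullet> v) * (f y * osc (Suc m) ((x - y) \<bullet> \<xi>))" for y
    have i: "integrable lborel (\<lambda>y. f' y * osc m ((x - y) \<bullet> \<xi>))"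
      "integrable lborel (\<lambda>y. f y * osc m ((x - y) \<bullet> \<xi>))"
      "integrable lborel (\<lambda>y. f y * osc (Suc m) ((x - y) \<bullet> \<xi>))"
      by (auto intro!: integrable_osc f f')
    have "(\<integral>y. h' y \<partial>lborel) = 0"
    proof (rule integral_directional_derivative_eq_0)
      show "integrable lborel h" "integrable lborel h'" unfolding h_def h'_def using i by auto
      show "continuous_on UNIV h'" unfolding h'_def by (intro continuous_intros f f')
      fix y
      have "((\<lambda>\<sigma>. (x - (y + \<sigma> *\<^sub>R v)) \<bullet> \<xi>) has_real_derivative - (\<xi> \<bullet> v)) (at 0)"
        unfolding inner_diff_left inner_add_left inner_scaleR_left inner_commute[of v]
        by (auto intro!: derivative_eq_intros)
      from DERIV_chain2[OF osc_has_derivative this, of m]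
      have "((\<lambda>\<sigma>. osc m ((x - (y + \<sigma> *\<^sub>R v)) \<bullet> \<xi>)) has_real_derivative
          osc (Suc m) ((x - y) \<bullet> \<xi>) * - (\<xi> \<bullet> v)) (at 0)" by simp
      from DERIV_mult[OF der[of y] this]
      show "((\<lambda>\<sigma>. h (y + \<sigma> *\<^sub>R v)) has_real_derivative h' y) (at 0)"
        unfolding h_def h'_def by (simp add: algebra_simps)
    qed
    then show ?thesis unfolding h'_def using i by simp
  qed
  then show ?thesis unfolding conv_heat_def
    by (simp add: mult.assoc mult.left_commute[of "_ \<bullet> v"])
qed

lemma conv_heat_add_symbol:
  assumes "real_polynomial_function a" "real_polynomial_function b" "t > 0" "integrable lborel f"
  shows "conv_heat t (\<lambda>\<xi>. a \<xi> + b \<xi>) m f x = conv_heat t a m f x + conv_heat t b m f x"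
proof -
  have "conv_heat t a m f x + conv_heat t b m f x =
      (\<integral>\<xi>. a \<xi> * exp (- t * q \<xi>) * (\<integral>y. f y * osc m ((x - y) \<bullet> \<xi>) \<partial>lborel)
        + b \<xi> * exp (- t * q \<xi>) * (\<integral>y. f y * osc m ((x - y) \<bullet> \<xi>) \<partial>lborel) \<partial>lborel)"
    unfolding conv_heat_def
    by (rule Bochner_Integration.integral_add[symmetric]) (intro integrable_conv_heat assms)+
  then show ?thesis unfolding conv_heat_def by (simp add: distrib_right)
qed

lemma conv_heat_zero_symbol: "conv_heat t (\<lambda>_. 0) m f x = 0"
  by (simp add: conv_heat_def)

lemma conv_heat_has_derivative_time:
  assumes a: "real_polynomial_function a" and t: "t > 0" and f: "integrable lborel f"
  shows "((\<lambda>t. conv_heat t a m f x) has_real_derivative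
    - conv_heat t (\<lambda>\<xi>. a \<xi> * q \<xi>) m f x) (at t)"
proof -
  define T where "T \<xi> = (\<integral>y. f y * osc m ((x - y) \<bullet> \<xi>) \<partial>lborel)" for \<xi>
  define B where "B = (\<integral>y. \<bar>f y\<bar> \<partial>lborel)"
  have T: "\<bar>T \<xi>\<bar> \<le> B" for \<xi> unfolding T_def B_def by (rule abs_fourier_le[OF f])
  have aq: "real_polynomial_function (\<lambda>\<xi>. a \<xi> * q \<xi>)" using a poly_q by blast
  \<comment> \<open>For \<open>\<tau> > t / 2\<close> the time derivatives are dominated by the
    symbol at time \<open>t / 2\<close>, with \<open>B\<close> bounding the inner transform.\<close>
  have "((\<lambda>t. \<integral>\<xi>. a \<xi> * exp (- t * q \<xi>) * T \<xi> \<partial>lborel) has_real_derivative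
      (\<integral>\<xi>. - (a \<xi> * q \<xi> * exp (- t * q \<xi>) * T \<xi>) \<partial>lborel)) (at t)"
  proof (rule has_real_derivative_integral[where \<delta> = "t/2" and g = "\<lambda>\<xi>. B * \<bar>a \<xi> * q \<xi> * exp (- (t/2) * q \<xi>)\<bar>"])
    fix \<tau> assume \<tau>: "\<bar>\<tau> - t\<bar> < t / 2"
    then have \<tau>0: "\<tau> > t/2" by (simp add: abs_if split: if_splits)
    show "integrable lborel (\<lambda>\<xi>. a \<xi> * exp (- \<tau> * q \<xi>) * T \<xi>)"
      unfolding T_def using \<tau>0 t by (intro integrable_conv_heat a f) simp
    fix \<xi>
    show "((\<lambda>\<tau>. a \<xi> * exp (- \<tau> * q \<xi>) * T \<xi>) has_real_derivative
        - (a \<xi> * q \<xi> * exp (- \<tau> * q \<xi>) * T \<xi>)) (at \<tau>)"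
      by (auto intro!: derivative_eq_intros)
    have "exp (- \<tau> * q \<xi>) \<le> exp (- (t/2) * q \<xi>)"
      using \<tau>0 q_nonneg[of \<xi>] mult_right_mono[of "t/2" \<tau> "q \<xi>"] by simp
    then have "\<bar>a \<xi> * q \<xi>\<bar> * exp (- \<tau> * q \<xi>) * \<bar>T \<xi>\<bar> \<le> \<bar>a \<xi> * q \<xi>\<bar> * exp (- (t/2) * q \<xi>) * B"
      using T[of \<xi>] by (intro mult_mono) auto
    then show "\<bar>- (a \<xi> * q \<xi> * exp (- \<tau> * q \<xi>) * T \<xi>)\<bar> \<le> B * \<bar>a \<xi> * q \<xi> * exp (- (t/2) * q \<xi>)\<bar>"
      by (simp add: abs_mult mult_ac)
  next
    show "integrable lborel (\<lambda>\<xi>. B * \<bar>a \<xi> * q \<xi> * exp (- (t/2) * q \<xi>)\<bar>)"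
      using integrable_heat_symbol[OF aq, of "t/2"] t by (intro integrable_mult_right integrable_abs) auto
    show "(\<lambda>\<xi>. - (a \<xi> * q \<xi> * exp (- t * q \<xi>) * T \<xi>)) \<in> borel_measurable lborel"
      unfolding T_def
      by (intro borel_measurable_uminus borel_measurable_integrable integrable_conv_heat aq f t)
  qed (use t in simp)
  then show ?thesis by (simp add: conv_heat_def T_def)
qed

lemma conv_heat_has_derivative_space:
  assumes a: "real_polynomial_function a" and t: "t > 0" and f: "integrable lborel f"
  shows "((\<lambda>\<tau>. conv_heat t a m f (x + \<tau> *\<^sub>R v)) has_real_derivative
    conv_heat t (\<lambda>\<xi>. a \<xi> * (\<xi> \<bullet> v)) (Suc m) f (x + \<tau> *\<^sub>R v)) (at \<tau>)"
proof -
  define T where "T m \<tau> \<xi> = (\<integral>y. f y * osc m ((x + \<tau> *\<^sub>R v - y) \<bullet> \<xi>) \<partial>lborel)" for m \<tau> \<xi>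
  define B where "B = (\<integral>y. \<bar>f y\<bar> \<partial>lborel)"
  have T: "\<bar>T m \<tau> \<xi>\<bar> \<le> B" for m \<tau> \<xi> unfolding T_def B_def by (rule abs_fourier_le[OF f])
  have av: "real_polynomial_function (\<lambda>\<xi>. a \<xi> * (\<xi> \<bullet> v))"
    by (intro real_polynomial_function.intros(4) a real_polynomial_function_inner)
  \<comment> \<open>The x-dependence sits in the oscillation, so the derivative falls on it and not
    on \<open>f\<close>; the resulting factor \<open>\<xi> \<bullet> v\<close> is absorbed into the
    symbol.\<close>
  have dT: "((\<lambda>\<tau>. T m \<tau> \<xi>) has_real_derivative (\<xi> \<bullet> v) * T (Suc m) \<tau> \<xi>) (at \<tau>)" for m \<tau> \<xi>
  proof -
    have "((\<lambda>\<tau>. \<integral>y. f y * osc m ((x + \<tau> *\<^sub>R v - y) \<bullet> \<xi>) \<partial>lborel) has_real_derivative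
      (\<integral>y. f y * osc (Suc m) ((x + \<tau> *\<^sub>R v - y) \<bullet> \<xi>) * (\<xi> \<bullet> v) \<partial>lborel)) (at \<tau>)"
    proof (rule has_real_derivative_integral[where \<delta> = 1 and g = "\<lambda>y. \<bar>f y\<bar> * \<bar>\<xi> \<bullet> v\<bar>"])
      show int: "integrable lborel (\<lambda>y. f y * osc m ((x + \<tau> *\<^sub>R v - y) \<bullet> \<xi>))" for m \<tau>
        by (rule integrable_osc[OF f]) measurable
      show "(\<lambda>y. f y * osc (Suc m) ((x + \<tau> *\<^sub>R v - y) \<bullet> \<xi>) * (\<xi> \<bullet> v)) \<in> borel_measurable lborel"
        by (rule borel_measurable_times[OF borel_measurable_integrable[OF int]]) simp
      fix \<tau> y
      have "((\<lambda>\<tau>. (x + \<tau> *\<^sub>R v - y) \<bullet> \<xi>) has_real_derivative \<xi> \<bullet> v) (at \<tau>)"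
        unfolding inner_diff_left inner_add_left inner_scaleR_left inner_commute[of v]
        by (auto intro!: derivative_eq_intros)
      from DERIV_cmult[OF DERIV_chain2[OF osc_has_derivative this]]
      show "((\<lambda>\<tau>. f y * osc m ((x + \<tau> *\<^sub>R v - y) \<bullet> \<xi>)) has_real_derivative
        f y * osc (Suc m) ((x + \<tau> *\<^sub>R v - y) \<bullet> \<xi>) * (\<xi> \<bullet> v)) (at \<tau>)" by (simp add: mult.assoc)
      show "\<bar>f y * osc (Suc m) ((x + \<tau> *\<^sub>R v - y) \<bullet> \<xi>) * (\<xi> \<bullet> v)\<bar> \<le> \<bar>f y\<bar> * \<bar>\<xi> \<bullet> v\<bar>"
        unfolding abs_mult by (intro mult_right_mono mult_left_le abs_osc_le_1) auto
    qed (use f in auto)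
    then show ?thesis unfolding T_def by (simp add: mult.commute)
  qed
  have "((\<lambda>\<tau>. \<integral>\<xi>. a \<xi> * exp (- t * q \<xi>) * T m \<tau> \<xi> \<partial>lborel) has_real_derivative
      (\<integral>\<xi>. a \<xi> * (\<xi> \<bullet> v) * exp (- t * q \<xi>) * T (Suc m) \<tau> \<xi> \<partial>lborel)) (at \<tau>)"
  proof (rule has_real_derivative_integral[where \<delta> = 1 and g = "\<lambda>\<xi>. B * \<bar>a \<xi> * (\<xi> \<bullet> v) * exp (- t * q \<xi>)\<bar>"])
    fix \<tau>
    show "integrable lborel (\<lambda>\<xi>. a \<xi> * exp (- t * q \<xi>) * T m \<tau> \<xi>)"
      unfolding T_def by (intro integrable_conv_heat a f t)
    fix \<xi>
    show "((\<lambda>\<tau>. a \<xi> * exp (- t * q \<xi>) * T m \<tau> \<xi>) has_real_derivative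
        a \<xi> * (\<xi> \<bullet> v) * exp (- t * q \<xi>) * T (Suc m) \<tau> \<xi>) (at \<tau>)"
      using DERIV_cmult[OF dT, of "a \<xi> * exp (- t * q \<xi>)"] by (simp add: mult_ac)
    have "\<bar>a \<xi> * (\<xi> \<bullet> v) * exp (- t * q \<xi>)\<bar> * \<bar>T (Suc m) \<tau> \<xi>\<bar> \<le> \<bar>a \<xi> * (\<xi> \<bullet> v) * exp (- t * q \<xi>)\<bar> * B"
      using T by (intro mult_left_mono) auto
    then show "\<bar>a \<xi> * (\<xi> \<bullet> v) * exp (- t * q \<xi>) * T (Suc m) \<tau> \<xi>\<bar> \<le> B * \<bar>a \<xi> * (\<xi> \<bullet> v) * exp (- t * q \<xi>)\<bar>"
      by (simp add: abs_mult mult_ac)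
  next
    show "integrable lborel (\<lambda>\<xi>. B * \<bar>a \<xi> * (\<xi> \<bullet> v) * exp (- t * q \<xi>)\<bar>)"
      using integrable_heat_symbol[OF av t] by (intro integrable_mult_right integrable_abs) auto
    show "(\<lambda>\<xi>. a \<xi> * (\<xi> \<bullet> v) * exp (- t * q \<xi>) * T (Suc m) \<tau> \<xi>) \<in> borel_measurable lborel"
      unfolding T_def by (intro borel_measurable_integrable integrable_conv_heat av f t)
  qed simp
  then show ?thesis by (simp add: conv_heat_def T_def)
qed

lemma conv_heat_at_top:
  assumes a: "real_polynomial_function a" and f: "integrable lborel f"
  shows "((\<lambda>t. conv_heat t a m f x) \<longlongrightarrow> 0) at_top"
proof -
  define T where "T \<xi> = (\<integral>y. f y * osc m ((x - y) \<bullet> \<xi>) \<partial>lborel)" for \<xi>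
  define B where "B = (\<integral>y. \<bar>f y\<bar> \<partial>lborel)"
  have T: "\<bar>T \<xi>\<bar> \<le> B" for \<xi> unfolding T_def B_def by (rule abs_fourier_le[OF f])
  have meas: "(\<lambda>\<xi>. a \<xi> * exp (- t * q \<xi>) * T \<xi>) \<in> borel_measurable lborel" if "t > 0" for t
    unfolding T_def by (intro borel_measurable_integrable integrable_conv_heat a f that)
  \<comment> \<open>\<open>max 1 t\<close> keeps the integrand dominated by the symbol at time 1 for
    every real t and agrees with t near infinity. Pointwise convergence can fail only at \<xi> =
    0.\<close>
  have "((\<lambda>t. \<integral>\<xi>. a \<xi> * exp (- (max 1 t) * q \<xi>) * T \<xi> \<partial>lborel) \<longlongrightarrow> (\<integral>\<xi>. 0 \<partial>(lborel::'a measure))) at_top"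
  proof (rule integral_dominated_convergence_at_top)
    show "integrable lborel (\<lambda>\<xi>. B * \<bar>a \<xi> * exp (- 1 * q \<xi>)\<bar>)"
      by (intro integrable_mult_right integrable_abs integrable_heat_symbol a) simp
    show "\<forall>\<^sub>F t in at_top. AE \<xi> in lborel. norm (a \<xi> * exp (- (max 1 t) * q \<xi>) * T \<xi>) \<le> B * \<bar>a \<xi> * exp (- 1 * q \<xi>)\<bar>"
    proof (intro always_eventually allI AE_I2)
      fix t \<xi>
      have "exp (- (max 1 t) * q \<xi>) \<le> exp (- 1 * q \<xi>)"
        using mult_right_mono[of 1 "max 1 t" "q \<xi>"] q_nonneg[of \<xi>] by simp
      then have "\<bar>a \<xi>\<bar> * exp (- (max 1 t) * q \<xi>) * \<bar>T \<xi>\<bar> \<le> \<bar>a \<xi>\<bar> * exp (- 1 * q \<xi>) * B"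
        using T[of \<xi>] by (intro mult_mono) auto
      then show "norm (a \<xi> * exp (- (max 1 t) * q \<xi>) * T \<xi>) \<le> B * \<bar>a \<xi> * exp (- 1 * q \<xi>)\<bar>"
        by (simp add: abs_mult mult_ac)
    qed
    show "AE \<xi> in lborel. ((\<lambda>t. a \<xi> * exp (- (max 1 t) * q \<xi>) * T \<xi>) \<longlongrightarrow> 0) at_top"
      using AE_lborel_singleton[of "0::'a"]
    proof eventually_elim
      fix \<xi> :: 'a assume "\<xi> \<noteq> 0"
      then have "q \<xi> > 0" by (rule q_pos)
      then have "((\<lambda>t. exp (- t * q \<xi>)) \<longlongrightarrow> 0) at_top" by real_asymp
      moreover have "\<forall>\<^sub>F t in at_top. exp (- t * q \<xi>) = exp (- (max 1 t) * q \<xi>)"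
        using eventually_ge_at_top[of 1] by eventually_elim (simp add: max_def)
      ultimately have "((\<lambda>t. exp (- (max 1 t) * q \<xi>)) \<longlongrightarrow> 0) at_top"
        by (rule Lim_transform_eventually)
      from tendsto_mult[OF tendsto_mult[OF tendsto_const this] tendsto_const]
      show "((\<lambda>t. a \<xi> * exp (- (max 1 t) * q \<xi>) * T \<xi>) \<longlongrightarrow> 0) at_top" by simp
    qed
    show "(\<lambda>\<xi>. a \<xi> * exp (- (max 1 t) * q \<xi>) * T \<xi>) \<in> borel_measurable lborel" for t by (rule meas) simp
  qed simp
  moreover have "\<forall>\<^sub>F t in at_top. (\<integral>\<xi>. a \<xi> * exp (- (max 1 t) * q \<xi>) * T \<xi> \<partial>lborel) = conv_heat t a m f x"
    using eventually_ge_at_top[of 1] by eventually_elim (simp add: max_def conv_heat_def T_def)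
  ultimately show ?thesis by (simp add: Lim_transform_eventually)
qed

section \<open>Kernels of the flow: decay, cancellation and scaling\<close>

lemma integrable_kernel_symbol:
  assumes "real_polynomial_function a"
  shows "integrable lborel (\<lambda>\<xi>. a \<xi> * exp (- q \<xi>))"
    "integrable lborel (\<lambda>\<xi>. a \<xi> * exp (- q \<xi>) * osc m (z \<bullet> \<xi>))"
proof -
  show 1: "integrable lborel (\<lambda>\<xi>. a \<xi> * exp (- q \<xi>))"
    using integrable_heat_symbol[OF assms, of 1] by simp
  show "integrable lborel (\<lambda>\<xi>. a \<xi> * exp (- q \<xi>) * osc m (z \<bullet> \<xi>))"
    by (rule integrable_osc[OF 1]) measurable
qed

text \<open>\<open>(z \<bullet> v) * osc m (z \<bullet> \<xi>)\<close> is the derivative along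
  \<open>v\<close> in \<xi> of \<open>osc (m + 3)\<close>, so integration by parts moves it onto
  \<open>a exp (- q)\<close>; the new symbol is \<open>a q' - a'\<close>.\<close>

lemma kernel_mult_inner:
  assumes a: "real_polynomial_function a"
  shows "\<exists>b. real_polynomial_function b \<and> (\<forall>z. (z \<bullet> v) * kernel a m z = kernel b (m + 3) z)"
proof -
  obtain a' q' where a': "real_polynomial_function a'"
      "\<And>x. ((\<lambda>\<sigma>. a (x + \<sigma> *\<^sub>R v)) has_real_derivative a' x) (at 0)"
    and q': "real_polynomial_function q'"
      "\<And>x. ((\<lambda>\<sigma>. q (x + \<sigma> *\<^sub>R v)) has_real_derivative q' x) (at 0)"
    using real_polynomial_function_directional_derivative[OF a]
      real_polynomial_function_directional_derivative[OF poly_q] by metis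
  define b where "b \<xi> = a \<xi> * q' \<xi> - a' \<xi>" for \<xi>
  have b: "real_polynomial_function b"
    unfolding b_def by (intro real_polynomial_function_diff real_polynomial_function.intros(4) a a' q')
  have "(z \<bullet> v) * kernel a m z = kernel b (m + 3) z" for z
  proof -
    define h where "h \<xi> = a \<xi> * exp (- q \<xi>) * osc (m + 3) (z \<bullet> \<xi>)" for \<xi>
    define h' where "h' \<xi> = (z \<bullet> v) * (a \<xi> * exp (- q \<xi>) * osc m (z \<bullet> \<xi>)) -
       b \<xi> * exp (- q \<xi>) * osc (m + 3) (z \<bullet> \<xi>)" for \<xi>
    have "(\<integral>\<xi>. h' \<xi> \<partial>lborel) = 0"
    proof (rule integral_directional_derivative_eq_0)
      show "integrable lborel h" "integrable lborel h'"
        unfolding h_def h'_def using integrable_kernel_symbol a b by auto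
      show "continuous_on UNIV h'"
        unfolding h'_def
        by (intro continuous_intros continuous_on_q real_polynomial_function_continuous_on a b)
      fix \<xi>
      have "((\<lambda>\<sigma>. z \<bullet> (\<xi> + \<sigma> *\<^sub>R v)) has_real_derivative (z \<bullet> v)) (at 0)"
        unfolding inner_add_right inner_scaleR_right by (auto intro!: derivative_eq_intros)
      from DERIV_chain2[OF osc_has_derivative this, of "m + 3"]
      have 1: "((\<lambda>\<sigma>. osc (m + 3) (z \<bullet> (\<xi> + \<sigma> *\<^sub>R v))) has_real_derivative
          osc m (z \<bullet> \<xi>) * (z \<bullet> v)) (at 0)" by (simp only: osc_add_4) simp
      have 2: "((\<lambda>\<sigma>. exp (- q (\<xi> + \<sigma> *\<^sub>R v))) has_real_derivative exp (- q \<xi>) * - q' \<xi>) (at 0)"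
        using DERIV_chain2[OF DERIV_exp DERIV_minus[OF q'(2)[of \<xi>]]] by simp
      show "((\<lambda>\<sigma>. h (\<xi> + \<sigma> *\<^sub>R v)) has_real_derivative h' \<xi>) (at 0)"
        using DERIV_mult[OF DERIV_mult[OF a'(2)[of \<xi>] 2] 1]
        unfolding h_def h'_def b_def by (simp add: algebra_simps)
    qed
    then show ?thesis
      unfolding h'_def kernel_def using integrable_kernel_symbol a b by simp
  qed
  then show ?thesis using b by blast
qed

text \<open>Multiplication by a linear form adds 3 to the index, so polynomials with terms of
  several degrees lead to sums of kernels with different indices. Closing under sums gives a class
  stable under multiplication by polynomials.\<close>

inductive_set kernels :: "('a \<Rightarrow> real) set" where
  base: "real_polynomial_function a \<Longrightarrow> kernel a m \<in> kernels"
| plus: "k \<in> kernels \<Longrightarrow> l \<in> kernels \<Longrightarrow> (\<lambda>z. k z + l z) \<in> kernels"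

lemma kernels_cmult:
  assumes "k \<in> kernels" shows "(\<lambda>z. c * k z) \<in> kernels"
  using assms
proof induction
  case (base a m)
  have "(\<lambda>z. c * kernel a m z) = kernel (\<lambda>\<xi>. c * a \<xi>) m"
    unfolding kernel_def using integrable_kernel_symbol[OF base] by (auto simp: mult.assoc)
  moreover have "real_polynomial_function (\<lambda>\<xi>. c * a \<xi>)"
    by (intro real_polynomial_function.intros(4) real_polynomial_function.intros(2) base)
  ultimately show ?case using kernels.base[of "\<lambda>\<xi>. c * a \<xi>" m] by simp
next
  case (plus k l)
  then show ?case using kernels.plus by (simp add: distrib_left)
qed

lemma kernels_mult_inner:
  assumes "k \<in> kernels" shows "(\<lambda>z. (z \<bullet> v) * k z) \<in> kernels"
  using assms
proof induction
  case (base a m)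
  obtain b where b: "real_polynomial_function b" "\<And>z. (z \<bullet> v) * kernel a m z = kernel b (m + 3) z"
    using kernel_mult_inner[OF base] by blast
  then have "(\<lambda>z. (z \<bullet> v) * kernel a m z) = kernel b (m + 3)" by auto
  then show ?case using b(1) by (auto intro: kernels.base)
next
  case (plus k l)
  then show ?case using kernels.plus by (simp add: distrib_left)
qed

lemma kernels_mult_polynomial:
  assumes "real_polynomial_function p" "k \<in> kernels"
  shows "(\<lambda>z. p z * k z) \<in> kernels"
  using assms
proof (induction arbitrary: k)
  case (linear f)
  interpret bounded_linear f by fact
  have "f z = z \<bullet> (\<Sum>b\<in>Basis. f b *\<^sub>R b)" for z
  proof -
    have "f z = f (\<Sum>b\<in>Basis. (z \<bullet> b) *\<^sub>R b)" by (simp add: euclidean_representation)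
    then show ?thesis by (simp add: sum scaleR inner_sum_right mult.commute)
  qed
  then obtain u where "f = (\<lambda>z. z \<bullet> u)" by (intro that ext)
  then show ?case using kernels_mult_inner[OF linear.prems, of u] by simp
next
  case (const c)
  then show ?case by (rule kernels_cmult)
next
  case (add f g)
  then show ?case using kernels.plus by (simp add: distrib_right)
next
  case (mult f g)
  from mult.IH(1)[OF mult.IH(2)[OF mult.prems]] show ?case by (simp add: mult.assoc)
qed

lemma kernels_continuous_bounded:
  assumes "k \<in> kernels" shows "continuous_on UNIV k \<and> (\<exists>C. \<forall>z. \<bar>k z\<bar> \<le> C)"
  using assms
proof induction
  case (base a m)
  note int = integrable_kernel_symbol[OF base]
  have "\<bar>kernel a m z\<bar> \<le> (\<integral>\<xi>. \<bar>a \<xi> * exp (- q \<xi>)\<bar> \<partial>lborel)" for z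
    unfolding kernel_def by (rule abs_fourier_le[OF int(1)])
  moreover have "continuous_on UNIV (kernel a m)"
    unfolding continuous_on_sequentially comp_def
  proof (intro allI ballI impI, elim conjE)
    fix X :: "nat \<Rightarrow> 'a" and z assume X: "X \<longlonglongrightarrow> z"
    show "(\<lambda>n. kernel a m (X n)) \<longlonglongrightarrow> kernel a m z"
      unfolding kernel_def
    proof (rule integral_dominated_convergence[where w = "\<lambda>\<xi>. \<bar>a \<xi> * exp (- q \<xi>)\<bar>"])
      show "AE \<xi> in lborel. (\<lambda>n. a \<xi> * exp (- q \<xi>) * osc m (X n \<bullet> \<xi>)) \<longlonglongrightarrow> a \<xi> * exp (- q \<xi>) * osc m (z \<bullet> \<xi>)"
        unfolding osc_def by (intro AE_I2 tendsto_intros X)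
      show "AE \<xi> in lborel. norm (a \<xi> * exp (- q \<xi>) * osc m (X n \<bullet> \<xi>)) \<le> \<bar>a \<xi> * exp (- q \<xi>)\<bar>" for n
        unfolding real_norm_def abs_mult by (intro AE_I2 mult_left_le abs_osc_le_1) auto
      show "(\<lambda>\<xi>. a \<xi> * exp (- q \<xi>) * osc m (X n \<bullet> \<xi>)) \<in> borel_measurable lborel" for n
        using int(2) by (rule borel_measurable_integrable)
      show "(\<lambda>\<xi>. a \<xi> * exp (- q \<xi>) * osc m (z \<bullet> \<xi>)) \<in> borel_measurable lborel"
        using int(2) by (rule borel_measurable_integrable)
    qed (use int in auto)
  qed
  ultimately show ?case by blast
next
  case (plus k l)
  then obtain C D where "\<And>z. \<bar>k z\<bar> \<le> C" "\<And>z. \<bar>l z\<bar> \<le> D" by auto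
  then have "\<bar>k z + l z\<bar> \<le> C + D" for z using abs_triangle_ineq[of "k z" "l z"] by (meson add_mono order_trans)
  then show ?case using plus by (auto intro: continuous_intros)
qed

text \<open>Boundedness is upgraded to integrability: \<open>w * k\<close> is again in the class,
  hence bounded, and 1/w is integrable.\<close>

lemma integrable_kernels:
  assumes k: "k \<in> kernels" shows "integrable lborel k"
proof -
  define w where "w z = (\<Prod>b\<in>Basis. 1 + (z \<bullet> b)\<^sup>2)" for z :: 'a
  have w: "w \<xi> > 0" for \<xi> unfolding w_def by (intro prod_pos) (auto intro: add_pos_nonneg)
  have "real_polynomial_function w"
    unfolding w_def by (intro real_polynomial_function.intros(3) real_polynomial_function.intros(2)
      real_polynomial_function_prod real_polynomial_function_power real_polynomial_function_inner) auto
  from kernels_continuous_bounded[OF kernels_mult_polynomial[OF this k]]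
  obtain C where C: "\<And>z. \<bar>w z * k z\<bar> \<le> C" by blast
  have inv: "inverse (w z) = (\<Prod>b\<in>Basis. inverse (1 + (z \<bullet> b)\<^sup>2))" for z
    unfolding w_def by (simp add: prod_inversef[symmetric] comp_def)
  have bnd: "norm (k z) \<le> norm (C * inverse (w z))" for z
    using C[of z] w[of z] by (simp add: abs_mult field_simps)
  show ?thesis
    by (rule Bochner_Integration.integrable_bound[OF _ _ AE_I2[OF bnd]])
       (use kernels_continuous_bounded[OF k] in \<open>auto simp: inv
         intro!: integrable_mult_right integrable_prod_inverse_1_plus_square borel_measurable_continuous_onI\<close>)
qed

text \<open>The factor \<open>\<xi> \<bullet> v\<close> in the symbol makes this kernel the
  derivative along \<open>v\<close> of the integrable \<open>kernel a (m + 3)\<close>. This is the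
  cancellation on which the terms with Hoelder data rely.\<close>

lemma integral_kernel_eq_0:
  assumes a: "real_polynomial_function a"
  shows "(\<integral>z. kernel (\<lambda>\<xi>. a \<xi> * (\<xi> \<bullet> v)) m z \<partial>lborel) = 0"
proof (rule integral_directional_derivative_eq_0)
  have av: "real_polynomial_function (\<lambda>\<xi>. a \<xi> * (\<xi> \<bullet> v))"
    by (intro real_polynomial_function.intros(4) a real_polynomial_function_inner)
  show "integrable lborel (kernel a (m + 3))" "integrable lborel (kernel (\<lambda>\<xi>. a \<xi> * (\<xi> \<bullet> v)) m)"
    by (intro integrable_kernels kernels.base a av)+
  show "continuous_on UNIV (kernel (\<lambda>\<xi>. a \<xi> * (\<xi> \<bullet> v)) m)"
    using kernels_continuous_bounded[OF kernels.base[OF av]] by blast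
  fix z
  have "((\<lambda>\<sigma>. \<integral>\<xi>. a \<xi> * exp (- q \<xi>) * osc (m + 3) ((z + \<sigma> *\<^sub>R v) \<bullet> \<xi>) \<partial>lborel) has_real_derivative
      (\<integral>\<xi>. a \<xi> * (\<xi> \<bullet> v) * exp (- q \<xi>) * osc m ((z + 0 *\<^sub>R v) \<bullet> \<xi>) \<partial>lborel)) (at 0)"
  proof (rule has_real_derivative_integral[where \<delta> = 1 and g = "\<lambda>\<xi>. \<bar>a \<xi> * (\<xi> \<bullet> v) * exp (- q \<xi>)\<bar>"])
    fix \<sigma> \<xi>
    have "((\<lambda>\<sigma>. (z + \<sigma> *\<^sub>R v) \<bullet> \<xi>) has_real_derivative \<xi> \<bullet> v) (at \<sigma>)"
      unfolding inner_add_left inner_scaleR_left inner_commute[of v] by (auto intro!: derivative_eq_intros)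
    from DERIV_cmult[OF DERIV_chain2[OF osc_has_derivative this, of "m + 3"], of "a \<xi> * exp (- q \<xi>)"]
    show "((\<lambda>\<sigma>. a \<xi> * exp (- q \<xi>) * osc (m + 3) ((z + \<sigma> *\<^sub>R v) \<bullet> \<xi>)) has_real_derivative
        a \<xi> * (\<xi> \<bullet> v) * exp (- q \<xi>) * osc m ((z + \<sigma> *\<^sub>R v) \<bullet> \<xi>)) (at \<sigma>)"
      unfolding osc_add_4 by (simp add: mult_ac)
    show "\<bar>a \<xi> * (\<xi> \<bullet> v) * exp (- q \<xi>) * osc m ((z + \<sigma> *\<^sub>R v) \<bullet> \<xi>)\<bar> \<le> \<bar>a \<xi> * (\<xi> \<bullet> v) * exp (- q \<xi>)\<bar>"
      unfolding abs_mult[of _ "osc _ _"] by (intro mult_left_le abs_osc_le_1) auto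
  next
    show "integrable lborel (\<lambda>\<xi>. \<bar>a \<xi> * (\<xi> \<bullet> v) * exp (- q \<xi>)\<bar>)"
      using integrable_kernel_symbol(1)[OF av] by (rule integrable_abs)
    show "(\<lambda>\<xi>. a \<xi> * (\<xi> \<bullet> v) * exp (- q \<xi>) * osc m ((z + 0 *\<^sub>R v) \<bullet> \<xi>)) \<in> borel_measurable lborel"
      by (intro borel_measurable_integrable integrable_kernel_symbol(2) av)
  qed (use integrable_kernel_symbol[OF a] in auto)
  then show "((\<lambda>\<sigma>. kernel a (m + 3) (z + \<sigma> *\<^sub>R v)) has_real_derivative kernel (\<lambda>\<xi>. a \<xi> * (\<xi> \<bullet> v)) m z) (at 0)"
    by (simp add: kernel_def)
qed

text \<open>Substitute \<xi> = \<eta> / r and y = x - r z. Homogeneity turns r^e q(\<eta> / r) into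
  q(\<eta>), the two Jacobians cancel, and the degree of \<open>a\<close> leaves the factor
  \<open>1 / r ^ h\<close>. Fubini then collects the frequency integral into the kernel.\<close>

lemma conv_heat_scaling:
  assumes a: "real_polynomial_function a" and hom: "\<And>r \<xi>. a (r *\<^sub>R \<xi>) = r ^ h * a \<xi>"
    and r: "r > 0" and f: "integrable lborel f"
  shows "conv_heat (r ^ e) a m f x = (\<integral>z. kernel a m z * f (x - r *\<^sub>R z) \<partial>lborel) / r ^ h"
proof -
  let ?n = "DIM('a)"
  have fr: "integrable lborel (\<lambda>z. f (x - r *\<^sub>R z))"
    using lborel_integral_affine(2)[of "- r" f x] f r by simp
  have "(\<integral>y. f y * osc m ((x - y) \<bullet> ((1/r) *\<^sub>R \<eta>)) \<partial>lborel)
      = r ^ ?n * (\<integral>z. f (x - r *\<^sub>R z) * osc m (z \<bullet> \<eta>) \<partial>lborel)" for \<eta>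
    using lborel_integral_affine(1)[of "- r" "\<lambda>y. f y * osc m ((x - y) \<bullet> ((1/r) *\<^sub>R \<eta>))" x] r
    by simp
  moreover have "conv_heat (r ^ e) a m f x = (1/r) ^ ?n * (\<integral>\<eta>. a ((1/r) *\<^sub>R \<eta>) * exp (- (r ^ e) * q ((1/r) *\<^sub>R \<eta>)) *
      (\<integral>y. f y * osc m ((x - y) \<bullet> ((1/r) *\<^sub>R \<eta>)) \<partial>lborel) \<partial>lborel)"
    unfolding conv_heat_def
    using lborel_integral_affine(1)[of "1/r" "\<lambda>\<xi>. a \<xi> * exp (- (r ^ e) * q \<xi>) * (\<integral>y. f y * osc m ((x - y) \<bullet> \<xi>) \<partial>lborel)" 0] r
    by simp
  ultimately have "conv_heat (r ^ e) a m f x = (1/r) ^ ?n * (\<integral>\<eta>. ((1/r) ^ h * r ^ ?n) * (a \<eta> * exp (- q \<eta>) *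
      (\<integral>z. f (x - r *\<^sub>R z) * osc m (z \<bullet> \<eta>) \<partial>lborel)) \<partial>lborel)"
    unfolding hom homogeneous using r by (simp add: power_one_over mult_ac)
  also have "\<dots> = (1/r) ^ h * (\<integral>\<eta>. a \<eta> * exp (- q \<eta>) * (\<integral>z. f (x - r *\<^sub>R z) * osc m (z \<bullet> \<eta>) \<partial>lborel) \<partial>lborel)"
    using r by (subst integral_mult_right_zero) (simp add: power_one_over)
  also have "(\<integral>\<eta>. a \<eta> * exp (- q \<eta>) * (\<integral>z. f (x - r *\<^sub>R z) * osc m (z \<bullet> \<eta>) \<partial>lborel) \<partial>lborel)
      = (\<integral>z. f (x - r *\<^sub>R z) * kernel a m z \<partial>lborel)"
    unfolding kernel_def
    by (rule Fubini_bounded_kernel(2)[OF integrable_kernel_symbol(1)[OF a] fr osc_measurable_pair(2) abs_osc_le_1])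
  finally show ?thesis by (simp add: power_one_over mult_ac)
qed

section \<open>Scaling bounds for data in L^p and for Hoelder data\<close>

lemma integrable_kernel:
  assumes "real_polynomial_function a"
  shows "integrable lborel (kernel a m)"
  by (intro integrable_kernels kernels.base assms)

text \<open>The excess power \<open>s - 1\<close> is estimated by the supremum of the kernel. The
  dual exponent in Hoelder's inequality is the case of interest.\<close>

lemma integrable_kernel_powr:
  assumes a: "real_polynomial_function a" and s: "s \<ge> 1"
  shows "integrable lborel (\<lambda>z. \<bar>kernel a m z\<bar> powr s)"
proof -
  have k: "kernel a m \<in> kernels" by (intro kernels.base a)
  obtain C where C: "\<And>z. \<bar>kernel a m z\<bar> \<le> C" using kernels_continuous_bounded[OF k] by blast
  have C0: "C \<ge> 0" using C[of 0] by simp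
  have "\<bar>kernel a m z\<bar> powr s \<le> C powr (s - 1) * \<bar>kernel a m z\<bar>" for z
  proof -
    have "\<bar>kernel a m z\<bar> powr s = \<bar>kernel a m z\<bar> powr (s - 1) * \<bar>kernel a m z\<bar>"
      by (cases "kernel a m z = 0") (simp_all add: powr_diff)
    also have "\<dots> \<le> C powr (s - 1) * \<bar>kernel a m z\<bar>"
      using s C by (intro mult_right_mono powr_mono2) auto
    finally show ?thesis .
  qed
  then have bnd: "norm (\<bar>kernel a m z\<bar> powr s) \<le> norm (C powr (s - 1) * kernel a m z)" for z
    by (simp add: abs_mult)
  have [measurable]: "kernel a m \<in> borel_measurable borel"
    using borel_measurable_integrable[OF integrable_kernel[OF a]] by simp
  show ?thesis
    by (rule Bochner_Integration.integrable_bound[OF _ _ AE_I2[OF bnd]])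
       (use integrable_kernel[OF a] in auto)
qed

lemma conv_heat_Lp_bound:
  assumes a: "real_polynomial_function a" and hom: "\<And>r \<xi>. a (r *\<^sub>R \<xi>) = r ^ h * a \<xi>" and p: "p > 1"
  shows "\<exists>C\<ge>0. \<forall>f x r \<nu>. r > 0 \<longrightarrow> \<nu> > 0 \<longrightarrow> integrable lborel f \<longrightarrow>
    integrable lborel (\<lambda>y. \<bar>f y\<bar> powr p) \<longrightarrow> (\<integral>y. \<bar>f y\<bar> powr p \<partial>lborel) \<le> \<nu> powr p \<longrightarrow>
    \<bar>conv_heat (r ^ e) a m f x\<bar> \<le> C * \<nu> * r powr (- real h - real DIM('a) / p)"
proof -
  define C where "C = (\<integral>z. \<bar>kernel a m z\<bar> powr (p / (p - 1)) \<partial>lborel) + 1"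
  have p': "p / (p - 1) \<ge> 1" using p by simp
  have C0: "C \<ge> 0" unfolding C_def by (intro add_nonneg_nonneg integral_nonneg_AE AE_I2) auto
  have "\<bar>conv_heat (r ^ e) a m f x\<bar> \<le> C * \<nu> * r powr (- real h - real DIM('a) / p)"
    if r: "r > 0" and \<nu>: "\<nu> > 0" and f: "integrable lborel f"
      and fp: "integrable lborel (\<lambda>y. \<bar>f y\<bar> powr p)" "(\<integral>y. \<bar>f y\<bar> powr p \<partial>lborel) \<le> \<nu> powr p" for f x r \<nu>
  proof -
    \<comment> \<open>\<open>\<mu>\<close> bounds the L^p norm of
      \<open>\<lambda>z. f (x - r *\<^sub>R z)\<close>: rescaling by r produces the factor
      r^(-n/p).\<close>
    define \<mu> where "\<mu> = \<nu> * r powr (- real DIM('a) / p)"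
    have \<mu>: "\<mu> > 0" using \<nu> r by (simp add: \<mu>_def)
    have sc: "integrable lborel (\<lambda>z. \<bar>f (x - r *\<^sub>R z)\<bar> powr p)"
      "(\<integral>y. \<bar>f y\<bar> powr p \<partial>lborel) = r ^ DIM('a) * (\<integral>z. \<bar>f (x - r *\<^sub>R z)\<bar> powr p \<partial>lborel)"
      using lborel_integral_affine[of "- r" "\<lambda>y. \<bar>f y\<bar> powr p" x] r fp by simp_all
    have "\<mu> powr p = \<nu> powr p * r powr (- real DIM('a))"
      using r \<nu> p by (simp add: \<mu>_def powr_mult powr_powr)
    also have "\<dots> = \<nu> powr p / r ^ DIM('a)"
      using r by (simp add: powr_minus powr_realpow divide_inverse)
    finally have "r ^ DIM('a) * (\<mu> powr p) = \<nu> powr p"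
      using r by simp
    then have "r ^ DIM('a) * (\<integral>z. \<bar>f (x - r *\<^sub>R z)\<bar> powr p \<partial>lborel) \<le> r ^ DIM('a) * (\<mu> powr p)"
      using sc(2) fp(2) by simp
    then have "(\<integral>z. \<bar>f (x - r *\<^sub>R z)\<bar> powr p \<partial>lborel) \<le> \<mu> powr p"
      by (rule mult_left_le_imp_le) (use r in simp)
    then have "\<bar>\<integral>z. kernel a m z * f (x - r *\<^sub>R z) \<partial>lborel\<bar> \<le> C * \<mu>"
      unfolding C_def using abs_integral_mult_le_powr[OF p \<mu> integrable_kernel_powr[OF a p'] sc(1)] by blast
    then have "\<bar>conv_heat (r ^ e) a m f x\<bar> \<le> C * \<mu> / r ^ h"
      unfolding conv_heat_scaling[OF a hom r f] using r by (simp add: divide_right_mono)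
    also have "\<dots> = C * \<nu> * r powr (- real h - real DIM('a) / p)"
      using r by (simp add: \<mu>_def powr_diff powr_minus powr_realpow divide_inverse)
    finally show ?thesis .
  qed
  then show ?thesis using C0 by blast
qed

text \<open>Because the kernel has integral zero, f (x - r z) may be replaced by f (x - r z) - f x,
  which is at most H r^s |z|^s in absolute value; the moment of order s of the kernel is
  finite.\<close>

lemma conv_heat_Hoelder_bound:
  assumes a: "real_polynomial_function a"
    and hom: "\<And>r \<xi>. a (r *\<^sub>R \<xi>) * (r *\<^sub>R \<xi> \<bullet> v) = r ^ h * (a \<xi> * (\<xi> \<bullet> v))"
    and s: "0 \<le> s" "s \<le> 1"
  shows "\<exists>C\<ge>0. \<forall>f x r H. r > 0 \<longrightarrow> integrable lborel f \<longrightarrow>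
    (\<forall>y z. \<bar>f y - f z\<bar> \<le> H * norm (y - z) powr s) \<longrightarrow>
    \<bar>conv_heat (r ^ e) (\<lambda>\<xi>. a \<xi> * (\<xi> \<bullet> v)) m f x\<bar> \<le> C * H * r powr (s - real h)"
proof -
  define av where "av = (\<lambda>\<xi>. a \<xi> * (\<xi> \<bullet> v))"
  have av: "real_polynomial_function av"
    unfolding av_def by (intro real_polynomial_function.intros(4) a real_polynomial_function_inner)
  have hom': "av (r *\<^sub>R \<xi>) = r ^ h * av \<xi>" for r \<xi> using hom unfolding av_def .
  define k where "k = kernel av m"
  have k: "k \<in> kernels" unfolding k_def by (intro kernels.base av)
  obtain B where B: "\<And>z. \<bar>k z\<bar> \<le> B" using kernels_continuous_bounded[OF k] by blast
  have k0: "(\<integral>z. k z \<partial>lborel) = 0" unfolding k_def av_def by (rule integral_kernel_eq_0[OF a])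
  \<comment> \<open>|z|^s is not a polynomial, but it is at most 1 + |z|^2, and this weight keeps
    the kernel in \<open>kernels\<close>.\<close>
  have P: "real_polynomial_function (\<lambda>z::'a. 1 + (\<Sum>b\<in>Basis. (z \<bullet> b)\<^sup>2))"
    by (intro real_polynomial_function.intros(3) real_polynomial_function.intros(2)
      real_polynomial_function_sum real_polynomial_function_power real_polynomial_function_inner) auto
  define g where "g z = (1 + (\<Sum>b\<in>Basis. (z \<bullet> b)\<^sup>2)) * k z" for z
  have g: "integrable lborel g" unfolding g_def by (intro integrable_kernels kernels_mult_polynomial P k)
  define C where "C = (\<integral>z. \<bar>g z\<bar> \<partial>lborel)"
  have C0: "C \<ge> 0" unfolding C_def by (intro integral_nonneg_AE AE_I2) auto
  have "\<bar>conv_heat (r ^ e) av m f x\<bar> \<le> C * H * r powr (s - real h)"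
    if r: "r > 0" and f: "integrable lborel f" and H: "\<And>y z. \<bar>f y - f z\<bar> \<le> H * norm (y - z) powr s" for f x r H
  proof -
    \<comment> \<open>A basis vector has distance 1 from 0, so the Hoelder bound itself forces
      \<open>H\<close> to be nonnegative.\<close>
    obtain b :: 'a where b: "b \<in> Basis" using nonempty_Basis by blast
    have H0: "0 \<le> H" using H[of b 0] b order_trans[OF abs_ge_zero H[of b 0]] by simp
    have fr: "integrable lborel (\<lambda>z. f (x - r *\<^sub>R z))"
      using lborel_integral_affine(2)[of "- r" f x] f r by simp
    have kf: "integrable lborel (\<lambda>z. k z * f (x - r *\<^sub>R z))"
      using integrable_mult_bounded[OF fr _ B] borel_measurable_integrable[OF integrable_kernels[OF k]]
      by (simp add: mult.commute)
    have "(\<integral>z. k z * f (x - r *\<^sub>R z) \<partial>lborel) = (\<integral>z. k z * (f (x - r *\<^sub>R z) - f x) \<partial>lborel)"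
      using kf integrable_kernels[OF k] k0 by (simp add: right_diff_distrib)
    also have "\<bar>\<dots>\<bar> \<le> (\<integral>z. H * r powr s * \<bar>g z\<bar> \<partial>lborel)"
    proof (rule abs_integral_le)
      fix z :: 'a
      have z2: "(\<Sum>b\<in>Basis. (z \<bullet> b)\<^sup>2) = (norm z)\<^sup>2"
        unfolding power2_norm_eq_inner euclidean_inner[of z z] by (simp add: power2_eq_square)
      have "norm z powr s \<le> 1 + (norm z)\<^sup>2"
      proof (cases "norm z \<le> 1")
        case True
        then have "norm z powr s \<le> 1" using s by (intro powr_le1) auto
        then show ?thesis by (meson add_increasing2 zero_le_power2)
      next
        case False
        then have "norm z powr s \<le> norm z powr 2" using s by (intro powr_mono) auto
        then show ?thesis using False by (simp add: powr_numeral)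
      qed
      then have zs: "norm z powr s \<le> 1 + (\<Sum>b\<in>Basis. (z \<bullet> b)\<^sup>2)" unfolding z2 .
      have "\<bar>f (x - r *\<^sub>R z) - f x\<bar> \<le> H * (r powr s * norm z powr s)"
        using H[of "x - r *\<^sub>R z" x] r by (simp add: powr_mult)
      also have "\<dots> \<le> H * (r powr s * (1 + (\<Sum>b\<in>Basis. (z \<bullet> b)\<^sup>2)))"
        using zs H0 by (intro mult_left_mono) auto
      finally have "\<bar>k z\<bar> * \<bar>f (x - r *\<^sub>R z) - f x\<bar> \<le> \<bar>k z\<bar> * (H * (r powr s * (1 + (\<Sum>b\<in>Basis. (z \<bullet> b)\<^sup>2))))"
        by (intro mult_left_mono) auto
      moreover have "0 \<le> 1 + (\<Sum>b\<in>Basis. (z \<bullet> b)\<^sup>2)" by (intro add_nonneg_nonneg sum_nonneg) auto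
      ultimately show "\<bar>k z * (f (x - r *\<^sub>R z) - f x)\<bar> \<le> H * r powr s * \<bar>g z\<bar>"
        unfolding g_def abs_mult by (simp add: mult_ac)
    qed (use g in auto)
    also have "\<dots> = C * H * r powr s" by (simp add: C_def)
    finally have "\<bar>conv_heat (r ^ e) av m f x\<bar> \<le> C * H * r powr s / r ^ h"
      unfolding conv_heat_scaling[OF av hom' r f] k_def using r by (simp add: divide_right_mono)
    also have "\<dots> = C * H * r powr (s - real h)" using r by (simp add: powr_diff powr_realpow)
    finally show ?thesis .
  qed
  then show ?thesis using C0 unfolding av_def by blast
qed

section \<open>The limit at time zero and the mass of the kernel\<close>

definition kernel_mass :: real where
  "kernel_mass = (\<integral>z. kernel (\<lambda>_. 1) 0 z \<partial>lborel)"

lemma real_polynomial_function_one: "real_polynomial_function (\<lambda>_::'a. 1)"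
  by (rule real_polynomial_function.intros(2))

lemma conv_heat_one:
  assumes "r > 0" "integrable lborel f"
  shows "conv_heat (r ^ e) (\<lambda>_. 1) 0 f x = (\<integral>z. kernel (\<lambda>_. 1) 0 z * f (x - r *\<^sub>R z) \<partial>lborel)"
  using conv_heat_scaling[OF real_polynomial_function_one, of 0] assms by simp

text \<open>Approximate identity: after scaling, the flow at time r^e averages
  \<open>f (x - r *\<^sub>R z)\<close> against one fixed integrable kernel.\<close>

lemma conv_heat_at_right_0:
  assumes f: "integrable lborel f" "continuous_on UNIV f" "\<And>x. \<bar>f x\<bar> \<le> B"
  shows "((\<lambda>r. conv_heat (r ^ e) (\<lambda>_. 1) 0 f x) \<longlongrightarrow> kernel_mass * f x) (at_right 0)"
  unfolding tendsto_at_iff_sequentially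
proof (intro allI impI)
  fix X :: "nat \<Rightarrow> real"
  assume X: "\<forall>i. X i \<in> {0<..} - {0}" "X \<longlonglongrightarrow> 0"
  let ?k = "kernel (\<lambda>_. 1) 0"
  have k: "integrable lborel ?k" by (rule integrable_kernel[OF real_polynomial_function_one])
  have fb [measurable]: "f \<in> borel_measurable borel" by (rule borel_measurable_continuous_onI[OF f(2)])
  have kb [measurable]: "?k \<in> borel_measurable borel" using borel_measurable_integrable[OF k] by simp
  have "(\<lambda>n. \<integral>z. ?k z * f (x - X n *\<^sub>R z) \<partial>lborel) \<longlonglongrightarrow> (\<integral>z. ?k z * f x \<partial>lborel)"
  proof (rule integral_dominated_convergence[where w = "\<lambda>z. B * \<bar>?k z\<bar>"])
    show "AE z in lborel. (\<lambda>n. ?k z * f (x - X n *\<^sub>R z)) \<longlonglongrightarrow> ?k z * f x"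
    proof (intro AE_I2 tendsto_intros)
      fix z
      have "(\<lambda>n. x - X n *\<^sub>R z) \<longlonglongrightarrow> x - 0 *\<^sub>R z" by (intro tendsto_intros X(2))
      then show "(\<lambda>n. f (x - X n *\<^sub>R z)) \<longlonglongrightarrow> f x"
        using continuous_on_tendsto_compose[OF f(2), of "\<lambda>n. x - X n *\<^sub>R z" x] by simp
    qed
    show "AE z in lborel. norm (?k z * f (x - X n *\<^sub>R z)) \<le> B * \<bar>?k z\<bar>" for n
      using mult_right_mono[OF f(3) abs_ge_zero] by (intro AE_I2) (simp add: abs_mult mult.commute)
  qed (use k in auto)
  moreover have "(\<integral>z. ?k z * f x \<partial>lborel) = kernel_mass * f x" by (simp add: kernel_mass_def)
  ultimately show "((\<lambda>r. conv_heat (r ^ e) (\<lambda>_. 1) 0 f x) \<circ> X) \<longlonglongrightarrow> kernel_mass * f x"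
    using X(1) conv_heat_one[OF _ f(1)] by (simp add: comp_def kernel_mass_def)
qed

text \<open>For an integrable bump \<open>f\<close> the pairing of the heat flow of \<open>f\<close> with \<open>f\<close> equals
  \<open>\<integral> exp (- t q) (A\<^sup>2 + B\<^sup>2)\<close>, where \<open>A\<close> and \<open>B\<close> are the cosine and sine transforms of \<open>f\<close>.
  It is positive and decreases in \<open>t\<close>, so its limit \<open>kernel_mass * \<integral> f\<^sup>2\<close> at \<open>t = 0\<close> is positive.\<close>

lemma kernel_mass_pos: "kernel_mass > 0"
proof -
  \<comment> \<open>The tent is supported in the unit ball, so for |\<xi>| \<le> 1 the phase
    \<open>x \<bullet> \<xi>\<close> stays in [-1, 1], where the cosine is at least cos 1.\<close>
  define f where "f x = max 0 (1 - norm x)" for x :: 'a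
  have f01: "0 \<le> f x" "f x \<le> 1" for x by (auto simp: f_def)
  have fcont: "continuous_on UNIV f" unfolding f_def by (intro continuous_intros)
  have [measurable]: "f \<in> borel_measurable borel" by (rule borel_measurable_continuous_onI[OF fcont])
  have balls: "integrable lborel (indicator (cball 0 r) :: 'a \<Rightarrow> real)" for r
    by (rule integrable_real_indicator[OF _ emeasure_bounded_finite[OF bounded_cball]]) simp
  note ball = balls[of 1]
  have f: "integrable lborel f"
    by (rule Bochner_Integration.integrable_bound[OF ball]) (auto simp: f_def indicator_def)
  have f2: "integrable lborel (\<lambda>x. f x * f x)"
    by (rule integrable_mult_bounded[OF f, of _ 1]) (use f01 in auto)
  have fpos: "0 < (\<integral>x. f x \<partial>lborel)"
  proof -
    have "0 < measure lborel (cball (0::'a) (1/2)) / 2"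
      using content_cball_pos[of "1/2" "0::'a"] by simp
    also have "\<dots> = (\<integral>x. indicator (cball (0::'a) (1/2)) x / 2 \<partial>lborel)" by simp
    also have "\<dots> \<le> (\<integral>x. f x \<partial>lborel)"
      by (intro integral_mono f integrable_divide balls) (auto simp: f_def indicator_def)
    finally show ?thesis .
  qed
  define A where "A \<xi> = (\<integral>y. f y * cos (y \<bullet> \<xi>) \<partial>lborel)" for \<xi>
  define B where "B \<xi> = (\<integral>y. f y * sin (y \<bullet> \<xi>) \<partial>lborel)" for \<xi>
  have int: "integrable lborel (\<lambda>y. f y * cos (y \<bullet> \<xi>))" "integrable lborel (\<lambda>y. f y * sin (y \<bullet> \<xi>))" for \<xi>
    by (auto intro!: integrable_mult_bounded[OF f, of _ 1])
  have cs: "(\<lambda>(x::'a, y). cos (x \<bullet> y)) \<in> borel_measurable borel" "(\<lambda>(x::'a, y). sin (x \<bullet> y)) \<in> borel_measurable borel"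
    unfolding case_prod_unfold by (intro borel_measurable_continuous_onI continuous_intros)+
  have cs': "(\<lambda>(x::'a, y). cos (y \<bullet> x)) \<in> borel_measurable borel" "(\<lambda>(x::'a, y). sin (y \<bullet> x)) \<in> borel_measurable borel"
    using cs by (simp_all add: inner_commute)
  have eint: "integrable lborel (\<lambda>\<xi>. exp (- t * q \<xi>))" if "t > 0" for t
    using integrable_heat_symbol[OF real_polynomial_function_one that] by simp
  have eA: "integrable lborel (\<lambda>\<xi>. exp (- t * q \<xi>) * A \<xi>)" "integrable lborel (\<lambda>\<xi>. exp (- t * q \<xi>) * B \<xi>)"
    if "t > 0" for t
    unfolding A_def B_def
    using Fubini_bounded_kernel(1)[OF eint[OF that] f cs'(1) abs_cos_le_one]
      Fubini_bounded_kernel(1)[OF eint[OF that] f cs'(2) abs_sin_le_one] by blast+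
  have ecos: "integrable lborel (\<lambda>\<xi>. exp (- t * q \<xi>) * A \<xi> * cos (x \<bullet> \<xi>))"
    "integrable lborel (\<lambda>\<xi>. exp (- t * q \<xi>) * B \<xi> * sin (x \<bullet> \<xi>))" if "t > 0" for t x
    using integrable_mult_bounded[OF eA(1)[OF that], of "\<lambda>\<xi>. cos (x \<bullet> \<xi>)" 1]
      integrable_mult_bounded[OF eA(2)[OF that], of "\<lambda>\<xi>. sin (x \<bullet> \<xi>)" 1] by simp_all
  have u: "conv_heat t (\<lambda>_. 1) 0 f x = (\<integral>\<xi>. exp (- t * q \<xi>) * A \<xi> * cos (x \<bullet> \<xi>) \<partial>lborel) +
      (\<integral>\<xi>. exp (- t * q \<xi>) * B \<xi> * sin (x \<bullet> \<xi>) \<partial>lborel)" if "t > 0" for t x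
  proof -
    have "(\<integral>y. f y * osc 0 ((x - y) \<bullet> \<xi>) \<partial>lborel) = A \<xi> * cos (x \<bullet> \<xi>) + B \<xi> * sin (x \<bullet> \<xi>)" for \<xi>
    proof -
      have "f y * osc 0 ((x - y) \<bullet> \<xi>) = f y * cos (y \<bullet> \<xi>) * cos (x \<bullet> \<xi>) + f y * sin (y \<bullet> \<xi>) * sin (x \<bullet> \<xi>)" for y
        by (simp add: osc_def inner_diff_left cos_diff algebra_simps)
      then show ?thesis using int by (simp add: A_def B_def)
    qed
    then show ?thesis
      unfolding conv_heat_def Bochner_Integration.integral_add[OF ecos[OF that], symmetric]
      by (simp add: algebra_simps)
  qed
  define F where "F t = (\<integral>x. f x * conv_heat t (\<lambda>_. 1) 0 f x \<partial>lborel)" for t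
  have AB: "integrable lborel (\<lambda>\<xi>. exp (- t * q \<xi>) * A \<xi> * A \<xi>)" "integrable lborel (\<lambda>\<xi>. exp (- t * q \<xi>) * B \<xi> * B \<xi>)"
    if "t > 0" for t
    using Fubini_bounded_kernel(1)[OF eA(1)[OF that] f cs'(1) abs_cos_le_one]
      Fubini_bounded_kernel(1)[OF eA(2)[OF that] f cs'(2) abs_sin_le_one]
    unfolding A_def[symmetric] B_def[symmetric] by blast+
  have F: "F t = (\<integral>\<xi>. exp (- t * q \<xi>) * ((A \<xi>)\<^sup>2 + (B \<xi>)\<^sup>2) \<partial>lborel)" if "t > 0" for t
  proof -
    note 1 = Fubini_bounded_kernel[OF f eA(1)[OF that] cs(1) abs_cos_le_one]
    note 2 = Fubini_bounded_kernel[OF f eA(2)[OF that] cs(2) abs_sin_le_one]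
    have "F t = (\<integral>x. f x * (\<integral>\<xi>. exp (- t * q \<xi>) * A \<xi> * cos (x \<bullet> \<xi>) \<partial>lborel) \<partial>lborel)
      + (\<integral>x. f x * (\<integral>\<xi>. exp (- t * q \<xi>) * B \<xi> * sin (x \<bullet> \<xi>) \<partial>lborel) \<partial>lborel)"
      unfolding F_def u[OF that] distrib_left by (rule Bochner_Integration.integral_add[OF 1(1) 2(1)])
    also have "\<dots> = (\<integral>\<xi>. exp (- t * q \<xi>) * A \<xi> * A \<xi> \<partial>lborel) + (\<integral>\<xi>. exp (- t * q \<xi>) * B \<xi> * B \<xi> \<partial>lborel)"
      unfolding 1(2) 2(2) A_def[symmetric] B_def[symmetric] ..
    also have "\<dots> = (\<integral>\<xi>. exp (- t * q \<xi>) * ((A \<xi>)\<^sup>2 + (B \<xi>)\<^sup>2) \<partial>lborel)"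
      unfolding Bochner_Integration.integral_add[OF AB[OF that], symmetric]
      by (simp add: power2_eq_square algebra_simps)
    finally show ?thesis .
  qed
  have intF: "integrable lborel (\<lambda>\<xi>. exp (- t * q \<xi>) * ((A \<xi>)\<^sup>2 + (B \<xi>)\<^sup>2))" if "t > 0" for t
    using Bochner_Integration.integrable_add[OF AB[OF that]] by (simp add: power2_eq_square algebra_simps)
  have F_mono: "F 1 \<le> F t" if t: "0 < t" "t \<le> 1" for t
  proof -
    have "exp (- 1 * q \<xi>) \<le> exp (- t * q \<xi>)" for \<xi>
      using mult_right_mono[OF t(2) q_nonneg[of \<xi>]] by simp
    then show ?thesis
      unfolding F[OF t(1)] F[OF less_numeral_extra(1)] using intF[OF t(1)] intF[of 1]
      by (intro integral_mono mult_right_mono) auto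
  qed
  have F1: "0 < F 1"
  proof -
    obtain Q where Q: "\<And>\<xi>. \<xi> \<in> cball 0 1 \<Longrightarrow> q \<xi> \<le> Q"
      using continuous_attains_sup[of "cball (0::'a) 1" q] continuous_on_q by (auto simp: Ball_def)
    \<comment> \<open>On the unit ball of frequencies \<open>exp (- q \<xi>)\<close> is at least exp
      (-Q), and the cosine transform \<open>A\<close> is at least cos 1 times the integral of
      \<open>f\<close>.\<close>
    define d where "d = exp (- Q) * (cos 1 * (\<integral>x. f x \<partial>lborel))\<^sup>2"
    have d: "d > 0" using fpos cos_gt_zero[of 1] pi_half_gt_zero pi_gt3 by (simp add: d_def)
    have "d * indicator (cball 0 1) \<xi> \<le> exp (- 1 * q \<xi>) * ((A \<xi>)\<^sup>2 + (B \<xi>)\<^sup>2)" for \<xi> :: 'a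
    proof (cases "\<xi> \<in> cball 0 1")
      case True
      have "(\<integral>x. f x * cos 1 \<partial>lborel) \<le> A \<xi>"
        unfolding A_def
      proof (intro integral_mono int)
        fix x
        show "f x * cos 1 \<le> f x * cos (x \<bullet> \<xi>)"
        proof (cases "norm x \<le> 1")
          case x: True
          have "\<bar>x \<bullet> \<xi>\<bar> \<le> 1"
            using Cauchy_Schwarz_ineq2[of x \<xi>] mult_mono[OF x, of "norm \<xi>" 1] True by simp
          then have "cos 1 \<le> cos \<bar>x \<bullet> \<xi>\<bar>" using pi_gt3 by (intro cos_monotone_0_pi_le) auto
          then show ?thesis using f01 by (intro mult_left_mono) auto
        qed (simp add: f_def)
      qed (use f in auto)
      then have "(cos 1 * (\<integral>x. f x \<partial>lborel))\<^sup>2 \<le> (A \<xi>)\<^sup>2"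
        using fpos cos_gt_zero[of 1] pi_gt3 by (intro power_mono) (auto simp: mult.commute)
      then have "(cos 1 * (\<integral>x. f x \<partial>lborel))\<^sup>2 \<le> (A \<xi>)\<^sup>2 + (B \<xi>)\<^sup>2"
        by (meson add_increasing2 zero_le_power2)
      then show ?thesis using True Q[OF True] unfolding d_def by (simp add: mult_mono)
    qed simp
    then have "(\<integral>\<xi>. d * indicator (cball (0::'a) 1) \<xi> \<partial>lborel) \<le> F 1"
      unfolding F[OF less_numeral_extra(1)] using intF[of 1] ball by (intro integral_mono) auto
    moreover have "0 < d * measure lborel (cball (0::'a) 1)"
      using d content_cball_pos[of 1 "0::'a"] by simp
    ultimately show ?thesis by simp
  qed
  define X where "X n = 1 / real (Suc n)" for n
  have X: "X \<longlonglongrightarrow> 0" "\<And>n. 0 < X n" "\<And>n. X n \<le> 1"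
    unfolding X_def using LIMSEQ_inverse_real_of_nat by (auto simp: inverse_eq_divide)
  \<comment> \<open>A bound of the flow that is uniform in r and x, since \<open>f\<close> is at
    most 1; it dominates the pairing as the times \<open>X n ^ e\<close> tend to 0.\<close>
  define D where "D = (\<integral>z. \<bar>kernel (\<lambda>_. 1) 0 z\<bar> \<partial>lborel)"
  have ub: "\<bar>conv_heat (r ^ e) (\<lambda>_. 1) 0 f x\<bar> \<le> D" if "r > 0" for r x
    unfolding conv_heat_one[OF that f] D_def
    using f01 integrable_kernel[OF real_polynomial_function_one]
    by (intro abs_integral_le) (auto simp: abs_mult intro!: mult_left_le)
  have "(\<lambda>n. F (X n ^ e)) \<longlonglongrightarrow> (\<integral>x. f x * (kernel_mass * f x) \<partial>lborel)"
    unfolding F_def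
  proof (rule integral_dominated_convergence[where w = "\<lambda>x. D * f x"])
    show "AE x in lborel. (\<lambda>n. f x * conv_heat (X n ^ e) (\<lambda>_. 1) 0 f x) \<longlonglongrightarrow> f x * (kernel_mass * f x)"
    proof (intro AE_I2 tendsto_intros)
      fix x
      show "(\<lambda>n. conv_heat (X n ^ e) (\<lambda>_. 1) 0 f x) \<longlonglongrightarrow> kernel_mass * f x"
        using conv_heat_at_right_0[OF f fcont, of 1 x] f01 X
        unfolding tendsto_at_iff_sequentially comp_def by (auto simp: less_imp_neq[THEN not_sym])
    qed
    show "AE x in lborel. norm (f x * conv_heat (X n ^ e) (\<lambda>_. 1) 0 f x) \<le> D * f x" for n
      using mult_right_mono[OF ub[OF X(2)[of n]] f01(1)] f01 by (intro AE_I2) (simp add: abs_mult mult.commute)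
    show "(\<lambda>x. f x * conv_heat (X n ^ e) (\<lambda>_. 1) 0 f x) \<in> borel_measurable lborel" for n
      using Fubini_bounded_kernel(1)[OF f eA(1) cs(1) abs_cos_le_one, of "X n ^ e"]
        Fubini_bounded_kernel(1)[OF f eA(2) cs(2) abs_sin_le_one, of "X n ^ e"] X(2)[of n]
      by (subst u) (auto simp: distrib_left intro!: borel_measurable_add)
  qed (use f f2 in auto)
  moreover have "F 1 \<le> F (X n ^ e)" for n
    using X(2,3)[of n] by (intro F_mono) (auto intro: power_le_one less_imp_le)
  ultimately have "F 1 \<le> (\<integral>x. f x * (kernel_mass * f x) \<partial>lborel)"
    by (intro LIMSEQ_le_const) auto
  also have "\<dots> = kernel_mass * (\<integral>x. f x * f x \<partial>lborel)"
    by (subst integral_mult_right_zero[symmetric]) (simp add: mult_ac)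
  finally have "0 < kernel_mass * (\<integral>x. f x * f x \<partial>lborel)" using F1 by simp
  moreover have "0 \<le> (\<integral>x. f x * f x \<partial>lborel)" using f01 by simp
  ultimately show ?thesis by (simp add: zero_less_mult_iff)
qed

section \<open>From bounds of the flow to the Hoelder estimate\<close>

lemma abs_conv_heat_diff_le:
  assumes a: "real_polynomial_function a" and t: "t > 0" and f: "integrable lborel f"
    and K: "\<And>b z. b \<in> Basis \<Longrightarrow> \<bar>conv_heat t (\<lambda>\<xi>. a \<xi> * (\<xi> \<bullet> b)) (Suc m) f z\<bar> \<le> K b"
  shows "\<bar>conv_heat t a m f x - conv_heat t a m f y\<bar> \<le> (\<Sum>b\<in>Basis. K b) * norm (x - y)"
proof -
  define v where "v = x - y"
  have grad: "\<bar>conv_heat t (\<lambda>\<xi>. a \<xi> * (\<xi> \<bullet> v)) (Suc m) f z\<bar> \<le> (\<Sum>b\<in>Basis. K b) * norm v" for z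
  proof -
    \<comment> \<open>The derivative along \<open>v\<close> is split into basis directions, so the
      constants do not depend on \<open>v\<close>; each coordinate of \<open>v\<close> is at most
      its norm.\<close>
    have "(\<lambda>\<xi>. a \<xi> * (\<xi> \<bullet> v)) = (\<lambda>\<xi>. \<Sum>b\<in>Basis. (v \<bullet> b) * (a \<xi> * (\<xi> \<bullet> b)))"
      by (simp add: fun_eq_iff euclidean_inner[of _ v] sum_distrib_left mult_ac)
    then have "conv_heat t (\<lambda>\<xi>. a \<xi> * (\<xi> \<bullet> v)) (Suc m) f z =
        (\<Sum>b\<in>Basis. (v \<bullet> b) * conv_heat t (\<lambda>\<xi>. a \<xi> * (\<xi> \<bullet> b)) (Suc m) f z)"
      using t f by (simp only:) (intro conv_heat_sum_symbol real_polynomial_function.intros(4) a real_polynomial_function_inner)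
    also have "\<bar>\<dots>\<bar> \<le> (\<Sum>b\<in>Basis. norm v * K b)"
      by (rule order_trans[OF sum_abs], rule sum_mono, unfold abs_mult)
         (intro mult_mono K Basis_le_norm, auto)
    finally show ?thesis by (simp add: sum_distrib_left mult.commute)
  qed
  have "norm (conv_heat t a m f (y + 1 *\<^sub>R v) - conv_heat t a m f (y + 0 *\<^sub>R v))
      \<le> ((\<Sum>b\<in>Basis. K b) * norm v) * norm (1 - 0 :: real)"
  proof (rule field_differentiable_bound[where S = UNIV])
    show "((\<lambda>\<tau>. conv_heat t a m f (y + \<tau> *\<^sub>R v)) has_field_derivative
        conv_heat t (\<lambda>\<xi>. a \<xi> * (\<xi> \<bullet> v)) (Suc m) f (y + \<tau> *\<^sub>R v)) (at \<tau> within UNIV)" for \<tau>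
      using conv_heat_has_derivative_space[OF a t f] by simp
    show "norm (conv_heat t (\<lambda>\<xi>. a \<xi> * (\<xi> \<bullet> v)) (Suc m) f (y + \<tau> *\<^sub>R v)) \<le> (\<Sum>b\<in>Basis. K b) * norm v" for \<tau> :: real
      using grad by simp
  qed auto
  then show ?thesis by (simp add: v_def)
qed

text \<open>\<open>Q F N\<close> reads: the relevant size of \<open>F\<close> (an \<open>L\<^sup>p\<close> norm or a Hoelder seminorm) is at most \<open>N\<close>.\<close>

definition heat_bounded ::
  "real \<Rightarrow> ('a \<Rightarrow> real) \<Rightarrow> nat \<Rightarrow> (('a \<Rightarrow> real) \<Rightarrow> real \<Rightarrow> bool) \<Rightarrow> bool" where
  "heat_bounded s a m Q \<longleftrightarrow> (\<exists>C\<ge>0. \<forall>F N x y r. 0 < r \<and> integrable lborel F \<and> Q F N \<longrightarrow>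
    \<bar>conv_heat (r ^ e) a m F x\<bar> \<le> C * N * r powr (s - real e) \<and>
    \<bar>conv_heat (r ^ e) a m F x - conv_heat (r ^ e) a m F y\<bar> \<le> C * N * norm (x - y) * r powr (s - 1 - real e))"

text \<open>The Lipschitz part comes from the mean value inequality, with the constants of the basis
  directions added up. Nonnegativity of \<open>N\<close> permits one common constant for both
  parts.\<close>

lemma heat_boundedI:
  assumes a: "real_polynomial_function a" and C0: "C0 \<ge> 0"
    and 0: "\<And>F N x. \<And>r::real. 0 < r \<Longrightarrow> integrable lborel F \<Longrightarrow> Q F N \<Longrightarrow>
      \<bar>conv_heat (r ^ e) a m F x\<bar> \<le> C0 * N * r powr (s - real e)"
    and 1: "\<And>b. b \<in> Basis \<Longrightarrow> \<exists>C\<ge>0. \<forall>F N x. \<forall>r::real. 0 < r \<longrightarrow> integrable lborel F \<longrightarrow> Q F N \<longrightarrow>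
      \<bar>conv_heat (r ^ e) (\<lambda>\<xi>. a \<xi> * (\<xi> \<bullet> b)) (Suc m) F x\<bar> \<le> C * N * r powr (s - 1 - real e)"
    and N: "\<And>F N. Q F N \<Longrightarrow> N \<ge> 0"
  shows "heat_bounded s a m Q"
proof -
  have "\<forall>b\<in>Basis. \<exists>C\<ge>0. \<forall>F N x. \<forall>r::real. 0 < r \<longrightarrow> integrable lborel F \<longrightarrow> Q F N \<longrightarrow>
      \<bar>conv_heat (r ^ e) (\<lambda>\<xi>. a \<xi> * (\<xi> \<bullet> b)) (Suc m) F x\<bar> \<le> C * N * r powr (s - 1 - real e)"
    using 1 by blast
  from bchoice[OF this] obtain C where C: "\<And>b. b \<in> Basis \<Longrightarrow> C b \<ge> 0"
    "\<And>b F N x r. b \<in> Basis \<Longrightarrow> 0 < r \<Longrightarrow> integrable lborel F \<Longrightarrow> Q F N \<Longrightarrow>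
      \<bar>conv_heat (r ^ e) (\<lambda>\<xi>. a \<xi> * (\<xi> \<bullet> b)) (Suc m) F x\<bar> \<le> C b * N * r powr (s - 1 - real e)"
    by blast
  define C1 where "C1 = (\<Sum>b\<in>Basis. C b)"
  have C1: "C1 \<ge> 0" unfolding C1_def by (intro sum_nonneg C)
  show ?thesis
    unfolding heat_bounded_def
  proof (intro exI[of _ "C0 + C1"] conjI allI impI; (elim conjE)?)
    show "0 \<le> C0 + C1" using C0 C1 by simp
    fix F N x y and r :: real assume *: "0 < r" "integrable lborel F" "Q F N"
    have "C0 * (N * r powr (s - real e)) \<le> (C0 + C1) * (N * r powr (s - real e))"
      using C1 N[OF *(3)] by (intro mult_right_mono) auto
    then show "\<bar>conv_heat (r ^ e) a m F x\<bar> \<le> (C0 + C1) * N * r powr (s - real e)"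
      using 0[OF *, of x] by (simp add: mult.assoc)
    have "\<bar>conv_heat (r ^ e) a m F x - conv_heat (r ^ e) a m F y\<bar>
        \<le> (\<Sum>b\<in>Basis. C b * N * r powr (s - 1 - real e)) * norm (x - y)"
      using * C by (intro abs_conv_heat_diff_le a) auto
    also have "\<dots> = C1 * (N * norm (x - y) * r powr (s - 1 - real e))"
      unfolding C1_def sum_distrib_right by (intro sum.cong) (auto simp: mult_ac)
    also have "\<dots> \<le> (C0 + C1) * (N * norm (x - y) * r powr (s - 1 - real e))"
      using C0 N[OF *(3)] by (intro mult_right_mono) auto
    finally show "\<bar>conv_heat (r ^ e) a m F x - conv_heat (r ^ e) a m F y\<bar>
        \<le> (C0 + C1) * N * norm (x - y) * r powr (s - 1 - real e)" by (simp add: mult.assoc)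
  qed
qed

text \<open>Degree e - 1 is the balanced one: -(e - 1) - n/p = s - e, and the gradient, whose symbol
  has degree e, gives -e - n/p = s - 1 - e.\<close>

lemma heat_bounded_Lp:
  assumes a: "real_polynomial_function a" and hom: "\<And>r \<xi>. a (r *\<^sub>R \<xi>) = r ^ (e - 1) * a \<xi>"
    and p: "p > 1" and s: "s = 1 - real DIM('a) / p"
  shows "heat_bounded s a m (\<lambda>F N. N > 0 \<and> integrable lborel (\<lambda>y. \<bar>F y\<bar> powr p) \<and>
    (\<integral>y. \<bar>F y\<bar> powr p \<partial>lborel) \<le> N powr p)"
proof -
  have ex: "- real (e - 1) - real DIM('a) / p = s - real e"
    using s e_ge_1 by (simp add: of_nat_diff)
  obtain C where C: "C \<ge> 0" "\<And>f x r \<nu>. r > 0 \<Longrightarrow> \<nu> > 0 \<Longrightarrow> integrable lborel f \<Longrightarrow>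
    integrable lborel (\<lambda>y. \<bar>f y\<bar> powr p) \<Longrightarrow> (\<integral>y. \<bar>f y\<bar> powr p \<partial>lborel) \<le> \<nu> powr p \<Longrightarrow>
    \<bar>conv_heat (r ^ e) a m f x\<bar> \<le> C * \<nu> * r powr (s - real e)"
    using conv_heat_Lp_bound[OF a hom p, unfolded ex] by metis
  show ?thesis
  proof (rule heat_boundedI[OF a C(1)])
    fix b :: 'a assume "b \<in> Basis"
    have ab: "real_polynomial_function (\<lambda>\<xi>. a \<xi> * (\<xi> \<bullet> b))"
      by (intro real_polynomial_function.intros(4) a real_polynomial_function_inner)
    have hom_ab: "a (r *\<^sub>R \<xi>) * (r *\<^sub>R \<xi> \<bullet> b) = r ^ e * (a \<xi> * (\<xi> \<bullet> b))" for r \<xi>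
    proof -
      have "a (r *\<^sub>R \<xi>) * (r *\<^sub>R \<xi> \<bullet> b) = (r ^ (e - 1) * r) * (a \<xi> * (\<xi> \<bullet> b))"
        unfolding hom by simp
      also have "r ^ (e - 1) * r = r ^ e" using e_ge_1 by (intro power_minus_mult) simp
      finally show ?thesis .
    qed
    have ex1: "- real e - real DIM('a) / p = s - 1 - real e" using s by simp
    note bound = conv_heat_Lp_bound[where a = "\<lambda>\<xi>. a \<xi> * (\<xi> \<bullet> b)" and h = e and m = "Suc m", OF ab hom_ab p, unfolded ex1]
    show "\<exists>C\<ge>0. \<forall>F N x. \<forall>r::real. 0 < r \<longrightarrow> integrable lborel F \<longrightarrow>
      (N > 0 \<and> integrable lborel (\<lambda>y. \<bar>F y\<bar> powr p) \<and> (\<integral>y. \<bar>F y\<bar> powr p \<partial>lborel) \<le> N powr p) \<longrightarrow>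
      \<bar>conv_heat (r ^ e) (\<lambda>\<xi>. a \<xi> * (\<xi> \<bullet> b)) (Suc m) F x\<bar> \<le> C * N * r powr (s - 1 - real e)"
      by (rule ex_forward[OF bound]) blast
  qed (use C(2) in auto)
qed

text \<open>The whole symbol has degree \<open>e\<close>, so Hoelder data give r^(s - e); for the
  gradient the degree is e + 1.\<close>

lemma heat_bounded_Hoelder:
  assumes a: "real_polynomial_function a"
    and hom: "\<And>r \<xi>. a (r *\<^sub>R \<xi>) * (r *\<^sub>R \<xi> \<bullet> v) = r ^ e * (a \<xi> * (\<xi> \<bullet> v))"
    and s: "0 \<le> s" "s \<le> 1"
  shows "heat_bounded s (\<lambda>\<xi>. a \<xi> * (\<xi> \<bullet> v)) m
    (\<lambda>F N. \<forall>y z. \<bar>F y - F z\<bar> \<le> N * norm (y - z) powr s)"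
proof -
  have av: "real_polynomial_function (\<lambda>\<xi>. a \<xi> * (\<xi> \<bullet> v))"
    by (intro real_polynomial_function.intros(4) a real_polynomial_function_inner)
  from conv_heat_Hoelder_bound[where a = a and v = v and h = e and m = m, OF a hom s]
  obtain C where C': "0 \<le> C \<and> (\<forall>f x r H. r > 0 \<longrightarrow> integrable lborel f \<longrightarrow>
    (\<forall>y z. \<bar>f y - f z\<bar> \<le> H * norm (y - z) powr s) \<longrightarrow>
    \<bar>conv_heat (r ^ e) (\<lambda>\<xi>. a \<xi> * (\<xi> \<bullet> v)) m f x\<bar> \<le> C * H * r powr (s - real e))" ..
  note C = conjunct1[OF C'] conjunct2[OF C', rule_format]
  show ?thesis
  proof (rule heat_boundedI[OF av C(1)])
    fix b :: 'a assume "b \<in> Basis"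
    have ab: "real_polynomial_function (\<lambda>\<xi>. a \<xi> * (\<xi> \<bullet> b))"
      by (intro real_polynomial_function.intros(4) a real_polynomial_function_inner)
    have h: "a (r *\<^sub>R \<xi>) * (r *\<^sub>R \<xi> \<bullet> b) * (r *\<^sub>R \<xi> \<bullet> v) = r ^ Suc e * (a \<xi> * (\<xi> \<bullet> b) * (\<xi> \<bullet> v))" for r \<xi>
      using hom[of r \<xi>] by (simp add: mult_ac)
    \<comment> \<open>The cancelling factor remains \<open>\<xi> \<bullet> v\<close>; the factor
      \<open>\<xi> \<bullet> b\<close> from the gradient is counted as part of
      \<open>a\<close>.\<close>
    have eq: "(\<lambda>\<xi>. a \<xi> * (\<xi> \<bullet> b) * (\<xi> \<bullet> v)) = (\<lambda>\<xi>. a \<xi> * (\<xi> \<bullet> v) * (\<xi> \<bullet> b))" by (simp add: mult_ac)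
    have ex1: "s - real (Suc e) = s - 1 - real e" by simp
    note bound = conv_heat_Hoelder_bound[where a = "\<lambda>\<xi>. a \<xi> * (\<xi> \<bullet> b)" and v = v and h = "Suc e" and m = "Suc m", OF ab h s, unfolded ex1 eq]
    show "\<exists>C\<ge>0. \<forall>F N x. \<forall>r::real. 0 < r \<longrightarrow> integrable lborel F \<longrightarrow>
      (\<forall>y z. \<bar>F y - F z\<bar> \<le> N * norm (y - z) powr s) \<longrightarrow>
      \<bar>conv_heat (r ^ e) (\<lambda>\<xi>. a \<xi> * (\<xi> \<bullet> v) * (\<xi> \<bullet> b)) (Suc m) F x\<bar> \<le> C * N * r powr (s - 1 - real e)"
      by (rule ex_forward[OF bound]) blast
  next
    fix F :: "'a \<Rightarrow> real" and N assume H: "\<forall>y z. \<bar>F y - F z\<bar> \<le> N * norm (y - z) powr s"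
    obtain b :: 'a where b: "b \<in> Basis" using nonempty_Basis by blast
    show "N \<ge> 0" using order_trans[OF abs_ge_zero H[rule_format, of b 0]] b by simp
  qed (use C(2) in auto)
qed

text \<open>The flow of \<open>g\<close> with symbol \<open>q\<close> is minus the time derivative
  of the flow with symbol 1, so its representation through the \<open>F i\<close> controls that
  derivative. \<open>C\<close> is chosen before \<open>g\<close> and \<open>B\<close>; boundedness
  of \<open>g\<close> serves the limit at time 0.\<close>

theorem Hoelder_estimate:
  assumes I: "finite I" and a: "\<And>i. i \<in> I \<Longrightarrow> heat_bounded s (a i) (m i) (Q i)"
    and s: "0 < s" "s < 1"
  shows "\<exists>C\<ge>0. \<forall>g F N B. integrable lborel g \<longrightarrow> continuous_on UNIV g \<longrightarrow> (\<forall>x. \<bar>g x\<bar> \<le> B) \<longrightarrow>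
    (\<forall>i\<in>I. integrable lborel (F i) \<and> Q i (F i) N) \<longrightarrow>
    (\<forall>t>0. \<forall>x. conv_heat t q 0 g x = (\<Sum>i\<in>I. conv_heat t (a i) (m i) (F i) x)) \<longrightarrow>
    (\<forall>x y. \<bar>g x - g y\<bar> \<le> C * N * norm (x - y) powr s)"
proof -
  have "\<forall>i\<in>I. \<exists>C\<ge>0. \<forall>F N x y r. 0 < r \<and> integrable lborel F \<and> Q i F N \<longrightarrow>
    \<bar>conv_heat (r ^ e) (a i) (m i) F x\<bar> \<le> C * N * r powr (s - real e) \<and>
    \<bar>conv_heat (r ^ e) (a i) (m i) F x - conv_heat (r ^ e) (a i) (m i) F y\<bar> \<le> C * N * norm (x - y) * r powr (s - 1 - real e)"
    using a unfolding heat_bounded_def by blast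
  from bchoice[OF this] obtain C where CC: "\<forall>i\<in>I. C i \<ge> 0 \<and> (\<forall>F N x y r. 0 < r \<and> integrable lborel F \<and> Q i F N \<longrightarrow>
    \<bar>conv_heat (r ^ e) (a i) (m i) F x\<bar> \<le> C i * N * r powr (s - real e) \<and>
    \<bar>conv_heat (r ^ e) (a i) (m i) F x - conv_heat (r ^ e) (a i) (m i) F y\<bar>
      \<le> C i * N * norm (x - y) * r powr (s - 1 - real e))" ..
  note C2 = conjunct2[OF bspec[OF CC], rule_format, OF _ conjI[OF _ conjI]]
  note C = conjunct1[OF bspec[OF CC]] conjunct1[OF C2] conjunct2[OF C2]
  define D where "D = (\<Sum>i\<in>I. C i)"
  have D0: "D \<ge> 0" unfolding D_def by (intro sum_nonneg C)
  \<comment> \<open>In the variable t = r^e the bounds r^(s - e) and r^(s - 1 - e) become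
    t^(\<alpha> - 1) and t^(-\<beta> - 1).\<close>
  define \<alpha> where "\<alpha> = s / real e"
  define \<beta> where "\<beta> = (1 - s) / real e"
  have e: "real e > 0" using e_ge_1 by simp
  have \<alpha>: "\<alpha> > 0" and \<beta>: "\<beta> > 0" using s e by (auto simp: \<alpha>_def \<beta>_def)
  \<comment> \<open>The factor 2 arises because near time 0 the two points are estimated separately;
    dividing by \<open>kernel_mass\<close> normalises the limit at time 0.\<close>
  define C' where "C' = (2 * D / \<alpha> + D / \<beta>) / kernel_mass"
  have C'0: "C' \<ge> 0" using D0 \<alpha> \<beta> kernel_mass_pos by (simp add: C'_def)
  have "\<bar>g x - g y\<bar> \<le> C' * N * norm (x - y) powr s"
    if g: "integrable lborel g" "continuous_on UNIV g" "\<And>x. \<bar>g x\<bar> \<le> B"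
      and F: "\<And>i. i \<in> I \<Longrightarrow> integrable lborel (F i)" "\<And>i. i \<in> I \<Longrightarrow> Q i (F i) N"
      and eq: "\<And>t x. t > 0 \<Longrightarrow> conv_heat t q 0 g x = (\<Sum>i\<in>I. conv_heat t (a i) (m i) (F i) x)"
    for g F N B x y
  proof (cases "x = y")
    case True
    then show ?thesis by simp
  next
    case False
    then have xy: "norm (x - y) > 0" by simp
    define \<phi> where "\<phi> t = conv_heat t (\<lambda>_. 1) 0 g x - conv_heat t (\<lambda>_. 1) 0 g y" for t
    define \<phi>' where "\<phi>' t = conv_heat t q 0 g y - conv_heat t q 0 g x" for t
    have root: "(t powr (1 / real e)) ^ e = t" "t powr (1 / real e) > 0" if "t > 0" for t :: real
      using that e by (simp_all add: powr_powr flip: powr_realpow)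
    have near: "\<bar>conv_heat t q 0 g z\<bar> \<le> D * N * t powr (\<alpha> - 1)" if t: "t > 0" for t z
    proof -
      let ?r = "t powr (1 / real e)"
      have pw: "?r powr (s - real e) = t powr (\<alpha> - 1)"
        using e by (simp add: powr_powr \<alpha>_def diff_divide_distrib)
      have "\<bar>conv_heat t q 0 g z\<bar> \<le> (\<Sum>i\<in>I. \<bar>conv_heat t (a i) (m i) (F i) z\<bar>)"
        unfolding eq[OF t] by (rule sum_abs)
      also have "\<dots> \<le> (\<Sum>i\<in>I. C i * N * t powr (\<alpha> - 1))"
        using C(2)[OF _ root(2)[OF t] F] unfolding root(1)[OF t] pw by (intro sum_mono) auto
      finally show ?thesis by (simp add: D_def sum_distrib_right)
    qed
    have far: "\<bar>\<phi>' t\<bar> \<le> (D * N * norm (x - y)) * t powr (- \<beta> - 1)" if t: "t > 0" for t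
    proof -
      let ?r = "t powr (1 / real e)"
      have pw: "?r powr (s - 1 - real e) = t powr (- \<beta> - 1)"
        using e by (simp add: powr_powr \<beta>_def diff_divide_distrib)
      have "\<bar>\<phi>' t\<bar> = \<bar>\<Sum>i\<in>I. conv_heat t (a i) (m i) (F i) x - conv_heat t (a i) (m i) (F i) y\<bar>"
        unfolding \<phi>'_def eq[OF t] sum_subtractf by (rule abs_minus_commute)
      also have "\<dots> \<le> (\<Sum>i\<in>I. \<bar>conv_heat t (a i) (m i) (F i) x - conv_heat t (a i) (m i) (F i) y\<bar>)"
        by (rule sum_abs)
      also have "\<dots> \<le> (\<Sum>i\<in>I. C i * N * norm (x - y) * t powr (- \<beta> - 1))"
        using C(3)[OF _ root(2)[OF t] F] unfolding root(1)[OF t] pw by (intro sum_mono) auto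
      finally show ?thesis by (simp add: D_def sum_distrib_right)
    qed
    \<comment> \<open>Time is cut at |x - y|^e, where both contributions are of size |x -
      y|^s.\<close>
    have "\<bar>kernel_mass * g x - kernel_mass * g y\<bar> \<le>
        2 * D * N * (norm (x - y) ^ e) powr \<alpha> / \<alpha> + (D * N * norm (x - y)) * (norm (x - y) ^ e) powr (- \<beta>) / \<beta>"
    proof (rule abs_limit_le_of_derivative_bounds[OF _ _ far \<alpha> \<beta>])
      show "(\<phi> has_real_derivative \<phi>' t) (at t)" if "t > 0" for t
        using DERIV_diff[OF conv_heat_has_derivative_time[OF real_polynomial_function_one that g(1), of 0 x]
          conv_heat_has_derivative_time[OF real_polynomial_function_one that g(1), of 0 y]]
        unfolding \<phi>_def \<phi>'_def by simp
      show "\<bar>\<phi>' t\<bar> \<le> 2 * D * N * t powr (\<alpha> - 1)" if "t > 0" for t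
        using near[OF that, of x] near[OF that, of y] unfolding \<phi>'_def by linarith
      show "(\<phi> \<longlongrightarrow> 0) at_top"
        unfolding \<phi>_def
        using tendsto_diff[OF conv_heat_at_top[OF real_polynomial_function_one g(1), of 0 x]
          conv_heat_at_top[OF real_polynomial_function_one g(1), of 0 y]] by simp
      have lim: "((\<lambda>t. conv_heat t (\<lambda>_. 1) 0 g z) \<longlongrightarrow> kernel_mass * g z) (at_right 0)" for z
      proof -
        have "filterlim (\<lambda>t::real. t powr (1 / real e)) (at_right 0) (at_right 0)"
          using e by real_asymp
        from filterlim_compose[OF conv_heat_at_right_0[OF g] this]
        have "((\<lambda>t. conv_heat ((t powr (1 / real e)) ^ e) (\<lambda>_. 1) 0 g z) \<longlongrightarrow> kernel_mass * g z) (at_right 0)" .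
        moreover have "\<forall>\<^sub>F t in at_right 0. conv_heat ((t powr (1 / real e)) ^ e) (\<lambda>_. 1) 0 g z
            = conv_heat t (\<lambda>_. 1) 0 g z"
          using eventually_at_right_less[of 0] by eventually_elim (simp add: root)
        ultimately show ?thesis by (rule Lim_transform_eventually)
      qed
      show "(\<phi> \<longlongrightarrow> kernel_mass * g x - kernel_mass * g y) (at_right 0)"
        unfolding \<phi>_def by (intro tendsto_diff lim)
      show "norm (x - y) ^ e > 0" using xy by simp
    qed
    also have "(norm (x - y) ^ e) powr \<alpha> = norm (x - y) powr s"
      using xy e by (simp add: powr_powr \<alpha>_def flip: powr_realpow)
    also have "(D * N * norm (x - y)) * (norm (x - y) ^ e) powr (- \<beta>) = D * N * norm (x - y) powr s"
    proof -
      have "(norm (x - y) ^ e) powr (- \<beta>) = norm (x - y) powr (s - 1)"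
        using xy e by (simp add: powr_powr \<beta>_def flip: powr_realpow)
      then show ?thesis using xy by (simp add: powr_diff)
    qed
    also have "2 * D * N * norm (x - y) powr s / \<alpha> + D * N * norm (x - y) powr s / \<beta>
        = (2 * D / \<alpha> + D / \<beta>) * N * norm (x - y) powr s"
      by (simp add: distrib_right)
    also have "\<bar>kernel_mass * g x - kernel_mass * g y\<bar> = \<bar>g x - g y\<bar> * kernel_mass"
      using kernel_mass_pos by (simp add: abs_mult mult.commute flip: right_diff_distrib)
    finally have "\<bar>g x - g y\<bar> \<le> (2 * D / \<alpha> + D / \<beta>) * N * norm (x - y) powr s / kernel_mass"
      using kernel_mass_pos by (simp only: pos_le_divide_eq)
    then show ?thesis by (simp add: C'_def)
  qed
  note est = this
  show ?thesis
  proof (intro exI[of _ C'] conjI allI impI C'0)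
    fix g F N B x y
    assume *: "integrable lborel g" "continuous_on UNIV g" "\<forall>x. \<bar>g x\<bar> \<le> B"
      "\<forall>i\<in>I. integrable lborel (F i) \<and> Q i (F i) N"
      "\<forall>t>0. \<forall>x. conv_heat t q 0 g x = (\<Sum>i\<in>I. conv_heat t (a i) (m i) (F i) x)"
    show "\<bar>g x - g y\<bar> \<le> C' * N * norm (x - y) powr s"
      by (rule est[OF *(1,2) *(3)[rule_format]]) (use *(4,5) in auto)
  qed
qed

end

section \<open>Homogeneous polynomials\<close>

definition homogeneous_polynomial :: "nat \<Rightarrow> ('a::real_normed_vector \<Rightarrow> real) \<Rightarrow> bool" where
  "homogeneous_polynomial h a \<longleftrightarrow> real_polynomial_function a \<and> (\<forall>r \<xi>. a (r *\<^sub>R \<xi>) = r ^ h * a \<xi>)"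

lemma homogeneous_polynomialD:
  assumes "homogeneous_polynomial h a"
  shows "real_polynomial_function a" "a (r *\<^sub>R \<xi>) = r ^ h * a \<xi>"
  using assms by (auto simp: homogeneous_polynomial_def)

lemma homogeneous_polynomial_add:
  assumes "homogeneous_polynomial h a" "homogeneous_polynomial h b"
  shows "homogeneous_polynomial h (\<lambda>\<xi>. a \<xi> + b \<xi>)"
  using assms by (auto simp: homogeneous_polynomial_def distrib_left)

lemma homogeneous_polynomial_mult:
  assumes "homogeneous_polynomial h a" "homogeneous_polynomial l b"
  shows "homogeneous_polynomial (h + l) (\<lambda>\<xi>. a \<xi> * b \<xi>)"
  using assms by (auto simp: homogeneous_polynomial_def power_add)

lemma homogeneous_polynomial_cmult:
  assumes "homogeneous_polynomial h a"
  shows "homogeneous_polynomial h (\<lambda>\<xi>. c * a \<xi>)"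
  using assms real_polynomial_function.intros(4)[OF real_polynomial_function.intros(2)]
  by (auto simp: homogeneous_polynomial_def)

lemma homogeneous_polynomial_sum:
  assumes "finite I" "\<And>i. i \<in> I \<Longrightarrow> homogeneous_polynomial h (a i)"
  shows "homogeneous_polynomial h (\<lambda>\<xi>. \<Sum>i\<in>I. a i \<xi>)"
  using assms by (auto simp: homogeneous_polynomial_def sum_distrib_left)

lemma homogeneous_polynomial_prod:
  assumes "finite I" "\<And>i. i \<in> I \<Longrightarrow> homogeneous_polynomial (h i) (a i)"
  shows "homogeneous_polynomial (\<Sum>i\<in>I. h i) (\<lambda>\<xi>. \<Prod>i\<in>I. a i \<xi>)"
  using assms by (auto simp: homogeneous_polynomial_def power_sum prod.distrib)

lemma homogeneous_polynomial_power:
  assumes "homogeneous_polynomial h a"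
  shows "homogeneous_polynomial (h * n) (\<lambda>\<xi>. a \<xi> ^ n)"
  using assms by (auto simp: homogeneous_polynomial_def power_mult power_mult_distrib)

text \<open>Every summand of the Leibniz formula is, up to sign, a product of \<open>n\<close>
  entries of degree \<open>h\<close>.\<close>

lemma homogeneous_polynomial_det:
  assumes "\<And>i j. i < n \<Longrightarrow> j < n \<Longrightarrow> homogeneous_polynomial h (f i j)"
  shows "homogeneous_polynomial (h * n) (\<lambda>\<xi>. Determinant.det (Matrix.mat n n (\<lambda>(i, j). f i j \<xi>)))"
proof -
  have perm: "p i < n" if "p permutes {0..<n}" "i < n" for p i
    using permutes_in_image[OF that(1), of i] that(2) by simp
  have "Determinant.det (Matrix.mat n n (\<lambda>(i, j). f i j \<xi>)) =
      (\<Sum>p\<in>{p. p permutes {0..<n}}. signof p * (\<Prod>i = 0..<n. f i (p i) \<xi>))" for \<xi>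
    by (subst det_def'[of _ n]) (auto intro!: sum.cong prod.cong simp: perm)
  moreover have "homogeneous_polynomial (h * n)
      (\<lambda>\<xi>. \<Sum>p\<in>{p. p permutes {0..<n}}. signof p * (\<Prod>i = 0..<n. f i (p i) \<xi>))"
  proof (intro homogeneous_polynomial_sum homogeneous_polynomial_cmult finite_permutations)
    fix p assume "p \<in> {p. p permutes {0..<n}}"
    then have "homogeneous_polynomial (\<Sum>i = 0..<n. h) (\<lambda>\<xi>. \<Prod>i = 0..<n. f i (p i) \<xi>)"
      using assms by (intro homogeneous_polynomial_prod) (auto simp: perm)
    then show "homogeneous_polynomial (h * n) (\<lambda>\<xi>. \<Prod>i = 0..<n. f i (p i) \<xi>)" by (simp add: mult.commute)
  qed simp
  ultimately show ?thesis by simp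
qed

text \<open>The determinant is squared to make \<open>q\<close> positive without discussing its sign.\<close>

lemma polynomial_matrix_inverse:
  fixes M :: "nat \<Rightarrow> nat \<Rightarrow> 'a::real_normed_vector \<Rightarrow> real"
  assumes M: "\<And>i j. i < n \<Longrightarrow> j < n \<Longrightarrow> homogeneous_polynomial h (M i j)" and n: "n > 0"
    and inj: "\<And>\<xi> c. \<xi> \<noteq> 0 \<Longrightarrow> (\<And>i. i < n \<Longrightarrow> (\<Sum>j<n. M i j \<xi> * c j) = 0) \<Longrightarrow> (\<And>j. j < n \<Longrightarrow> c j = 0)"
  shows "\<exists>q N. homogeneous_polynomial (2 * (h * n)) q \<and> (\<forall>\<xi>. \<xi> \<noteq> 0 \<longrightarrow> q \<xi> > 0) \<and>
    (\<forall>i<n. \<forall>j<n. homogeneous_polynomial (2 * (h * n) - h) (N i j)) \<and>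
    (\<forall>i<n. \<forall>l<n. \<forall>\<xi>. (\<Sum>j<n. N i j \<xi> * M j l \<xi>) = (if i = l then q \<xi> else 0))"
proof -
  define A where "A \<xi> = Matrix.mat n n (\<lambda>(i, j). M i j \<xi>)" for \<xi>
  have A: "A \<xi> \<in> carrier_mat n n" for \<xi> by (simp add: A_def)
  define d where "d \<xi> = Determinant.det (A \<xi>)" for \<xi>
  have d: "homogeneous_polynomial (h * n) d"
    unfolding d_def A_def by (rule homogeneous_polynomial_det[OF M])
  have d0: "d \<xi> \<noteq> 0" if "\<xi> \<noteq> 0" for \<xi>
  proof
    assume "d \<xi> = 0"
    then obtain v where v: "v \<in> carrier_vec n" "v \<noteq> 0\<^sub>v n" "A \<xi> *\<^sub>v v = 0\<^sub>v n"
      using det_0_iff_vec_prod_zero[OF A] unfolding d_def by blast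
    have "(\<Sum>j<n. M i j \<xi> * vec_index v j) = 0" if "i < n" for i
    proof -
      have "vec_index (A \<xi> *\<^sub>v v) i = (\<Sum>j = 0..<n. M i j \<xi> * vec_index v j)"
        using v(1) that by (auto simp: A_def scalar_prod_def)
      then show ?thesis using v(3) that by (simp add: lessThan_atLeast0)
    qed
    then have "vec_index v j = 0" if "j < n" for j using inj[OF \<open>\<xi> \<noteq> 0\<close>] that by blast
    then have "v = 0\<^sub>v n" using v(1) by (intro eq_vecI) auto
    then show False using v(2) by simp
  qed
  \<comment> \<open>\<open>N\<close> is \<open>d\<close> times the adjugate, hence the transposed
    indices of the cofactor; its product with the matrix is d^2 times the identity.\<close>
  define N where "N i j \<xi> = d \<xi> * cofactor (A \<xi>) j i" for i j \<xi>
  have cof: "homogeneous_polynomial (h * (n - 1)) (\<lambda>\<xi>. cofactor (A \<xi>) i j)" if "i < n" "j < n" for i j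
  proof -
    \<comment> \<open>Deleting a row and a column shifts the later indices by one, so a cofactor is
      again, up to sign, a determinant with polynomial entries.\<close>
    have "mat_delete (A \<xi>) i j = Matrix.mat (n - 1) (n - 1)
        (\<lambda>(i', j'). M (if i' < i then i' else Suc i') (if j' < j then j' else Suc j') \<xi>)" for \<xi>
      by (rule eq_matI) (auto simp: mat_delete_def A_def)
    then show ?thesis
      unfolding cofactor_def
      by (simp only:) (intro homogeneous_polynomial_cmult homogeneous_polynomial_det M; auto)
  qed
  \<comment> \<open>\<open>n > 0\<close> keeps the truncated subtractions exact.\<close>
  have deg: "h * n + h * (n - 1) = 2 * (h * n) - h" using n by (cases n) auto
  have "homogeneous_polynomial (2 * (h * n) - h) (N i j)" if "i < n" "j < n" for i j
    using homogeneous_polynomial_mult[OF d cof[OF that(2,1)]] unfolding N_def deg .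
  moreover have "homogeneous_polynomial (2 * (h * n)) (\<lambda>\<xi>. d \<xi> * d \<xi>)"
    using homogeneous_polynomial_mult[OF d d] by (simp add: mult_2)
  moreover have "d \<xi> * d \<xi> > 0" if "\<xi> \<noteq> 0" for \<xi> using d0[OF that] by (simp add: zero_less_mult_iff) linarith
  moreover have "(\<Sum>j<n. N i j \<xi> * M j l \<xi>) = (if i = l then d \<xi> * d \<xi> else 0)" if il: "i < n" "l < n" for i l \<xi>
  proof -
    have "index_mat (adj_mat (A \<xi>) * A \<xi>) (i, l) = (\<Sum>j<n. cofactor (A \<xi>) j i * M j l \<xi>)"
      using il by (simp add: adj_mat_def scalar_prod_def A_def lessThan_atLeast0)
    moreover have "index_mat (adj_mat (A \<xi>) * A \<xi>) (i, l) = (if i = l then d \<xi> else 0)"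
      unfolding adj_mat(3)[OF A] using il by (simp add: d_def)
    ultimately have "(\<Sum>j<n. cofactor (A \<xi>) j i * M j l \<xi>) = (if i = l then d \<xi> else 0)" by simp
    then have "d \<xi> * (\<Sum>j<n. cofactor (A \<xi>) j i * M j l \<xi>) = (if i = l then d \<xi> * d \<xi> else 0)" by simp
    then show ?thesis by (simp add: N_def sum_distrib_left mult.assoc)
  qed
  ultimately show ?thesis by (intro exI[of _ "\<lambda>\<xi>. d \<xi> * d \<xi>"] exI[of _ N]) blast
qed

text \<open>The constant is the minimum of \<open>q\<close> over the compact unit sphere;
  homogeneity carries the bound to all vectors.\<close>

lemma elliptic_polynomial_if_positive:
  fixes q :: "'a::euclidean_space \<Rightarrow> real"
  assumes q: "homogeneous_polynomial e q" and pos: "\<And>\<xi>. \<xi> \<noteq> 0 \<Longrightarrow> q \<xi> > 0" and e: "e \<ge> 1"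
  obtains c0 where "elliptic_polynomial q e c0"
proof -
  have cont: "continuous_on (sphere 0 1) q"
    by (rule real_polynomial_function_continuous_on[OF homogeneous_polynomialD(1)[OF q]])
  have "sphere (0::'a) 1 \<noteq> {}" by simp
  then obtain \<eta> where \<eta>: "\<eta> \<in> sphere 0 1" "\<And>\<xi>. \<xi> \<in> sphere 0 1 \<Longrightarrow> q \<eta> \<le> q \<xi>"
    using continuous_attains_inf[OF compact_sphere _ cont] by blast
  have "q \<eta> * norm \<xi> ^ e \<le> q \<xi>" for \<xi>
  proof (cases "\<xi> = 0")
    case True
    then show ?thesis using homogeneous_polynomialD(2)[OF q, of 0 0] e by (auto simp: power_0_left)
  next
    case False
    then have "q \<eta> \<le> q ((1 / norm \<xi>) *\<^sub>R \<xi>)" by (intro \<eta>) simp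
    then have "norm \<xi> ^ e * q \<eta> \<le> norm \<xi> ^ e * q ((1 / norm \<xi>) *\<^sub>R \<xi>)" by (intro mult_left_mono) auto
    also have "\<dots> = q \<xi>" using False homogeneous_polynomialD(2)[OF q, of "norm \<xi>" "(1 / norm \<xi>) *\<^sub>R \<xi>"] by simp
    finally show ?thesis by (simp add: mult.commute)
  qed
  moreover have "q \<eta> > 0" using \<eta>(1) by (intro pos) auto
  ultimately have "elliptic_polynomial q e (q \<eta>)"
    using homogeneous_polynomialD[OF q] e by unfold_locales
  then show ?thesis by (rule that)
qed

section \<open>Test functions\<close>

lemma iter_partial_Nil [simp]: "iter_partial [] f = f"
  by (simp add: iter_partial_def)

lemma iter_partial_Cons: "iter_partial (i # is) f = partial_deriv i (iter_partial is f)"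
  by (simp add: iter_partial_def)

lemma iter_partial_append: "iter_partial (js @ is) f = iter_partial js (iter_partial is f)"
  by (simp add: iter_partial_def)

lemma smooth_iter_partial: "smooth f \<Longrightarrow> smooth (iter_partial is f)"
  unfolding smooth_def iter_partial_append[symmetric] by blast

lemma smooth_has_partial_deriv:
  assumes "smooth f"
  shows "((\<lambda>\<sigma>. f (x + \<sigma> *\<^sub>R axis i 1)) has_vector_derivative partial_deriv i f x) (at 0)"
proof -
  have "f differentiable (at (x + 0 *\<^sub>R axis i 1))"
    using assms unfolding smooth_def by (metis iter_partial_Nil)
  moreover have "(\<lambda>\<sigma>::real. x + \<sigma> *\<^sub>R axis i 1) differentiable (at 0)"
    by (intro derivative_intros)
  ultimately have "(\<lambda>\<sigma>. f (x + \<sigma> *\<^sub>R axis i 1)) differentiable (at (0::real))"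
    using differentiable_chain_at[of "\<lambda>\<sigma>. x + \<sigma> *\<^sub>R axis i 1" 0 f] by (simp add: comp_def)
  then show ?thesis unfolding partial_deriv_def vector_derivative_works .
qed

lemma iter_partial_bounded_linear:
  assumes "bounded_linear T" "smooth f"
  shows "iter_partial is (\<lambda>x. T (f x)) = (\<lambda>x. T (iter_partial is f x))"
proof (induction "is")
  case (Cons i "is")
  have "partial_deriv i (\<lambda>x. T (iter_partial is f x)) x = T (partial_deriv i (iter_partial is f) x)" for x
  proof -
    have "((\<lambda>\<sigma>. T (iter_partial is f (x + \<sigma> *\<^sub>R axis i 1))) has_vector_derivative
        T (partial_deriv i (iter_partial is f) x)) (at 0)"
      by (rule bounded_linear.has_vector_derivative[OF assms(1) smooth_has_partial_deriv[OF smooth_iter_partial[OF assms(2)]]])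
    then show ?thesis by (simp add: partial_deriv_def vector_derivative_at)
  qed
  then show ?case by (simp add: iter_partial_Cons Cons fun_eq_iff)
qed simp

lemma smooth_bounded_linear:
  assumes "bounded_linear T" "smooth f"
  shows "smooth (\<lambda>x. T (f x))"
  unfolding smooth_def iter_partial_bounded_linear[OF assms]
proof (intro allI)
  fix "is" x
  have "iter_partial is f differentiable (at x)" using assms(2) by (simp add: smooth_def)
  from differentiable_chain_at[OF this bounded_linear_imp_differentiable[OF assms(1)]]
  show "(\<lambda>x. T (iter_partial is f x)) differentiable (at x)" by (simp add: comp_def)
qed

lemma iter_partial_eq_0:
  assumes "\<And>x. norm x > R \<Longrightarrow> f x = 0" "norm x > R"
  shows "iter_partial is f x = 0"
  using assms(2)
proof (induction "is" arbitrary: x)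
  case (Cons i "is")
  let ?S = "(\<lambda>\<sigma>::real. x + \<sigma> *\<^sub>R axis i 1) -` {y. norm y > R}"
  have "((\<lambda>\<sigma>. iter_partial is f (x + \<sigma> *\<^sub>R axis i 1)) has_vector_derivative 0) (at 0)"
  proof (rule has_vector_derivative_transform_within_open)
    show "((\<lambda>_. 0) has_vector_derivative 0) (at 0)" by simp
    show "open ?S" by (intro open_vimage open_Collect_less continuous_intros)
  qed (use Cons in auto)
  then show ?case by (simp add: iter_partial_Cons partial_deriv_def vector_derivative_at)
qed (use assms in auto)

section \<open>Compact support, multi-indices and orthonormal coordinates\<close>

definition compactly_supported :: "('a::real_normed_vector \<Rightarrow> 'b::real_normed_vector) \<Rightarrow> bool" where
  "compactly_supported f \<longleftrightarrow> continuous_on UNIV f \<and> (\<exists>R. \<forall>x. norm x > R \<longrightarrow> f x = 0)"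

lemma compactly_supported_compose:
  assumes "compactly_supported f" "continuous_on UNIV h" "h 0 = 0"
  shows "compactly_supported (\<lambda>x. h (f x))"
  using assms continuous_on_compose2[of UNIV h UNIV f] unfolding compactly_supported_def by force

lemma compactly_supported_sum:
  assumes "finite I" "\<And>i. i \<in> I \<Longrightarrow> compactly_supported (f i)"
  shows "compactly_supported (\<lambda>x. \<Sum>i\<in>I. f i x)"
proof -
  have "\<forall>i\<in>I. \<exists>R. \<forall>x. norm x > R \<longrightarrow> f i x = 0" using assms unfolding compactly_supported_def by blast
  from bchoice[OF this] obtain R where R: "\<forall>i\<in>I. \<forall>x. norm x > R i \<longrightarrow> f i x = 0" ..
  have "(\<Sum>i\<in>I. f i x) = 0" if x: "norm x > (\<Sum>i\<in>I. \<bar>R i\<bar>)" for x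
  proof (intro sum.neutral ballI)
    fix i assume "i \<in> I"
    then have "\<bar>R i\<bar> \<le> (\<Sum>i\<in>I. \<bar>R i\<bar>)" using assms(1) by (intro member_le_sum) auto
    then show "f i x = 0" using R \<open>i \<in> I\<close> x by auto
  qed
  then show ?thesis using assms unfolding compactly_supported_def by (auto intro!: continuous_on_sum)
qed

lemma compactly_supported_integrable_bounded:
  fixes f :: "'a::euclidean_space \<Rightarrow> real"
  assumes "compactly_supported f"
  shows "integrable lborel f" "\<exists>B. \<forall>x. \<bar>f x\<bar> \<le> B"
proof -
  obtain R where f: "continuous_on UNIV f" "\<And>x. norm x > R \<Longrightarrow> f x = 0"
    using assms unfolding compactly_supported_def by blast
  have cont: "continuous_on (cball 0 R) f" using f(1) by (rule continuous_on_subset) simp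
  have "(\<lambda>x. indicator (cball 0 R) x *\<^sub>R f x) = f"
    using f(2) by (auto simp: fun_eq_iff indicator_def)
  then show "integrable lborel f" using borel_integrable_compact[OF compact_cball cont] by simp
  have "bounded (f ` cball 0 R)" by (intro compact_imp_bounded compact_continuous_image cont compact_cball)
  then obtain B where B: "\<forall>x\<in>cball 0 R. \<bar>f x\<bar> \<le> B" by (auto simp: bounded_iff)
  have "\<bar>f x\<bar> \<le> max B 0" for x
    using bspec[OF B, of x] f(2)[of x] by (cases "norm x \<le> R") auto
  then show "\<exists>B. \<forall>x. \<bar>f x\<bar> \<le> B" by blast
qed

lemma compactly_supported_powr:
  fixes f :: "'a::real_normed_vector \<Rightarrow> real"
  assumes "compactly_supported f" "p > 0"
  shows "compactly_supported (\<lambda>x. \<bar>f x\<bar> powr p)"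
proof -
  have "continuous_on UNIV (\<lambda>y::real. \<bar>y\<bar> powr p)"
    using assms(2) by (intro continuous_on_powr' continuous_intros) auto
  from compactly_supported_compose[OF assms(1) this] show ?thesis by simp
qed

lemma test_function_iter_partial:
  assumes "P \<in> test_functions"
  shows "compactly_supported (iter_partial is P)"
proof -
  have P: "smooth P" "compact (closure {x. P x \<noteq> 0})" using assms by (auto simp: test_functions_def)
  obtain R where R: "\<And>x. x \<in> closure {x. P x \<noteq> 0} \<Longrightarrow> norm x \<le> R"
    using compact_imp_bounded[OF P(2)] by (auto simp: bounded_iff)
  have "P x = 0" if "norm x > R" for x using R[of x] that closure_subset[of "{x. P x \<noteq> 0}"] by force
  then have "iter_partial is P x = 0" if "norm x > R" for x using iter_partial_eq_0 that by blast
  moreover have "continuous_on UNIV (iter_partial is P)"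
    using P(1) unfolding smooth_def
    by (meson continuous_at_imp_continuous_on differentiable_imp_continuous_within)
  ultimately show ?thesis unfolding compactly_supported_def by blast
qed

definition coordinate_list :: "('n::finite \<Rightarrow> nat) \<Rightarrow> 'n list" where
  "coordinate_list \<alpha> = (SOME is. \<forall>i. count_list is i = \<alpha> i)"

lemma multi_partial_eq: "multi_partial \<alpha> = iter_partial (coordinate_list \<alpha>)"
  by (simp add: multi_partial_def coordinate_list_def)

text \<open>The choice is meaningful: concatenating \<open>\<alpha> i\<close> copies of each
  coordinate \<open>i\<close> produces a list with these counts.\<close>

lemma count_coordinate_list: "count_list (coordinate_list \<alpha>) i = \<alpha> i"
proof -
  obtain xs :: "'a list" where xs: "set xs = UNIV" "distinct xs"
    using finite_distinct_list[of "UNIV :: 'a set"] by auto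
  have repl: "count_list (replicate n a) j = (if a = j then n else 0)" for n and a j :: 'a
    by (induction n) auto
  have "count_list (concat (map (\<lambda>i. replicate (\<alpha> i) i) ys)) j = (if j \<in> set ys then \<alpha> j else 0)"
    if "distinct ys" for ys j
    using that by (induction ys) (auto simp: repl)
  then have "\<exists>is. \<forall>i. count_list is i = \<alpha> i" using xs by (metis UNIV_I)
  from someI_ex[OF this] show ?thesis unfolding coordinate_list_def by blast
qed

lemma length_coordinate_list: "\<alpha> \<in> multi_indices k \<Longrightarrow> length (coordinate_list \<alpha>) = k"
  using sum_count_set[of "coordinate_list \<alpha>" UNIV] by (simp add: count_coordinate_list multi_indices_def)

definition monomial :: "('n::finite \<Rightarrow> nat) \<Rightarrow> real ^ 'n \<Rightarrow> real" where
  "monomial \<alpha> \<xi> = (\<Prod>i\<in>UNIV. (\<xi> $ i) ^ \<alpha> i)"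

lemma monomial_count_list: "monomial (count_list is) \<xi> = prod_list (map (\<lambda>i. \<xi> $ i) is)"
proof (induction "is")
  case (Cons j "is")
  have "monomial (count_list (j # is)) \<xi> = (\<Prod>i\<in>UNIV. (if i = j then \<xi> $ j else 1) * (\<xi> $ i) ^ count_list is i)"
    unfolding monomial_def by (intro prod.cong) auto
  also have "\<dots> = \<xi> $ j * monomial (count_list is) \<xi>"
    by (simp add: prod.distrib monomial_def)
  finally show ?case using Cons.IH by (simp only: list.map prod_list.Cons)
qed (simp add: monomial_def)

lemma monomial_coordinate_list: "prod_list (map (\<lambda>i. \<xi> $ i) (coordinate_list \<alpha>)) = monomial \<alpha> \<xi>"
  unfolding monomial_count_list[symmetric] by (simp add: monomial_def count_coordinate_list)

lemma homogeneous_polynomial_coordinate: "homogeneous_polynomial 1 (\<lambda>\<xi>::real ^ 'n::finite. \<xi> $ i)"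
  unfolding homogeneous_polynomial_def
  by (auto intro!: real_polynomial_function.intros(1) bounded_linear_vec_nth)

lemma homogeneous_polynomial_monomial:
  assumes "\<alpha> \<in> multi_indices k"
  shows "homogeneous_polynomial k (monomial \<alpha>)"
proof -
  have "homogeneous_polynomial (\<Sum>i\<in>UNIV. 1 * \<alpha> i) (\<lambda>\<xi>. \<Prod>i\<in>UNIV. (\<xi> $ i) ^ \<alpha> i)"
    by (intro homogeneous_polynomial_prod homogeneous_polynomial_power homogeneous_polynomial_coordinate) auto
  then show ?thesis using assms by (simp add: monomial_def[abs_def] multi_indices_def)
qed

lemma finite_multi_indices: "finite (multi_indices k :: ('n::finite \<Rightarrow> nat) set)"
proof (rule finite_subset)
  show "multi_indices k \<subseteq> (UNIV :: 'n set) \<rightarrow>\<^sub>E {..k}"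
  proof
    fix \<alpha> :: "'n \<Rightarrow> nat" assume "\<alpha> \<in> multi_indices k"
    then have "\<alpha> i \<le> k" for i
      using member_le_sum[of i UNIV \<alpha>] by (simp add: multi_indices_def)
    then show "\<alpha> \<in> UNIV \<rightarrow>\<^sub>E {..k}" by auto
  qed
  show "finite ((UNIV :: 'n set) \<rightarrow>\<^sub>E {..k})" by (intro finite_PiE) auto
qed

text \<open>Orthogonalising a finite spanning set may produce the zero vector, which is removed
  before normalising; \<open>d = 0\<close> occurs for the zero space. The expansion holds because
  the remainder is orthogonal to a spanning set and hence to itself.\<close>

lemma orthonormal_basis_enumeration:
  assumes "finite_dimensional TYPE('v::real_inner)"
  obtains d and b :: "nat \<Rightarrow> 'v::real_inner" where
    "\<And>i j. i < d \<Longrightarrow> j < d \<Longrightarrow> b i \<bullet> b j = (if i = j then 1 else 0)"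
    "\<And>v. v = (\<Sum>i<d. (v \<bullet> b i) *\<^sub>R b i)"
proof -
  obtain B :: "'v set" where "finite B" "span B = UNIV"
    using assms by (auto simp: finite_dimensional_def)
  then obtain C :: "'v set" where C: "finite C" "span C = UNIV" "pairwise orthogonal C"
    using basis_orthogonal[of B] by auto
  obtain u where u: "bij_betw u {..<card (C - {0})} (C - {0})"
    using ex_bij_betw_nat_finite[of "C - {0}"] C(1) by (auto simp: lessThan_atLeast0)
  define d where "d = card (C - {0})"
  define b where "b i = (1 / norm (u i)) *\<^sub>R u i" for i
  have uC: "u i \<in> C" "u i \<noteq> 0" if "i < d" for i
    using bij_betwE[OF u] that by (auto simp: d_def)
  have uj: "u i \<noteq> u j" if "i < d" "j < d" "i \<noteq> j" for i j
    using bij_betw_imp_inj_on[OF u] that by (auto simp: d_def inj_on_def)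
  have orth: "b i \<bullet> b j = (if i = j then 1 else 0)" if "i < d" "j < d" for i j
  proof (cases "i = j")
    case True
    then show ?thesis using uC[OF that(1)] by (simp add: b_def dot_square_norm power2_eq_square)
  next
    case False
    then have "orthogonal (u i) (u j)"
      using C(3) uC that uj by (auto simp: pairwise_def)
    then show ?thesis using False by (simp add: b_def Linear_Algebra.orthogonal_def)
  qed
  have "v = (\<Sum>i<d. (v \<bullet> b i) *\<^sub>R b i)" for v
  proof -
    define w where "w = v - (\<Sum>i<d. (v \<bullet> b i) *\<^sub>R b i)"
    have wb: "w \<bullet> b j = 0" if "j < d" for j
    proof -
      have "(\<Sum>i<d. (v \<bullet> b i) *\<^sub>R b i) \<bullet> b j = (\<Sum>i<d. if i = j then v \<bullet> b i else 0)"
        unfolding inner_sum_left using orth[OF _ that] by (intro sum.cong) auto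
      then show ?thesis using that by (simp add: w_def inner_diff_left)
    qed
    have "orthogonal w y" if "y \<in> C" for y
    proof (cases "y = 0")
      case False
      then obtain j where j: "j < d" "y = u j"
        using bij_betw_imp_surj_on[OF u] \<open>y \<in> C\<close> by (auto simp: d_def)
      then show ?thesis using wb[OF j(1)] uC(2)[OF j(1)] by (simp add: b_def Linear_Algebra.orthogonal_def)
    qed (simp add: Linear_Algebra.orthogonal_def)
    then have "orthogonal w w" using C(2) by (intro orthogonal_to_span[of w C w]) auto
    then show ?thesis by (simp add: w_def Linear_Algebra.orthogonal_def)
  qed
  with orth show ?thesis by (rule that)
qed

context
  fixes q :: "real ^ 'n::finite \<Rightarrow> real" and e c0
  assumes q: "elliptic_polynomial q e c0"
begin

interpretation elliptic_polynomial q e c0 by (rule q)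

text \<open>Each derivative in the list becomes a coordinate factor of the symbol and raises the
  index; the induction therefore has to vary \<open>a\<close> and \<open>m\<close>.\<close>

lemma conv_heat_iter_partial:
  assumes "f \<in> test_functions"
  shows "conv_heat t (\<lambda>\<xi>. a \<xi> * prod_list (map (\<lambda>i. \<xi> $ i) is)) (m + length is) f x
    = conv_heat t a m (iter_partial is f) x"
proof (induction "is" arbitrary: a m)
  case (Cons i "is")
  let ?h = "iter_partial is f"
  have sm: "smooth f" using assms by (simp add: test_functions_def)
  have cs: "compactly_supported (iter_partial is f)" for "is" by (rule test_function_iter_partial[OF assms])
  have "conv_heat t a m (iter_partial (i # is) f) x = conv_heat t (\<lambda>\<xi>. a \<xi> * (\<xi> \<bullet> axis i 1)) (Suc m) ?h x"
    unfolding iter_partial_Cons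
  proof (rule conv_heat_derivative[symmetric])
    show "integrable lborel ?h" "continuous_on UNIV ?h"
      using cs compactly_supported_integrable_bounded by (auto simp: compactly_supported_def)
    show "integrable lborel (partial_deriv i ?h)" "continuous_on UNIV (partial_deriv i ?h)"
      using cs[of "i # is"] compactly_supported_integrable_bounded unfolding iter_partial_Cons
      by (auto simp: compactly_supported_def)
    show "((\<lambda>\<sigma>. ?h (y + \<sigma> *\<^sub>R axis i 1)) has_real_derivative partial_deriv i ?h y) (at 0)" for y
      using smooth_has_partial_deriv[OF smooth_iter_partial[OF sm]]
      by (simp add: has_real_derivative_iff_has_vector_derivative)
  qed
  also have "\<dots> = conv_heat t (\<lambda>\<xi>. a \<xi> * (\<xi> \<bullet> axis i 1) * prod_list (map (\<lambda>i. \<xi> $ i) is)) (Suc m + length is) f x"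
    by (rule Cons[symmetric])
  finally show ?case by (simp add: inner_axis mult.assoc)
qed simp

lemma conv_heat_multi_partial:
  assumes "f \<in> test_functions" "\<alpha> \<in> multi_indices k"
  shows "conv_heat t (\<lambda>\<xi>. a \<xi> * monomial \<alpha> \<xi>) (m + k) f x = conv_heat t a m (multi_partial \<alpha> f) x"
  using conv_heat_iter_partial[OF assms(1), of t a "coordinate_list \<alpha>" m x]
  unfolding monomial_coordinate_list multi_partial_eq length_coordinate_list[OF assms(2)] .

end

section \<open>Elliptic systems\<close>

lemma test_functions_bounded_linear:
  assumes T: "bounded_linear T" and P: "P \<in> test_functions"
  shows "(\<lambda>x. T (P x)) \<in> test_functions"
proof -
  interpret bounded_linear T by fact
  have "smooth (\<lambda>x. T (P x))" using P by (simp add: test_functions_def smooth_bounded_linear[OF T])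
  moreover have "closure {x. T (P x) \<noteq> 0} \<subseteq> closure {x. P x \<noteq> 0}"
    by (intro closure_mono) (auto simp: zero)
  then have "compact (closure {x. T (P x) \<noteq> 0})"
    using P compact_Int_closed[of "closure {x. P x \<noteq> 0}" "closure {x. T (P x) \<noteq> 0}"]
    by (simp add: test_functions_def Int_absorb1)
  ultimately show ?thesis by (simp add: test_functions_def)
qed

lemma multi_partial_bounded_linear:
  assumes "bounded_linear T" "P \<in> test_functions"
  shows "multi_partial \<alpha> (\<lambda>x. T (P x)) y = T (multi_partial \<alpha> P y)"
  using iter_partial_bounded_linear[OF assms(1), of P] assms(2)
  by (simp add: multi_partial_eq test_functions_def)

text \<open>\<open>d > 0\<close> excludes the zero space, where \<open>q\<close> would be a
  constant; that case is settled separately at the end.\<close>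

locale elliptic_system =
  fixes k d :: nat and bs :: "nat \<Rightarrow> 'v::real_inner"
    and A :: "'v \<Rightarrow> 'u::real_inner"
    and BB :: "('n::finite \<Rightarrow> nat) \<Rightarrow> 'v \<Rightarrow> 'w::real_inner"
  assumes k: "k \<ge> 1" and d: "d > 0"
    and orthonormal: "\<And>i j. i < d \<Longrightarrow> j < d \<Longrightarrow> bs i \<bullet> bs j = (if i = j then 1 else 0)"
    and expansion: "\<And>v. v = (\<Sum>i<d. (v \<bullet> bs i) *\<^sub>R bs i)"
    and linear_A: "linear A"
    and linear_BB: "\<And>\<alpha>. \<alpha> \<in> multi_indices k \<Longrightarrow> linear (BB \<alpha>)"
    and kernels_trivial: "\<And>(\<xi>::real ^ 'n) v. \<xi> \<noteq> 0 \<Longrightarrow> A v = 0 \<Longrightarrow> symbol k BB \<xi> v = 0 \<Longrightarrow> v = 0"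
begin

section \<open>Coordinates and the Gram matrix of the system\<close>

lemma linear_expansion:
  fixes T :: "'v \<Rightarrow> 'z::real_vector"
  assumes "linear T"
  shows "T v = (\<Sum>i<d. (v \<bullet> bs i) *\<^sub>R T (bs i))"
proof -
  have "T v = T (\<Sum>i<d. (v \<bullet> bs i) *\<^sub>R bs i)" using expansion[of v] by simp
  also have "\<dots> = (\<Sum>i<d. (v \<bullet> bs i) *\<^sub>R T (bs i))"
    by (simp add: linear_sum[OF assms] linear_scale[OF assms])
  finally show ?thesis .
qed

lemma linear_imp_bounded_linear:
  fixes T :: "'v \<Rightarrow> 'z::real_normed_vector"
  assumes "linear T"
  shows "bounded_linear T"
proof -
  have "bounded_linear (\<lambda>v. \<Sum>i<d. (v \<bullet> bs i) *\<^sub>R T (bs i))"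
    by (intro bounded_linear_sum bounded_linear_scaleR_const bounded_linear_inner_left)
  moreover have "T = (\<lambda>v. \<Sum>i<d. (v \<bullet> bs i) *\<^sub>R T (bs i))"
    using linear_expansion[OF assms] by (intro ext)
  ultimately show ?thesis by simp
qed

text \<open>The monomials are written out because they are later converted into derivatives one by
  one. The sum of the powers \<open>(\<xi> $ b) ^ (2 * k)\<close> replaces |\<xi>|^(2k): it is
  positive off the origin, and each summand splits off a factor \<open>\<xi> $ b\<close>.\<close>

definition gram :: "nat \<Rightarrow> nat \<Rightarrow> real ^ 'n \<Rightarrow> real" where
  "gram j l \<xi> =
    (\<Sum>\<beta>\<in>multi_indices k. \<Sum>\<gamma>\<in>multi_indices k.
      (BB \<beta> (bs j) \<bullet> BB \<gamma> (bs l)) * (monomial \<beta> \<xi> * monomial \<gamma> \<xi>)) +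
    (\<Sum>b\<in>UNIV. (A (bs j) \<bullet> A (bs l)) * (\<xi> $ b) ^ (2 * k))"

lemma homogeneous_polynomial_coordinate_power: "homogeneous_polynomial n (\<lambda>\<xi>::real ^ 'n. (\<xi> $ b) ^ n)"
  using homogeneous_polynomial_power[OF homogeneous_polynomial_coordinate, of n b] by simp

lemma homogeneous_polynomial_gram: "homogeneous_polynomial (2 * k) (gram j l)"
  unfolding gram_def[abs_def]
proof (intro homogeneous_polynomial_add homogeneous_polynomial_sum finite_multi_indices
    homogeneous_polynomial_cmult homogeneous_polynomial_coordinate_power)
  fix \<beta> \<gamma> :: "'n \<Rightarrow> nat" assume "\<beta> \<in> multi_indices k" "\<gamma> \<in> multi_indices k"
  from homogeneous_polynomial_mult[OF this[THEN homogeneous_polynomial_monomial]]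
  show "homogeneous_polynomial (2 * k) (\<lambda>\<xi>. monomial \<beta> \<xi> * monomial \<gamma> \<xi>)" by (simp add: mult_2)
qed simp

lemma linear_symbol: "linear (symbol k BB \<xi>)"
  unfolding symbol_def[abs_def] by (intro linear_compose_sum ballI linear_compose_scale_right linear_BB)

lemma gram_eq: "gram j l \<xi> = symbol k BB \<xi> (bs j) \<bullet> symbol k BB \<xi> (bs l) +
    (\<Sum>b\<in>UNIV. (\<xi> $ b) ^ (2 * k)) * (A (bs j) \<bullet> A (bs l))"
proof -
  have sym: "symbol k BB \<xi> v = (\<Sum>\<alpha>\<in>multi_indices k. monomial \<alpha> \<xi> *\<^sub>R BB \<alpha> v)" for v
    by (simp add: symbol_def monomial_def)
  have right: "(monomial \<beta> \<xi> *\<^sub>R w) \<bullet> symbol k BB \<xi> (bs l) =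
      (\<Sum>\<gamma>\<in>multi_indices k. (w \<bullet> BB \<gamma> (bs l)) * (monomial \<beta> \<xi> * monomial \<gamma> \<xi>))" for \<beta> w
    unfolding sym inner_sum_right by (intro sum.cong) auto
  have "symbol k BB \<xi> (bs j) \<bullet> symbol k BB \<xi> (bs l) =
      (\<Sum>\<beta>\<in>multi_indices k. (monomial \<beta> \<xi> *\<^sub>R BB \<beta> (bs j)) \<bullet> symbol k BB \<xi> (bs l))"
    unfolding sym[of "bs j"] inner_sum_left ..
  then show ?thesis unfolding gram_def right by (simp add: sum_distrib_left mult.commute)
qed

text \<open>For v the combination of the \<open>bs l\<close> with coefficients \<open>c l\<close>,
  the quadratic form of the matrix at c equals |B[\<xi>] v|^2 + S |A v|^2 with S > 0. If it
  vanishes, v lies in both kernels, so v = 0, and orthonormality gives c = 0.\<close>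

lemma gram_injective:
  assumes \<xi>: "\<xi> \<noteq> 0" and 0: "\<And>j. j < d \<Longrightarrow> (\<Sum>l<d. gram j l \<xi> * c l) = 0" and l: "l < d"
  shows "c l = 0"
proof -
  define v where "v = (\<Sum>l<d. c l *\<^sub>R bs l)"
  define S where "S = (\<Sum>b\<in>UNIV. (\<xi> $ b) ^ (2 * k))"
  obtain b where b: "\<xi> $ b \<noteq> 0" using \<xi> by (metis Finite_Cartesian_Product.vec_eq_iff zero_index)
  have "0 < (\<xi> $ b) ^ (2 * k)" using b by (simp add: zero_less_power_eq)
  also have "\<dots> \<le> S" unfolding S_def by (intro member_le_sum) auto
  finally have S: "S > 0" .
  have sv: "symbol k BB \<xi> v = (\<Sum>l<d. c l *\<^sub>R symbol k BB \<xi> (bs l))" and Av: "A v = (\<Sum>l<d. c l *\<^sub>R A (bs l))"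
    unfolding v_def by (simp_all add: linear_sum[OF linear_symbol] linear_scale[OF linear_symbol]
        linear_sum[OF linear_A] linear_scale[OF linear_A])
  have "(\<Sum>l<d. gram j l \<xi> * c l) = symbol k BB \<xi> (bs j) \<bullet> symbol k BB \<xi> v + S * (A (bs j) \<bullet> A v)" for j
    unfolding gram_eq sv Av S_def[symmetric]
    by (simp add: inner_sum_right sum_distrib_left sum.distrib[symmetric] algebra_simps)
  then have "(\<Sum>j<d. c j * (symbol k BB \<xi> (bs j) \<bullet> symbol k BB \<xi> v + S * (A (bs j) \<bullet> A v))) = 0"
    using 0 by (intro sum.neutral) auto
  moreover have "(\<Sum>j<d. c j * (symbol k BB \<xi> (bs j) \<bullet> symbol k BB \<xi> v + S * (A (bs j) \<bullet> A v)))
      = (\<Sum>j<d. c j *\<^sub>R symbol k BB \<xi> (bs j)) \<bullet> symbol k BB \<xi> v + S * ((\<Sum>j<d. c j *\<^sub>R A (bs j)) \<bullet> A v)"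
    by (simp add: inner_sum_left sum_distrib_left sum.distrib[symmetric] algebra_simps)
  ultimately have "symbol k BB \<xi> v \<bullet> symbol k BB \<xi> v + S * (A v \<bullet> A v) = 0"
    unfolding sv[symmetric] Av[symmetric] by simp
  moreover have "0 \<le> symbol k BB \<xi> v \<bullet> symbol k BB \<xi> v" "0 \<le> S * (A v \<bullet> A v)" using S by auto
  ultimately have "symbol k BB \<xi> v \<bullet> symbol k BB \<xi> v = 0" "S * (A v \<bullet> A v) = 0" by linarith+
  then have "v = 0" using kernels_trivial[OF \<xi>] S by simp
  moreover have "v \<bullet> bs l = (\<Sum>i<d. if i = l then c i else 0)"
    unfolding v_def inner_sum_left using orthonormal[OF _ l] by (intro sum.cong) auto
  ultimately show ?thesis using l by simp
qed

end

section \<open>Representation of the flow by the data and the estimate of one component\<close>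

locale inverted_elliptic_system = elliptic_system k d bs A BB + elliptic_polynomial q e c0
  for k d bs and A :: "'v::real_inner \<Rightarrow> 'u::real_inner"
    and BB :: "('n::finite \<Rightarrow> nat) \<Rightarrow> 'v \<Rightarrow> 'w::real_inner"
    and q :: "real ^ 'n \<Rightarrow> real" and e c0 +
  fixes N :: "nat \<Rightarrow> nat \<Rightarrow> real ^ 'n \<Rightarrow> real"
  assumes e_ge_2k: "2 * k \<le> e"
    and N: "\<And>i j. i < d \<Longrightarrow> j < d \<Longrightarrow> homogeneous_polynomial (e - 2 * k) (N i j)"
    and inverse: "\<And>i l \<xi>. i < d \<Longrightarrow> l < d \<Longrightarrow> (\<Sum>j<d. N i j \<xi> * gram j l \<xi>) = (if i = l then q \<xi> else 0)"
begin

text \<open>The matrix identity that makes \<open>N\<close> times \<open>gram\<close> equal to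
  \<open>q\<close> times the identity is inserted into the symbol, and monomials are read as
  derivatives: those with index \<gamma> build up \<open>diff_op k BB P\<close>, while in the A part
  the derivative \<alpha> stays on the function. The remaining monomials stay in the symbol.\<close>

lemma heat_decomposition:
  assumes P: "P \<in> test_functions" and i: "i < d" and \<alpha>: "\<alpha> \<in> multi_indices (k - 1)" and t: "t > 0"
  shows "conv_heat t q 0 (\<lambda>y. multi_partial \<alpha> P y \<bullet> bs i) x =
    (\<Sum>j<d. \<Sum>\<beta>\<in>multi_indices k. conv_heat t (\<lambda>\<xi>. N i j \<xi> * monomial \<beta> \<xi> * monomial \<alpha> \<xi>) (4 * k - 1)
      (\<lambda>y. BB \<beta> (bs j) \<bullet> diff_op k BB P y) x) +
    (\<Sum>j<d. \<Sum>b\<in>UNIV. conv_heat t (\<lambda>\<xi>. N i j \<xi> * (\<xi> $ b) ^ (2 * k)) 0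
      (\<lambda>y. A (bs j) \<bullet> multi_partial \<alpha> (\<lambda>z. A (P z)) y) x)"
proof -
  let ?M = "multi_indices k :: ('n \<Rightarrow> nat) set"
  define p where "p l y = P y \<bullet> bs l" for l y
  have pt: "p l \<in> test_functions" for l
    unfolding p_def[abs_def] by (rule test_functions_bounded_linear[OF bounded_linear_inner_left P])
  have mp: "multi_partial \<gamma> (p l) = (\<lambda>y. multi_partial \<gamma> P y \<bullet> bs l)" for \<gamma> l
    unfolding p_def[abs_def] using multi_partial_bounded_linear[OF bounded_linear_inner_left P] by (intro ext)
  have int: "integrable lborel (multi_partial \<gamma> (p l))" for \<gamma> l
    unfolding multi_partial_eq by (intro compactly_supported_integrable_bounded test_function_iter_partial pt)
  have polyN: "real_polynomial_function (N i j)" if "j < d" for j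
    using homogeneous_polynomialD(1)[OF N[OF i that]] .
  have poly_mono: "real_polynomial_function (monomial \<beta>)" if "\<beta> \<in> multi_indices n" for \<beta> :: "'n \<Rightarrow> nat" and n
    using homogeneous_polynomialD(1)[OF homogeneous_polynomial_monomial[OF that]] .
  have poly_coord: "real_polynomial_function (\<lambda>\<xi>::real ^ 'n. (\<xi> $ b) ^ n)" for b n
    using homogeneous_polynomialD(1)[OF homogeneous_polynomial_coordinate_power] .
  have poly_gram: "real_polynomial_function (gram j l)" for j l
    using homogeneous_polynomialD(1)[OF homogeneous_polynomial_gram] .
  \<comment> \<open>The index \<open>4 * k - 1\<close> stands for -1 modulo 4: \<open>k - 1\<close>
    derivatives pass from the function to the symbol and \<open>k\<close> from the symbol to the
    function.\<close>
  define U where "U j \<beta> \<gamma> l = conv_heat t (\<lambda>\<xi>. N i j \<xi> * monomial \<beta> \<xi> * monomial \<alpha> \<xi>) (4 * k - 1)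
      (multi_partial \<gamma> (p l)) x" for j \<beta> \<gamma> l
  define V where "V j b l = conv_heat t (\<lambda>\<xi>. N i j \<xi> * (\<xi> $ b) ^ (2 * k)) 0 (multi_partial \<alpha> (p l)) x" for j b l
  \<comment> \<open>Both sides are convolutions of \<open>p l\<close> with the same kernel, so no mixed derivative of \<open>P\<close> and hence no
    symmetry of second derivatives is needed.\<close>
  have exchange: "conv_heat t (\<lambda>\<xi>. N i j \<xi> * monomial \<beta> \<xi> * monomial \<gamma> \<xi>) 0 (multi_partial \<alpha> (p l)) x = U j \<beta> \<gamma> l"
    if "\<gamma> \<in> ?M" for j \<beta> \<gamma> l
  proof -
    note cm = conv_heat_multi_partial[OF elliptic_polynomial_axioms pt]
    have "U j \<beta> \<gamma> l = conv_heat t (\<lambda>\<xi>. N i j \<xi> * monomial \<beta> \<xi> * monomial \<alpha> \<xi> * monomial \<gamma> \<xi>) (4 * k - 1 + k) (p l) x"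
      unfolding U_def by (rule cm[OF that, symmetric])
    also have "4 * k - 1 + k = (0 + (k - 1)) + 4 * k" using k by simp
    also have "conv_heat t (\<lambda>\<xi>. N i j \<xi> * monomial \<beta> \<xi> * monomial \<alpha> \<xi> * monomial \<gamma> \<xi>) \<dots> (p l) x
        = conv_heat t (\<lambda>\<xi>. N i j \<xi> * monomial \<beta> \<xi> * monomial \<gamma> \<xi> * monomial \<alpha> \<xi>) (0 + (k - 1)) (p l) x"
      unfolding conv_heat_mod_4 by (simp add: mult_ac)
    also have "\<dots> = conv_heat t (\<lambda>\<xi>. N i j \<xi> * monomial \<beta> \<xi> * monomial \<gamma> \<xi>) 0 (multi_partial \<alpha> (p l)) x"
      by (rule cm[OF \<alpha>])
    finally show ?thesis ..
  qed
  have symbol_expand: "conv_heat t (\<lambda>\<xi>. N i j \<xi> * gram j l \<xi>) 0 (multi_partial \<alpha> (p l)) x =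
      (\<Sum>\<beta>\<in>?M. \<Sum>\<gamma>\<in>?M. (BB \<beta> (bs j) \<bullet> BB \<gamma> (bs l)) * U j \<beta> \<gamma> l) +
      (\<Sum>b\<in>UNIV. (A (bs j) \<bullet> A (bs l)) * V j b l)" if j: "j < d" for j l
  proof -
    let ?a1 = "\<lambda>\<xi>. \<Sum>z\<in>?M \<times> ?M. (BB (fst z) (bs j) \<bullet> BB (snd z) (bs l)) *
        (N i j \<xi> * monomial (fst z) \<xi> * monomial (snd z) \<xi>)"
    let ?a2 = "\<lambda>\<xi>. \<Sum>b\<in>UNIV. (A (bs j) \<bullet> A (bs l)) * (N i j \<xi> * (\<xi> $ b) ^ (2 * k))"
    have split: "(\<lambda>\<xi>. N i j \<xi> * gram j l \<xi>) = (\<lambda>\<xi>. ?a1 \<xi> + ?a2 \<xi>)"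
      unfolding gram_def distrib_left sum_distrib_left sum.cartesian_product
      by (simp add: case_prod_unfold mult_ac)
    have poly1: "real_polynomial_function (\<lambda>\<xi>. N i j \<xi> * monomial (fst z) \<xi> * monomial (snd z) \<xi>)"
      if "z \<in> ?M \<times> ?M" for z
      using that by (intro real_polynomial_function.intros(4) polyN j poly_mono[of _ k]) auto
    have poly2: "real_polynomial_function (\<lambda>\<xi>. N i j \<xi> * (\<xi> $ b) ^ (2 * k))" for b
      by (intro real_polynomial_function.intros(4) polyN j poly_coord)
    have "conv_heat t (\<lambda>\<xi>. N i j \<xi> * gram j l \<xi>) 0 (multi_partial \<alpha> (p l)) x =
        conv_heat t ?a1 0 (multi_partial \<alpha> (p l)) x + conv_heat t ?a2 0 (multi_partial \<alpha> (p l)) x"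
      unfolding split using poly1 poly2
      by (intro conv_heat_add_symbol t int real_polynomial_function_sum
          real_polynomial_function.intros(4)[OF real_polynomial_function.intros(2)])
         (auto simp: finite_multi_indices)
    also have "conv_heat t ?a1 0 (multi_partial \<alpha> (p l)) x =
        (\<Sum>z\<in>?M \<times> ?M. (BB (fst z) (bs j) \<bullet> BB (snd z) (bs l)) * U j (fst z) (snd z) l)"
      by (subst conv_heat_sum_symbol[OF poly1 t int]) (auto intro!: sum.cong simp: exchange)
    also have "conv_heat t ?a2 0 (multi_partial \<alpha> (p l)) x = (\<Sum>b\<in>UNIV. (A (bs j) \<bullet> A (bs l)) * V j b l)"
      unfolding V_def by (rule conv_heat_sum_symbol[OF poly2 t int])
    finally show ?thesis by (simp add: sum.cartesian_product case_prod_unfold)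
  qed
  \<comment> \<open>Summing the \<gamma>-derivatives of the coordinates \<open>p l\<close> against
    the vectors \<open>BB \<gamma> (bs l)\<close> rebuilds \<open>diff_op k BB P\<close>;
    \<open>BB \<beta> (bs j)\<close> is the fixed vector it is paired with.\<close>
  have F1: "conv_heat t (\<lambda>\<xi>. N i j \<xi> * monomial \<beta> \<xi> * monomial \<alpha> \<xi>) (4 * k - 1)
      (\<lambda>y. BB \<beta> (bs j) \<bullet> diff_op k BB P y) x = (\<Sum>l<d. \<Sum>\<gamma>\<in>?M. (BB \<beta> (bs j) \<bullet> BB \<gamma> (bs l)) * U j \<beta> \<gamma> l)"
    if j: "j < d" and \<beta>: "\<beta> \<in> ?M" for j \<beta>
  proof -
    have "BB \<beta> (bs j) \<bullet> diff_op k BB P y =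
        (\<Sum>z\<in>{..<d} \<times> ?M. (BB \<beta> (bs j) \<bullet> BB (snd z) (bs (fst z))) * multi_partial (snd z) (p (fst z)) y)" for y
    proof -
      have "diff_op k BB P y = (\<Sum>\<gamma>\<in>?M. \<Sum>l<d. multi_partial \<gamma> (p l) y *\<^sub>R BB \<gamma> (bs l))"
        unfolding diff_op_def mp by (intro sum.cong refl linear_expansion linear_BB)
      also have "\<dots> = (\<Sum>l<d. \<Sum>\<gamma>\<in>?M. multi_partial \<gamma> (p l) y *\<^sub>R BB \<gamma> (bs l))" by (rule sum.swap)
      finally show ?thesis
        by (simp add: inner_sum_right sum.cartesian_product case_prod_unfold mult.commute)
    qed
    moreover have "real_polynomial_function (\<lambda>\<xi>. N i j \<xi> * monomial \<beta> \<xi> * monomial \<alpha> \<xi>)"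
      by (intro real_polynomial_function.intros(4) polyN j poly_mono[OF \<beta>] poly_mono[OF \<alpha>])
    ultimately show ?thesis
      by (simp add: conv_heat_sum[OF _ t int] U_def sum.cartesian_product case_prod_unfold)
  qed
  have F2: "conv_heat t (\<lambda>\<xi>. N i j \<xi> * (\<xi> $ b) ^ (2 * k)) 0
      (\<lambda>y. A (bs j) \<bullet> multi_partial \<alpha> (\<lambda>z. A (P z)) y) x = (\<Sum>l<d. (A (bs j) \<bullet> A (bs l)) * V j b l)"
    if j: "j < d" for j b
  proof -
    have "A (bs j) \<bullet> multi_partial \<alpha> (\<lambda>z. A (P z)) y = (\<Sum>l<d. (A (bs j) \<bullet> A (bs l)) * multi_partial \<alpha> (p l) y)" for y
      unfolding multi_partial_bounded_linear[OF linear_imp_bounded_linear[OF linear_A] P] mp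
      by (subst linear_expansion[OF linear_A]) (simp add: inner_sum_right mult.commute)
    moreover have "real_polynomial_function (\<lambda>\<xi>. N i j \<xi> * (\<xi> $ b) ^ (2 * k))"
      by (intro real_polynomial_function.intros(4) polyN j poly_coord)
    ultimately show ?thesis
      by (simp add: conv_heat_sum[OF _ t int] V_def)
  qed
  \<comment> \<open>A Kronecker delta is inserted: coordinates other than \<open>i\<close> enter
    with the zero symbol, which brings the sum into the shape of row \<open>i\<close> of the matrix
    identity.\<close>
  have "conv_heat t q 0 (multi_partial \<alpha> (p i)) x =
      (\<Sum>l<d. conv_heat t (\<lambda>\<xi>. if i = l then q \<xi> else 0) 0 (multi_partial \<alpha> (p l)) x)"
  proof -
    have "conv_heat t (\<lambda>\<xi>. if i = l then q \<xi> else 0) 0 (multi_partial \<alpha> (p l)) x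
        = (if l = i then conv_heat t q 0 (multi_partial \<alpha> (p l)) x else 0)" for l
      by (auto simp: conv_heat_zero_symbol)
    then show ?thesis using i by simp
  qed
  also have "\<dots> = (\<Sum>l<d. conv_heat t (\<lambda>\<xi>. \<Sum>j<d. 1 * (N i j \<xi> * gram j l \<xi>)) 0 (multi_partial \<alpha> (p l)) x)"
    using inverse[OF i] by (intro sum.cong) auto
  also have "\<dots> = (\<Sum>l<d. \<Sum>j<d. 1 * conv_heat t (\<lambda>\<xi>. N i j \<xi> * gram j l \<xi>) 0 (multi_partial \<alpha> (p l)) x)"
    by (intro sum.cong refl conv_heat_sum_symbol t int real_polynomial_function.intros(4) polyN poly_gram) auto
  also have "\<dots> = (\<Sum>l<d. \<Sum>j<d. (\<Sum>\<beta>\<in>?M. \<Sum>\<gamma>\<in>?M. (BB \<beta> (bs j) \<bullet> BB \<gamma> (bs l)) * U j \<beta> \<gamma> l) +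
      (\<Sum>b\<in>UNIV. (A (bs j) \<bullet> A (bs l)) * V j b l))"
    by (intro sum.cong refl) (simp add: symbol_expand)
  also have "\<dots> = (\<Sum>j<d. \<Sum>l<d. (\<Sum>\<beta>\<in>?M. \<Sum>\<gamma>\<in>?M. (BB \<beta> (bs j) \<bullet> BB \<gamma> (bs l)) * U j \<beta> \<gamma> l) +
      (\<Sum>b\<in>UNIV. (A (bs j) \<bullet> A (bs l)) * V j b l))"
    by (rule sum.swap)
  also have "\<dots> = (\<Sum>j<d. (\<Sum>\<beta>\<in>?M. \<Sum>l<d. \<Sum>\<gamma>\<in>?M. (BB \<beta> (bs j) \<bullet> BB \<gamma> (bs l)) * U j \<beta> \<gamma> l)) +
      (\<Sum>j<d. \<Sum>b\<in>UNIV. \<Sum>l<d. (A (bs j) \<bullet> A (bs l)) * V j b l)"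
    unfolding sum.distrib by (intro arg_cong2[where f = "(+)"] sum.cong refl sum.swap)
  finally have "conv_heat t q 0 (multi_partial \<alpha> (p i)) x =
      (\<Sum>j<d. (\<Sum>\<beta>\<in>?M. \<Sum>l<d. \<Sum>\<gamma>\<in>?M. (BB \<beta> (bs j) \<bullet> BB \<gamma> (bs l)) * U j \<beta> \<gamma> l)) +
      (\<Sum>j<d. \<Sum>b\<in>UNIV. \<Sum>l<d. (A (bs j) \<bullet> A (bs l)) * V j b l)" .
  then show ?thesis unfolding mp[symmetric]
    by (simp only:) (intro arg_cong2[where f = "(+)"] sum.cong refl F1[symmetric] F2[symmetric]; simp)
qed

lemma component_estimate:
  assumes p: "real CARD('n) < p" and s: "s = 1 - real CARD('n) / p"
    and i: "i < d" and \<alpha>: "\<alpha> \<in> multi_indices (k - 1)"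
  shows "\<exists>C\<ge>0. \<forall>P \<nu>. P \<in> test_functions \<longrightarrow> \<nu> > 0 \<longrightarrow>
    (\<forall>j<d. \<forall>x y. \<bar>A (bs j) \<bullet> multi_partial \<alpha> (\<lambda>z. A (P z)) x - A (bs j) \<bullet> multi_partial \<alpha> (\<lambda>z. A (P z)) y\<bar>
      \<le> \<nu> * norm (x - y) powr s) \<longrightarrow>
    (\<forall>j<d. \<forall>\<beta>\<in>multi_indices k. (\<integral>y. \<bar>BB \<beta> (bs j) \<bullet> diff_op k BB P y\<bar> powr p \<partial>lborel) \<le> \<nu> powr p) \<longrightarrow>
    (\<forall>x y. \<bar>multi_partial \<alpha> P x \<bullet> bs i - multi_partial \<alpha> P y \<bullet> bs i\<bar> \<le> C * \<nu> * norm (x - y) powr s)"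
proof -
  let ?M = "multi_indices k :: ('n \<Rightarrow> nat) set"
  have p1: "p > 1" using p by (smt (verit) One_nat_def Suc_leI of_nat_1 of_nat_mono zero_less_card_finite)
  have s01: "0 < s" "s < 1" using p p1 by (auto simp: s field_simps)
  \<comment> \<open>The left summands index the terms with data in L^p, the right ones those with
    Hoelder data.\<close>
  define I where "I = ({..<d} \<times> ?M) <+> ({..<d} \<times> (UNIV :: 'n set))"
  \<comment> \<open>One factor of \<open>(\<xi> $ b) ^ (2 * k)\<close> is set apart as
    \<open>\<xi> \<bullet> axis b 1\<close>, the factor from which
    \<open>heat_bounded_Hoelder\<close> draws its cancellation.\<close>
  define a where "a = case_sum (\<lambda>(j, \<beta>) \<xi>. N i j \<xi> * monomial \<beta> \<xi> * monomial \<alpha> \<xi>)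
    (\<lambda>(j, b) \<xi>. N i j \<xi> * (\<xi> $ b) ^ (2 * k - 1) * (\<xi> \<bullet> axis b 1))"
  define m where "m = case_sum (\<lambda>_ :: nat \<times> ('n \<Rightarrow> nat). 4 * k - 1) (\<lambda>_ :: nat \<times> 'n. 0)"
  define Q where "Q = case_sum
    (\<lambda>_ :: nat \<times> ('n \<Rightarrow> nat). \<lambda>(F :: real ^ 'n \<Rightarrow> real) \<nu>. \<nu> > 0 \<and> integrable lborel (\<lambda>y. \<bar>F y\<bar> powr p) \<and>
      (\<integral>y. \<bar>F y\<bar> powr p \<partial>lborel) \<le> \<nu> powr p)
    (\<lambda>_ :: nat \<times> 'n. \<lambda>F \<nu>. \<forall>y z. \<bar>F y - F z\<bar> \<le> \<nu> * norm (y - z) powr s)"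
  have I: "finite I" unfolding I_def by (intro finite_Plus finite_cartesian_product finite_multi_indices) auto
  have heat: "heat_bounded s (a z) (m z) (Q z)" if "z \<in> I" for z
  proof (cases z)
    case (Inl w)
    obtain j \<beta> where w: "w = (j, \<beta>)" by (cases w)
    then have j: "j < d" and \<beta>: "\<beta> \<in> ?M" using that Inl by (auto simp: I_def)
    \<comment> \<open>\<open>N\<close> contributes \<open>e - 2 * k\<close>, the monomials
      \<open>k\<close> and \<open>k - 1\<close>: one degree less than \<open>q\<close>, as
      \<open>heat_bounded_Lp\<close> requires.\<close>
    have degree: "e - 2 * k + k + (k - 1) = e - 1" using e_ge_2k k by simp
    have h: "homogeneous_polynomial (e - 1) (\<lambda>\<xi>. N i j \<xi> * monomial \<beta> \<xi> * monomial \<alpha> \<xi>)"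
      using homogeneous_polynomial_mult[OF homogeneous_polynomial_mult[OF N[OF i j]
        homogeneous_polynomial_monomial[OF \<beta>]] homogeneous_polynomial_monomial[OF \<alpha>]]
      unfolding degree .
    have "s = 1 - real DIM(real ^ 'n) / p" using s by simp
    from heat_bounded_Lp[OF homogeneous_polynomialD(1)[OF h] homogeneous_polynomialD(2)[OF h] p1 this]
    show ?thesis unfolding Inl w by (simp add: a_def m_def Q_def)
  next
    case (Inr w)
    obtain j b where w: "w = (j, b)" by (cases w)
    then have j: "j < d" using that Inr by (auto simp: I_def)
    have h: "homogeneous_polynomial (e - 2 * k + (2 * k - 1)) (\<lambda>\<xi>. N i j \<xi> * (\<xi> $ b) ^ (2 * k - 1))"
      by (intro homogeneous_polynomial_mult N i j homogeneous_polynomial_coordinate_power)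
    have "e = Suc (e - 2 * k + (2 * k - 1))" using e_ge_2k k by simp
    then have re: "r ^ e = r * r ^ (e - 2 * k + (2 * k - 1))" for r :: real by (metis power_Suc)
    have "N i j (r *\<^sub>R \<xi>) * ((r *\<^sub>R \<xi>) $ b) ^ (2 * k - 1) * (r *\<^sub>R \<xi> \<bullet> axis b 1)
        = r ^ e * (N i j \<xi> * (\<xi> $ b) ^ (2 * k - 1) * (\<xi> \<bullet> axis b 1))" for r \<xi>
      unfolding homogeneous_polynomialD(2)[OF h] re by (simp only: inner_scaleR_left mult_ac)
    from heat_bounded_Hoelder[where a = "\<lambda>\<xi>. N i j \<xi> * (\<xi> $ b) ^ (2 * k - 1)" and v = "axis b 1" and m = 0,
      OF homogeneous_polynomialD(1)[OF h] this] s01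
    show ?thesis unfolding Inr w by (simp add: a_def m_def Q_def)
  qed
  from Hoelder_estimate[OF I heat s01]
  obtain C where C: "0 \<le> C \<and> (\<forall>g F \<nu> B. integrable lborel g \<longrightarrow> continuous_on UNIV g \<longrightarrow> (\<forall>x. \<bar>g x\<bar> \<le> B) \<longrightarrow>
    (\<forall>z\<in>I. integrable lborel (F z) \<and> Q z (F z) \<nu>) \<longrightarrow>
    (\<forall>t>0. \<forall>x. conv_heat t q 0 g x = (\<Sum>z\<in>I. conv_heat t (a z) (m z) (F z) x)) \<longrightarrow>
    (\<forall>x y. \<bar>g x - g y\<bar> \<le> C * \<nu> * norm (x - y) powr s))" ..
  show ?thesis
  proof (intro exI[of _ C] conjI conjunct1[OF C] allI impI)
    fix P :: "real ^ 'n \<Rightarrow> 'v" and \<nu> :: real and x y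
    assume P: "P \<in> test_functions" and \<nu>: "\<nu> > 0"
      and H: "\<forall>j<d. \<forall>x y. \<bar>A (bs j) \<bullet> multi_partial \<alpha> (\<lambda>z. A (P z)) x - A (bs j) \<bullet> multi_partial \<alpha> (\<lambda>z. A (P z)) y\<bar>
        \<le> \<nu> * norm (x - y) powr s"
      and L: "\<forall>j<d. \<forall>\<beta>\<in>?M. (\<integral>y. \<bar>BB \<beta> (bs j) \<bullet> diff_op k BB P y\<bar> powr p \<partial>lborel) \<le> \<nu> powr p"
    define g where "g y = multi_partial \<alpha> P y \<bullet> bs i" for y
    define F where "F = case_sum (\<lambda>(j, \<beta>) y. BB \<beta> (bs j) \<bullet> diff_op k BB P y)
      (\<lambda>(j, b :: 'n) y. A (bs j) \<bullet> multi_partial \<alpha> (\<lambda>z. A (P z)) y)"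
    have cs: "compactly_supported (\<lambda>y. T (multi_partial \<gamma> P y))" if "bounded_linear T"
      for T :: "'v \<Rightarrow> 'z::real_normed_vector" and \<gamma>
      unfolding multi_partial_eq
      by (rule compactly_supported_compose[OF test_function_iter_partial[OF P]])
         (use that in \<open>auto simp: linear_continuous_on bounded_linear.linear linear_0\<close>)
    have g: "compactly_supported g" unfolding g_def[abs_def] by (intro cs bounded_linear_inner_left)
    then obtain B where B: "\<forall>x. \<bar>g x\<bar> \<le> B" using compactly_supported_integrable_bounded(2) by blast
    have csB: "compactly_supported (\<lambda>y. BB \<beta> (bs j) \<bullet> diff_op k BB P y)" for j \<beta>
      unfolding diff_op_def inner_sum_right
      by (intro compactly_supported_sum finite_multi_indices cs bounded_linear_compose[OF bounded_linear_inner_right]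
          linear_imp_bounded_linear linear_BB)
    have csA: "compactly_supported (\<lambda>y. A (bs j) \<bullet> multi_partial \<alpha> (\<lambda>z. A (P z)) y)" for j
      unfolding multi_partial_bounded_linear[OF linear_imp_bounded_linear[OF linear_A] P]
      by (intro cs bounded_linear_compose[OF bounded_linear_inner_right] linear_imp_bounded_linear linear_A)
    have F: "\<forall>z\<in>I. integrable lborel (F z) \<and> Q z (F z) \<nu>"
    proof
      fix z assume z: "z \<in> I"
      show "integrable lborel (F z) \<and> Q z (F z) \<nu>"
      proof (cases z)
        case (Inl w)
        obtain j \<beta> where w: "w = (j, \<beta>)" by (cases w)
        then have "j < d" "\<beta> \<in> ?M" using z Inl by (auto simp: I_def)
        then show ?thesis
          using \<nu> L p1 compactly_supported_integrable_bounded(1)[OF csB]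
            compactly_supported_integrable_bounded(1)[OF compactly_supported_powr[OF csB, of p]]
          unfolding Inl w by (simp add: F_def Q_def)
      next
        case (Inr w)
        obtain j b where w: "w = (j, b)" by (cases w)
        then have "j < d" using z Inr by (auto simp: I_def)
        then show ?thesis
          using H compactly_supported_integrable_bounded(1)[OF csA]
          unfolding Inr w by (simp add: F_def Q_def)
      qed
    qed
    have eq: "\<forall>t>0. \<forall>x. conv_heat t q 0 g x = (\<Sum>z\<in>I. conv_heat t (a z) (m z) (F z) x)"
    proof (intro allI impI)
      fix t :: real and x assume t: "t > 0"
      have pw: "(\<xi> $ b) ^ (2 * k - 1) * (\<xi> \<bullet> axis b 1) = (\<xi> $ b) ^ (2 * k)" for \<xi> :: "real ^ 'n" and b
        using k power_minus_mult[of "2 * k" "\<xi> $ b"] by (simp add: inner_axis)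
      have "(\<Sum>z\<in>I. conv_heat t (a z) (m z) (F z) x) =
        (\<Sum>j<d. \<Sum>\<beta>\<in>?M. conv_heat t (\<lambda>\<xi>. N i j \<xi> * monomial \<beta> \<xi> * monomial \<alpha> \<xi>) (4 * k - 1)
          (\<lambda>y. BB \<beta> (bs j) \<bullet> diff_op k BB P y) x) +
        (\<Sum>j<d. \<Sum>b\<in>UNIV. conv_heat t (\<lambda>\<xi>. N i j \<xi> * (\<xi> $ b) ^ (2 * k)) 0
          (\<lambda>y. A (bs j) \<bullet> multi_partial \<alpha> (\<lambda>z. A (P z)) y) x)"
        unfolding I_def sum.cartesian_product
        by (subst sum.Plus)
           (auto simp: finite_multi_indices a_def m_def F_def pw[unfolded One_nat_def] mult.assoc intro!: arg_cong2[where f = "(+)"] sum.cong)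
      then show "conv_heat t q 0 g x = (\<Sum>z\<in>I. conv_heat t (a z) (m z) (F z) x)"
        unfolding g_def[abs_def] heat_decomposition[OF P i \<alpha> t] by simp
    qed
    have "\<forall>x y. \<bar>g x - g y\<bar> \<le> C * \<nu> * norm (x - y) powr s"
      by (rule conjunct2[OF C, rule_format, OF compactly_supported_integrable_bounded(1)[OF g] _ B[rule_format] F[rule_format] eq[rule_format], THEN allI, THEN allI])
         (use g in \<open>auto simp: compactly_supported_def\<close>)
    then show "\<bar>multi_partial \<alpha> P x \<bullet> bs i - multi_partial \<alpha> P y \<bullet> bs i\<bar> \<le> C * \<nu> * norm (x - y) powr s"
      by (simp add: g_def)
  qed
qed

end

section \<open>Existence of the inverse system and passage to the full norms\<close>

lemma (in elliptic_system) inverted_elliptic_system_exists: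
  obtains q :: "real ^ 'n \<Rightarrow> real" and e c0 N where "inverted_elliptic_system k d bs A BB q e c0 N"
proof -
  \<comment> \<open>Entries of degree \<open>2 * k\<close> give a determinant of degree
    \<open>2 * k * d\<close>, and \<open>q\<close> is its square.\<close>
  let ?e = "2 * (2 * k * d)"
  have "\<exists>q N. homogeneous_polynomial ?e q \<and> (\<forall>\<xi>. \<xi> \<noteq> 0 \<longrightarrow> q \<xi> > 0) \<and>
    (\<forall>i<d. \<forall>j<d. homogeneous_polynomial (?e - 2 * k) (N i j)) \<and>
    (\<forall>i<d. \<forall>l<d. \<forall>\<xi>. (\<Sum>j<d. N i j \<xi> * gram j l \<xi>) = (if i = l then q \<xi> else 0))"
  proof (rule polynomial_matrix_inverse[OF _ d])
    show "homogeneous_polynomial (2 * k) (gram i j)" for i j by (rule homogeneous_polynomial_gram)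
    show "c j = 0" if "\<xi> \<noteq> 0" "\<And>i. i < d \<Longrightarrow> (\<Sum>j<d. gram i j \<xi> * c j) = 0" "j < d" for \<xi> c j
      by (rule gram_injective[OF that])
  qed
  then obtain q N where q: "homogeneous_polynomial ?e q" "\<forall>\<xi>. \<xi> \<noteq> 0 \<longrightarrow> q \<xi> > 0"
    and N: "\<forall>i<d. \<forall>j<d. homogeneous_polynomial (?e - 2 * k) (N i j)"
      "\<forall>i<d. \<forall>l<d. \<forall>\<xi>. (\<Sum>j<d. N i j \<xi> * gram j l \<xi>) = (if i = l then q \<xi> else 0)"
    by blast
  have e: "2 * k \<le> ?e" "?e \<ge> 1" using k d by auto
  obtain c0 where "elliptic_polynomial q ?e c0"
    using elliptic_polynomial_if_positive[OF q(1) _ e(2)] q(2) by blast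
  then interpret elliptic_polynomial q ?e c0 .
  have "inverted_elliptic_system k d bs A BB q ?e c0 N"
    by unfold_locales (use N e in auto)
  then show ?thesis by (rule that)
qed

lemma (in elliptic_system) norm_le_sum_coordinates: "norm v \<le> (\<Sum>i<d. \<bar>v \<bullet> bs i\<bar>)"
proof -
  have "norm (bs i) = 1" if "i < d" for i
    using orthonormal[OF that that] by (simp add: norm_eq_sqrt_inner)
  then have "(\<Sum>i<d. norm ((v \<bullet> bs i) *\<^sub>R bs i)) = (\<Sum>i<d. \<bar>v \<bullet> bs i\<bar>)"
    by (intro sum.cong) auto
  then show ?thesis
    by (subst expansion) (metis norm_sum)
qed

lemma holder_deriv_seminormD:
  assumes "holder_deriv_seminorm s m u = ennreal H" "H \<ge> 0" "\<alpha> \<in> multi_indices m"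
  shows "norm (multi_partial \<alpha> u x - multi_partial \<alpha> u y) \<le> H * norm (x - y) powr s"
proof (cases "x = y")
  case False
  define l where "l = L2_set (\<lambda>\<alpha>. norm (multi_partial \<alpha> u x - multi_partial \<alpha> u y)) (multi_indices m)"
  have "ennreal (l / dist x y powr s) \<le> ennreal H"
    unfolding assms(1)[symmetric] holder_deriv_seminorm_def holder_seminorm_def l_def
    using False by (intro SUP_upper2[of "(x, y)"]) auto
  then have "l \<le> H * norm (x - y) powr s"
    using assms(2) False by (simp add: dist_norm divide_le_eq)
  moreover have "norm (multi_partial \<alpha> u x - multi_partial \<alpha> u y) \<le> l"
    unfolding l_def by (rule member_le_L2_set[OF finite_multi_indices assms(3)])
  ultimately show ?thesis by linarith
qed simp

lemma holder_deriv_seminorm_le: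
  fixes u :: "real ^ 'n::finite \<Rightarrow> 'v::real_normed_vector"
  assumes "\<And>x y. (\<Sum>\<alpha>\<in>multi_indices m. norm (multi_partial \<alpha> u x - multi_partial \<alpha> u y)) \<le> H * norm (x - y) powr s"
  shows "holder_deriv_seminorm s m u \<le> ennreal H"
  unfolding holder_deriv_seminorm_def holder_seminorm_def
proof (rule SUP_least, clarify)
  fix x y :: "real ^ 'n" assume "x \<noteq> y"
  have "L2_set (\<lambda>\<alpha>. norm (multi_partial \<alpha> u x - multi_partial \<alpha> u y)) (multi_indices m) \<le> H * norm (x - y) powr s"
    by (rule order_trans[OF L2_set_le_sum assms]) simp
  then have "L2_set (\<lambda>\<alpha>. norm (multi_partial \<alpha> u x - multi_partial \<alpha> u y)) (multi_indices m) / dist x y powr s \<le> H"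
    using \<open>x \<noteq> y\<close> by (simp add: dist_norm divide_le_eq)
  then show "ennreal (L2_set (\<lambda>\<alpha>. norm (multi_partial \<alpha> u x - multi_partial \<alpha> u y)) (multi_indices m) / dist x y powr s)
      \<le> ennreal H" by (rule ennreal_leI)
qed

text \<open>A bridge from the extended norm of a vector function to the Bochner integral of a scalar
  function dominated by it. The slack between \<open>K * L\<close> and \<open>\<nu>\<close> later
  admits a positive error term.\<close>

lemma Lp_normD:
  assumes L: "Lp_norm p u = ennreal L" "L \<ge> 0" and p: "p > 0"
    and le: "\<And>y. \<bar>f y\<bar> \<le> K * norm (u y)" and K: "K \<ge> 0"
    and u: "continuous_on UNIV u" and f: "f \<in> borel_measurable borel" and \<nu>: "K * L \<le> \<nu>"
  shows "(\<integral>y. \<bar>f y\<bar> powr p \<partial>lborel) \<le> \<nu> powr p"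
proof -
  define J where "J = (\<integral>\<^sup>+ x. ennreal (norm (u x) powr p) \<partial>lborel)"
  \<comment> \<open>A finite norm rules out the infinite branch of \<open>Lp_norm\<close>, so
    \<open>enn2real\<close> loses nothing.\<close>
  have "J \<noteq> \<infinity>" using L(1) by (auto simp: Lp_norm_def J_def[symmetric])
  then have J: "J = ennreal (enn2real J)" by (simp add: less_top)
  have "L = enn2real J powr (1 / p)"
    using L \<open>J \<noteq> \<infinity>\<close> by (simp add: Lp_norm_def J_def[symmetric])
  then have LJ: "L powr p = enn2real J" using p by (simp add: powr_powr)
  have meas: "(\<lambda>y. norm (u y) powr p) \<in> borel_measurable borel"
    by (intro borel_measurable_continuous_onI continuous_on_powr' continuous_on_norm u continuous_on_const)
       (use p in auto)
  have "(\<integral>\<^sup>+ y. ennreal (\<bar>f y\<bar> powr p) \<partial>lborel) \<le> (\<integral>\<^sup>+ y. ennreal (K powr p) * ennreal (norm (u y) powr p) \<partial>lborel)"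
    using le K p by (intro nn_integral_mono) (simp add: powr_mono2 flip: ennreal_mult powr_mult)
  also have "\<dots> = ennreal (K powr p) * J"
    unfolding J_def using meas by (intro nn_integral_cmult) simp
  also have "\<dots> = ennreal ((K * L) powr p)"
    using K L(2) by (subst J) (simp add: LJ powr_mult flip: ennreal_mult)
  also have "\<dots> \<le> ennreal (\<nu> powr p)"
    using K L(2) p \<nu> by (intro ennreal_leI powr_mono2) auto
  finally have "enn2real (\<integral>\<^sup>+ y. ennreal (\<bar>f y\<bar> powr p) \<partial>lborel) \<le> \<nu> powr p"
    by (rule enn2real_leI[rotated]) simp
  then show ?thesis using f by (subst integral_eq_nn_integral) auto
qed

theorem mainTheorem4:
  fixes k :: nat and p s :: real
    and A :: "'v::real_inner \<Rightarrow> 'u::real_inner"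
    and BB :: "('n::finite \<Rightarrow> nat) \<Rightarrow> 'v \<Rightarrow> 'w::real_inner"
  assumes "finite_dimensional TYPE('v)"
    and "finite_dimensional TYPE('u)"
    and "finite_dimensional TYPE('w)"
    and "k \<ge> 1"
    and "real CARD('n) < p"
    and "s = 1 - real CARD('n) / p"
    and "linear A"
    and "\<And>\<alpha>. \<alpha> \<in> multi_indices k \<Longrightarrow> linear (BB \<alpha>)"
    and "(\<Union>\<xi>\<in>UNIV - {0 :: real ^ 'n}. {v. A v = 0} \<inter> {v. symbol k BB \<xi> v = 0}) = {0}"
  shows "\<exists>c>0. \<forall>P :: real ^ 'n \<Rightarrow> 'v. P \<in> test_functions \<longrightarrow>
    holder_deriv_seminorm s (k - 1) P \<le>
      ennreal c * (holder_deriv_seminorm s (k - 1) (\<lambda>x. A (P x)) + Lp_norm p (diff_op k BB P))"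
proof -
  obtain d and bs :: "nat \<Rightarrow> 'v" where
    orth: "\<And>i j. i < d \<Longrightarrow> j < d \<Longrightarrow> bs i \<bullet> bs j = (if i = j then 1 else 0)"
    and expansion: "\<And>v. v = (\<Sum>i<d. (v \<bullet> bs i) *\<^sub>R bs i)"
    using orthonormal_basis_enumeration[OF assms(1)] by blast
  show ?thesis
  proof (cases "d = 0")
    \<comment> \<open>The space of values is zero, so the left-hand side vanishes and any positive
      constant will do.\<close>
    case True
    then have v0: "v = 0" for v :: 'v using expansion[of v] by simp
    have "holder_deriv_seminorm s (k - 1) P \<le> ennreal 0" for P :: "real ^ 'n \<Rightarrow> 'v"
    proof (rule holder_deriv_seminorm_le)
      fix x y :: "real ^ 'n"
      have norm0: "norm (v :: 'v) = 0" for v using v0[of v] by simp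
      show "(\<Sum>\<alpha>\<in>multi_indices (k - 1). norm (multi_partial \<alpha> P x - multi_partial \<alpha> P y)) \<le> 0 * norm (x - y) powr s"
        unfolding norm0 by simp
    qed
    then show ?thesis by (intro exI[of _ 1]) auto
  next
    case False
    interpret elliptic_system k d bs A BB
    proof (rule elliptic_system.intro)
      fix \<xi> :: "real ^ 'n" and v assume "\<xi> \<noteq> 0" "A v = 0" "symbol k BB \<xi> v = 0"
      then have "v \<in> (\<Union>\<xi>\<in>UNIV - {0 :: real ^ 'n}. {v. A v = 0} \<inter> {v. symbol k BB \<xi> v = 0})" by blast
      then show "v = 0" unfolding assms(9) by simp
    qed (use assms False orth expansion in auto)
    obtain q e c0 N where "inverted_elliptic_system k d bs A BB q e c0 N"
      by (rule inverted_elliptic_system_exists)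
    then interpret inverted_elliptic_system k d bs A BB q e c0 N .
    let ?M = "multi_indices k :: ('n \<Rightarrow> nat) set" and ?M' = "multi_indices (k - 1) :: ('n \<Rightarrow> nat) set"
    have "\<forall>z\<in>{..<d} \<times> ?M'. \<exists>C\<ge>0. \<forall>P \<nu>. P \<in> test_functions \<longrightarrow> \<nu> > 0 \<longrightarrow>
      (\<forall>j<d. \<forall>x y. \<bar>A (bs j) \<bullet> multi_partial (snd z) (\<lambda>z. A (P z)) x - A (bs j) \<bullet> multi_partial (snd z) (\<lambda>z. A (P z)) y\<bar>
        \<le> \<nu> * norm (x - y) powr s) \<longrightarrow>
      (\<forall>j<d. \<forall>\<beta>\<in>?M. (\<integral>y. \<bar>BB \<beta> (bs j) \<bullet> diff_op k BB P y\<bar> powr p \<partial>lborel) \<le> \<nu> powr p) \<longrightarrow>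
      (\<forall>x y. \<bar>multi_partial (snd z) P x \<bullet> bs (fst z) - multi_partial (snd z) P y \<bullet> bs (fst z)\<bar>
        \<le> C * \<nu> * norm (x - y) powr s)"
      by (intro ballI component_estimate assms(5,6)) auto
    from bchoice[OF this] obtain C where C: "\<forall>z\<in>{..<d} \<times> ?M'. C z \<ge> 0 \<and> (\<forall>P \<nu>. P \<in> test_functions \<longrightarrow> \<nu> > 0 \<longrightarrow>
      (\<forall>j<d. \<forall>x y. \<bar>A (bs j) \<bullet> multi_partial (snd z) (\<lambda>z. A (P z)) x - A (bs j) \<bullet> multi_partial (snd z) (\<lambda>z. A (P z)) y\<bar>
        \<le> \<nu> * norm (x - y) powr s) \<longrightarrow>
      (\<forall>j<d. \<forall>\<beta>\<in>?M. (\<integral>y. \<bar>BB \<beta> (bs j) \<bullet> diff_op k BB P y\<bar> powr p \<partial>lborel) \<le> \<nu> powr p) \<longrightarrow>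
      (\<forall>x y. \<bar>multi_partial (snd z) P x \<bullet> bs (fst z) - multi_partial (snd z) P y \<bullet> bs (fst z)\<bar>
        \<le> C z * \<nu> * norm (x - y) powr s))" ..
    \<comment> \<open>\<open>K\<close> dominates all vectors with which the data are paired, so
      Cauchy-Schwarz bounds the scalar terms by the full norms; the summand 1 makes it
      positive.\<close>
    define K where "K = 1 + (\<Sum>j<d. norm (A (bs j))) + (\<Sum>j<d. \<Sum>\<beta>\<in>?M. norm (BB \<beta> (bs j)))"
    have KA: "norm (A (bs j)) \<le> K" if "j < d" for j
    proof -
      have "norm (A (bs j)) \<le> (\<Sum>j<d. norm (A (bs j)))" using that by (intro member_le_sum) auto
      moreover have "0 \<le> (\<Sum>j<d. \<Sum>\<beta>\<in>?M. norm (BB \<beta> (bs j)))" by (intro sum_nonneg) auto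
      ultimately show ?thesis by (simp add: K_def)
    qed
    have KB: "norm (BB \<beta> (bs j)) \<le> K" if "j < d" "\<beta> \<in> ?M" for j \<beta>
    proof -
      have "norm (BB \<beta> (bs j)) \<le> (\<Sum>\<beta>\<in>?M. norm (BB \<beta> (bs j)))"
        using that by (intro member_le_sum finite_multi_indices) auto
      also have "\<dots> \<le> (\<Sum>j<d. \<Sum>\<beta>\<in>?M. norm (BB \<beta> (bs j)))"
        using that by (intro member_le_sum[where f = "\<lambda>j. \<Sum>\<beta>\<in>?M. norm (BB \<beta> (bs j))"] sum_nonneg) auto
      moreover have "0 \<le> (\<Sum>j<d. norm (A (bs j)))" by (intro sum_nonneg) auto
      ultimately show ?thesis by (simp add: K_def)
    qed
    have K: "K > 0" unfolding K_def by (intro add_pos_nonneg sum_nonneg) auto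
    define D where "D = (\<Sum>\<alpha>\<in>?M'. \<Sum>i<d. C (i, \<alpha>)) * K"
    have D: "D \<ge> 0" unfolding D_def using C K by (intro mult_nonneg_nonneg sum_nonneg) auto
    \<comment> \<open>\<open>D\<close> may vanish, hence \<open>D + 1\<close>. In
      \<open>ennreal\<close> the product of 0 and \<infinity> is 0, so a positive constant is also
      what settles an infinite right-hand side.\<close>
    show ?thesis
    proof (intro exI[of _ "D + 1"] conjI allI impI)
      show "0 < D + 1" using D by simp
      fix P :: "real ^ 'n \<Rightarrow> 'v" assume P: "P \<in> test_functions"
      let ?AP = "\<lambda>x. A (P x)"
      show "holder_deriv_seminorm s (k - 1) P \<le>
        ennreal (D + 1) * (holder_deriv_seminorm s (k - 1) ?AP + Lp_norm p (diff_op k BB P))"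
      proof (cases "holder_deriv_seminorm s (k - 1) ?AP = \<infinity> \<or> Lp_norm p (diff_op k BB P) = \<infinity>")
        case True
        then show ?thesis using D by (auto simp: ennreal_mult_top)
      next
        case False
        define H where "H = enn2real (holder_deriv_seminorm s (k - 1) ?AP)"
        define L where "L = enn2real (Lp_norm p (diff_op k BB P))"
        have H: "holder_deriv_seminorm s (k - 1) ?AP = ennreal H" "H \<ge> 0"
          and L: "Lp_norm p (diff_op k BB P) = ennreal L" "L \<ge> 0"
          using False by (simp_all add: H_def L_def less_top)
        have p0: "p > 0" using assms(5) by (meson of_nat_0_le_iff order_le_less_trans)
        have cont: "continuous_on UNIV (diff_op k BB P)"
          unfolding diff_op_def[abs_def] multi_partial_eq
          using test_function_iter_partial[OF P] unfolding compactly_supported_def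
          by (intro continuous_on_sum)
             (auto intro!: continuous_on_compose2[OF linear_continuous_on[OF linear_imp_bounded_linear[OF linear_BB]]])
        \<comment> \<open>\<open>component_estimate\<close> asks for a positive size, but
          \<open>H + L\<close> can be 0; the error \<open>\<epsilon>\<close> is removed
          below.\<close>
        have coordinate: "\<bar>multi_partial \<alpha> P x \<bullet> bs i - multi_partial \<alpha> P y \<bullet> bs i\<bar>
            \<le> C (i, \<alpha>) * (K * (H + L + \<epsilon>)) * norm (x - y) powr s"
          if i: "i < d" and \<alpha>: "\<alpha> \<in> ?M'" and \<epsilon>: "\<epsilon> > 0" for i \<alpha> \<epsilon> x y
        proof -
          have iz: "(i, \<alpha>) \<in> {..<d} \<times> ?M'" using i \<alpha> by simp
          have \<nu>: "0 < K * (H + L + \<epsilon>)" using K H L \<epsilon> by (intro mult_pos_pos) auto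
          have hA: "\<bar>A (bs j) \<bullet> multi_partial \<alpha> ?AP x - A (bs j) \<bullet> multi_partial \<alpha> ?AP y\<bar>
              \<le> K * (H + L + \<epsilon>) * norm (x - y) powr s" if j: "j < d" for j x y
          proof -
            have "\<bar>A (bs j) \<bullet> multi_partial \<alpha> ?AP x - A (bs j) \<bullet> multi_partial \<alpha> ?AP y\<bar>
                \<le> norm (A (bs j)) * norm (multi_partial \<alpha> ?AP x - multi_partial \<alpha> ?AP y)"
              unfolding inner_diff_right[symmetric] by (rule Cauchy_Schwarz_ineq2)
            also have "\<dots> \<le> K * (H * norm (x - y) powr s)"
              using K by (intro mult_mono KA j holder_deriv_seminormD[OF H \<alpha>]) auto
            also have "\<dots> \<le> K * ((H + L + \<epsilon>) * norm (x - y) powr s)"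
              using K L \<epsilon> by (intro mult_left_mono mult_right_mono) auto
            finally show ?thesis by (simp add: mult.assoc)
          qed
          have hB: "(\<integral>y. \<bar>BB \<beta> (bs j) \<bullet> diff_op k BB P y\<bar> powr p \<partial>lborel) \<le> (K * (H + L + \<epsilon>)) powr p"
            if j: "j < d" and \<beta>: "\<beta> \<in> ?M" for j \<beta>
          proof (rule Lp_normD[OF L p0, where K = K])
            show "\<bar>BB \<beta> (bs j) \<bullet> diff_op k BB P y\<bar> \<le> K * norm (diff_op k BB P y)" for y
              by (rule order_trans[OF Cauchy_Schwarz_ineq2 mult_right_mono[OF KB[OF j \<beta>]]]) simp
            show "(\<lambda>y. BB \<beta> (bs j) \<bullet> diff_op k BB P y) \<in> borel_measurable borel"
              by (intro borel_measurable_continuous_onI continuous_intros cont)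
            show "K * L \<le> K * (H + L + \<epsilon>)" using K H \<epsilon> by (intro mult_left_mono) auto
          qed (use K cont in auto)
          have all: "P \<in> test_functions \<longrightarrow> K * (H + L + \<epsilon>) > 0 \<longrightarrow>
            (\<forall>j<d. \<forall>x y. \<bar>A (bs j) \<bullet> multi_partial \<alpha> ?AP x - A (bs j) \<bullet> multi_partial \<alpha> ?AP y\<bar>
              \<le> K * (H + L + \<epsilon>) * norm (x - y) powr s) \<longrightarrow>
            (\<forall>j<d. \<forall>\<beta>\<in>?M. (\<integral>y. \<bar>BB \<beta> (bs j) \<bullet> diff_op k BB P y\<bar> powr p \<partial>lborel) \<le> (K * (H + L + \<epsilon>)) powr p) \<longrightarrow>
            (\<forall>x y. \<bar>multi_partial \<alpha> P x \<bullet> bs i - multi_partial \<alpha> P y \<bullet> bs i\<bar>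
              \<le> C (i, \<alpha>) * (K * (H + L + \<epsilon>)) * norm (x - y) powr s)"
            using conjunct2[OF bspec[OF C iz], THEN spec[where x = P], THEN spec[where x = "K * (H + L + \<epsilon>)"]]
            unfolding fst_conv snd_conv .
          show ?thesis
            using all[THEN mp, OF P, THEN mp, OF \<nu>] hA hB by blast
        qed
        have "(\<Sum>\<alpha>\<in>?M'. norm (multi_partial \<alpha> P x - multi_partial \<alpha> P y)) \<le> (D * (H + L)) * norm (x - y) powr s" for x y
        proof (rule field_le_epsilon)
          fix \<delta> :: real assume \<delta>: "\<delta> > 0"
          \<comment> \<open>Chosen so that the error term is at most \<open>\<delta>\<close>; the
            summand 1 keeps the denominator positive.\<close>
          define \<epsilon> where "\<epsilon> = \<delta> / (D * norm (x - y) powr s + 1)"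
          have den: "D * norm (x - y) powr s + 1 > 0" using D by (intro add_nonneg_pos) auto
          have \<epsilon>: "\<epsilon> > 0" using \<delta> den by (simp add: \<epsilon>_def)
          have "(\<Sum>\<alpha>\<in>?M'. norm (multi_partial \<alpha> P x - multi_partial \<alpha> P y))
              \<le> (\<Sum>\<alpha>\<in>?M'. \<Sum>i<d. \<bar>multi_partial \<alpha> P x \<bullet> bs i - multi_partial \<alpha> P y \<bullet> bs i\<bar>)"
            unfolding inner_diff_left[symmetric] by (intro sum_mono norm_le_sum_coordinates)
          also have "\<dots> \<le> (\<Sum>\<alpha>\<in>?M'. \<Sum>i<d. C (i, \<alpha>) * (K * (H + L + \<epsilon>)) * norm (x - y) powr s)"
            using \<epsilon> by (intro sum_mono coordinate) auto
          also have "\<dots> = D * (H + L + \<epsilon>) * norm (x - y) powr s"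
            by (simp only: D_def sum_distrib_right mult.assoc)
          also have "\<dots> = D * (H + L) * norm (x - y) powr s + \<epsilon> * (D * norm (x - y) powr s)"
            by (simp add: algebra_simps)
          also have "\<epsilon> * (D * norm (x - y) powr s) \<le> \<epsilon> * (D * norm (x - y) powr s + 1)"
            using \<epsilon> by (intro mult_left_mono) auto
          also have "\<dots> = \<delta>" using den by (simp add: \<epsilon>_def)
          finally show "(\<Sum>\<alpha>\<in>?M'. norm (multi_partial \<alpha> P x - multi_partial \<alpha> P y))
              \<le> D * (H + L) * norm (x - y) powr s + \<delta>" by simp
        qed
        then have "holder_deriv_seminorm s (k - 1) P \<le> ennreal (D * (H + L))"
          by (rule holder_deriv_seminorm_le)
        also have "\<dots> \<le> ennreal ((D + 1) * (H + L))"
          using H L D by (intro ennreal_leI mult_right_mono) auto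
        also have "\<dots> = ennreal (D + 1) * (holder_deriv_seminorm s (k - 1) ?AP + Lp_norm p (diff_op k BB P))"
          unfolding H(1) L(1) using H(2) L(2) D by (simp add: ennreal_mult' flip: ennreal_plus)
        finally show ?thesis .
      qed
    qed
  qed
qed

end
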